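(* Let $q \ge 2$ be an integer and let $G$ be a $(\mathrm{cap}, \mathrm{even\ hole})$-free graph with no odd hole of length at most $2q-1$. Then $$\chi_f(G)\le \frac{2q+1}{2q}\,\omega(G).$$
   Context: Graphs are finite and simple. $\chi_f(G)$ is the fractional chromatic number and $\omega(G)$ the clique number of $G$. A hole in a graph is an induced cycle of length at least $4$; it is even or odd if it has an even or odd number of vertices (its length). A cap is a graph consisting of a hole together with one additional vertex whose neighbors on the hole are exactly two vertices, and these two are consecutive on the hole. A graph $G$ is $H$-free if no induced subgraph of $G$ is isomorphic to $H$. $G$ is $(\mathrm{cap},\mathrm{even\ hole})$-free if it contains no cap as an induced subgraph and has no even hole. *)

theory Defs
  imports Complex_Main "Graph_Theory.Pair_Digraph" "Graph_Theory.Digraph_Component"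
begin

text \<open>
  A finite simple graph is a \<^locale>\<open>pair_graph\<close>: the arc set is a finite, symmetric,
  irreflexive relation, so an edge \<open>uv\<close> is represented by both \<open>(u, v)\<close> and \<open>(v, u)\<close>.
  The graph without vertices is allowed.
\<close>

definition is_cycle :: "nat \<Rightarrow> 'a pair_pre_digraph \<Rightarrow> bool" where
  "is_cycle n C \<longleftrightarrow> n \<ge> 3 \<and>
    (\<exists>v. bij_betw v {..<n} (pverts C) \<and>
         parcs C = (\<Union>i<n. {(v i, v (Suc i mod n)), (v (Suc i mod n), v i)}))"

definition hole :: "'a pair_pre_digraph \<Rightarrow> 'a pair_pre_digraph \<Rightarrow> bool" where
  "hole G C \<longleftrightarrow> induced_subgraph (with_proj C) (with_proj G) \<and> (\<exists>n\<ge>4. is_cycle n C)"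

abbreviation hole_length :: "'a pair_pre_digraph \<Rightarrow> nat" where
  "hole_length C \<equiv> card (pverts C)"

definition is_cap :: "'a pair_pre_digraph \<Rightarrow> bool" where
  "is_cap K \<longleftrightarrow> pair_graph K \<and>
    (\<exists>C x. hole K C \<and> x \<notin> pverts C \<and> pverts K = insert x (pverts C) \<and>
      (\<exists>(u, v) \<in> parcs C. {w \<in> pverts C. (x, w) \<in> parcs K} = {u, v}))"

text \<open>Being a cap is invariant under isomorphism, so no isomorphism appears below.\<close>

definition cap_free :: "'a pair_pre_digraph \<Rightarrow> bool" where
  "cap_free G \<longleftrightarrow> \<not> (\<exists>K. induced_subgraph (with_proj K) (with_proj G) \<and> is_cap K)"

definition even_hole_free :: "'a pair_pre_digraph \<Rightarrow> bool" where
  "even_hole_free G \<longleftrightarrow> \<not> (\<exists>C. hole G C \<and> even (hole_length C))"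

definition clique :: "'a pair_pre_digraph \<Rightarrow> 'a set \<Rightarrow> bool" where
  "clique G K \<longleftrightarrow> K \<subseteq> pverts G \<and> pairwise (\<lambda>u v. (u, v) \<in> parcs G) K"

definition stable_set :: "'a pair_pre_digraph \<Rightarrow> 'a set \<Rightarrow> bool" where
  "stable_set G S \<longleftrightarrow> S \<subseteq> pverts G \<and> pairwise (\<lambda>u v. (u, v) \<notin> parcs G) S"

text \<open>The empty set is a clique, so the clique number of the graph without vertices is \<open>0\<close>.\<close>

definition clique_number :: "'a pair_pre_digraph \<Rightarrow> nat" where
  "clique_number G = Max {card K |K. clique G K}"

definition fractional_colouring :: "'a pair_pre_digraph \<Rightarrow> ('a set \<Rightarrow> real) \<Rightarrow> bool" where
  "fractional_colouring G w \<longleftrightarrow>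
    (\<forall>S. stable_set G S \<longrightarrow> w S \<ge> 0) \<and>
    (\<forall>v\<in>pverts G. (\<Sum>S | stable_set G S \<and> v \<in> S. w S) \<ge> 1)"

text \<open>
  The optimum of the fractional colouring linear program. For a finite graph the infimum
  is over a nonempty set (weight \<open>1\<close> on every stable set is feasible) bounded below by \<open>0\<close>.
\<close>

definition fractional_chromatic_number :: "'a pair_pre_digraph \<Rightarrow> real" where
  "fractional_chromatic_number G =
    Inf {(\<Sum>S | stable_set G S. w S) |w. fractional_colouring G w}"

end

theory Submission
  imports Defs
begin

text \<open>
  The bound is proved in a weighted and integral form, \<open>weighted_colouring\<close>: if every clique has weight at most
  \<open>\<Omega>\<close>, then each vertex \<open>v\<close> can be given \<open>2 * q * w v\<close> out of \<open>(2 * q + 1) * \<Omega>\<close> colours so that adjacent vertices share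
  no colour. With unit weights and \<open>\<Omega> = \<omega>(G)\<close>, the colour classes, each with weight \<open>1 / (2 * q)\<close>, form a fractional
  colouring of the required total weight.

  Weights make an induction on the number of vertices possible. Colourings can be glued along a clique cutset, two
  adjacent vertices with the same other neighbours can be merged into one vertex carrying the sum of their weights,
  and a vertex adjacent to all others can be removed together with its share of \<open>\<Omega>\<close>. By \<open>indecomposable_triangle_free\<close>,
  a graph without caps and even holes to which none of these reductions applies is triangle-free. To see this, take
  a largest triangle-free induced subgraph \<open>F\<close> without clique cutset on at least five vertices. A vertex outside \<open>F\<close>
  is adjacent to all of \<open>F\<close>, or a copy of a vertex of \<open>F\<close>, or has at most one neighbour in \<open>F\<close>
  (\<open>core_attachment\<close>, \<open>max_core_types\<close>). A component of the vertices of the third kind would be cut off by a clique,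
  because otherwise a path through it could be added to \<open>F\<close> (\<open>loose_component_clique\<close>).

  For a triangle-free graph, a clique is an edge or a single vertex, and the polytope of the vectors \<open>x\<close> with \<open>x u + x v \<le> 1\<close> for all
  edges has half-integral vertices. The discrete counterpart \<open>set_colouring_layers\<close> of this fact reduces the weighted
  statement to the existence of a Kneser colouring: a \<open>q\<close>-element set of colours out of \<open>2 * q + 1\<close> for each vertex, with
  disjoint sets on adjacent vertices. Such a colouring exists when all holes are odd and have length at least
  \<open>2 * q + 1\<close> (\<open>kneser_colouring_extends\<close>). The induction for it proves more: a colouring of a hole that no
  outside vertex sees twice extends to the whole graph. If the rest of the graph is attached to such a hole in
  nonadjacent vertices, a shortest path \<open>P\<close> between nonadjacent attachments runs around a single vertex \<open>y\<close> of the hole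
  (\<open>shortest_ear\<close>). Between consecutive neighbours of \<open>y\<close>, the path \<open>P\<close> is as long as the colouring needs, and \<open>y\<close> has a
  neighbour inside \<open>P\<close>, so that \<open>P\<close> can be coloured whatever the colours on the hole are (\<open>kneser_col_ear\<close>). The hole and \<open>P\<close>
  form a wheel with hub \<open>y\<close>. A parity argument shows that whatever remains is attached to it component by component within a
  single hole (\<open>wheel_attachments\<close>), to which the induction hypothesis applies.
\<close>

section \<open>Paths, connected sets and holes\<close>

text \<open>
  Only the adjacency relation is fixed. A graph is a set of vertices with the adjacency induced on it, so that induced
  subgraphs are subsets.
\<close>

locale simple_graph =
  fixes E :: "'a \<Rightarrow> 'a \<Rightarrow> bool"
  assumes E_sym: "E u v \<Longrightarrow> E v u"
    and E_irrefl [simp]: "\<not> E u u"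
begin

lemma E_commute: "E u v \<longleftrightarrow> E v u"
  using E_sym by blast

fun ipath :: "'a list \<Rightarrow> bool" where
  "ipath [] = True"
| "ipath (x # p) = (ipath p \<and> x \<notin> set p \<and> (\<forall>u\<in>set p. E x u \<longleftrightarrow> u = hd p))"

lemma ipath_distinct: "ipath p \<Longrightarrow> distinct p"
  by (induction p) auto

lemma ipath_append:
  "ipath (p @ q) \<longleftrightarrow> ipath p \<and> ipath q \<and> set p \<inter> set q = {} \<and>
     (\<forall>u\<in>set p. \<forall>v\<in>set q. E u v \<longleftrightarrow> u = last p \<and> v = hd q)"
proof (induction p)
  case Nil
  show ?case by simp
next
  case (Cons x p)
  show ?case
  proof (cases "p = []")
    case True
    then show ?thesis by auto
  next
    case False
    have l: "last (x # p) = last p" "last p \<in> set p" using False by auto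
    have h: "hd (p @ q) = hd p" "hd p \<in> set p" using False by auto
    show ?thesis
      unfolding append_Cons ipath.simps Cons.IH l(1) h(1)
      using l(2) h(2) by auto
  qed
qed

lemma ipath_rev: "ipath p \<Longrightarrow> ipath (rev p)"
proof (induction p)
  case (Cons x p)
  then show ?case
    by (cases "p = []") (auto simp: ipath_append last_rev E_commute[of _ x])
qed simp

lemma ipath_sublist: "ipath (a @ m @ b) \<Longrightarrow> ipath m"
  by (simp add: ipath_append)

lemma ipath_imp_successively: "ipath p \<Longrightarrow> successively E p"
proof (induction p)
  case (Cons x p) then show ?case by (cases p) auto
qed simp

lemma ipathI_shortest:
  assumes "successively E p"
    and "\<And>a x m u b. p = a @ x # m @ u # b \<Longrightarrow> x \<noteq> u \<and> (m \<noteq> [] \<longrightarrow> \<not> E x u)"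
  shows "ipath p"
  using assms
proof (induction p)
  case (Cons x p)
  have "ipath p"
    using Cons.prems(1) Cons.prems(2)[of "x # _"] by (intro Cons.IH) (auto simp: successively_Cons)
  moreover have "x \<notin> set p"
    using Cons.prems(2)[of "[]" x] by (metis append_Nil append_Cons split_list)
  moreover have "E x u \<longleftrightarrow> u = hd p" if u: "u \<in> set p" for u
  proof -
    obtain m b where p: "p = m @ u # b" using u by (meson split_list)
    show ?thesis
    proof (cases "m = []")
      case True
      then show ?thesis using Cons.prems(1) p by auto
    next
      case False
      have "\<not> E x u" using Cons.prems(2)[of "[]" x m u b] p False by simp
      moreover have "u \<noteq> hd p"
        using Cons.prems(2)[of "[x]" "hd m" "tl m" u b] p False by (cases m) auto
      ultimately show ?thesis by simp
    qed
  qed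
  ultimately show ?case by simp
qed simp

text \<open>
  Shortcuts keep the two ends of a walk, so a shortest walk with a given property \<open>R\<close> of its ends is an induced path.
  The relation \<open>R\<close> is arbitrary because some of the paths needed below have ends that are constrained jointly.
\<close>

lemma shortest_walk:
  assumes "R (hd p0) (last p0)" "p0 \<noteq> []" "successively E p0" "set p0 \<subseteq> D"
  obtains p where "p \<noteq> []" "ipath p" "set p \<subseteq> D" "R (hd p) (last p)"
    "\<And>p'. p' \<noteq> [] \<Longrightarrow> successively E p' \<Longrightarrow> set p' \<subseteq> D \<Longrightarrow> R (hd p') (last p') \<Longrightarrow> length p \<le> length p'"
proof -
  let ?W = "\<lambda>p. p \<noteq> [] \<and> successively E p \<and> set p \<subseteq> D \<and> R (hd p) (last p)"
  obtain p where p: "?W p" "\<And>p'. ?W p' \<Longrightarrow> length p \<le> length p'"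
    using ex_has_least_nat[of ?W p0 length] assms by blast
  have "ipath p"
  proof (rule ipathI_shortest)
    fix a x m u b
    assume eq: "p = a @ x # m @ u # b"
    have s: "successively E (a @ [x])" "successively E (u # b)"
      using p(1) unfolding eq by (auto simp: successively_append_iff successively_Cons)
    show "x \<noteq> u \<and> (m \<noteq> [] \<longrightarrow> \<not> E x u)"
    proof (rule ccontr)
      assume neg: "\<not> ?thesis"
      define p' where "p' = (if x = u then a @ u # b else a @ x # u # b)"
      have "successively E p'"
        using s neg by (auto simp: p'_def successively_append_iff)
      moreover have "hd p' = hd p" "last p' = last p" "set p' \<subseteq> set p" "p' \<noteq> []"
        by (auto simp: p'_def eq hd_append)
      ultimately have "length p \<le> length p'" using p(1) p(2)[of p'] by auto
      with neg show False by (auto simp: p'_def eq split: if_splits)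
    qed
  qed (use p in auto)
  with p that show thesis by blast
qed

text \<open>
  Connectedness is expressed by sets closed under adjacency. This makes it easy to verify; walks are extracted from it only
  where a path is needed.
\<close>

definition conn :: "'a set \<Rightarrow> bool" where
  "conn D \<longleftrightarrow> (\<forall>A \<subseteq> D. A \<noteq> {} \<longrightarrow> (\<forall>x\<in>A. \<forall>y\<in>D. E x y \<longrightarrow> y \<in> A) \<longrightarrow> A = D)"

lemma connD:
  assumes "conn D" "A \<subseteq> D" "a \<in> A" "\<And>x y. x \<in> A \<Longrightarrow> y \<in> D \<Longrightarrow> E x y \<Longrightarrow> y \<in> A"
  shows "A = D"
  using assms unfolding conn_def by blast

lemma conn_walk:
  assumes "conn D" "a \<in> D" "b \<in> D"
  obtains p where "p \<noteq> []" "hd p = a" "last p = b" "successively E p" "set p \<subseteq> D"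
proof -
  let ?A = "{x\<in>D. \<exists>p. p \<noteq> [] \<and> hd p = a \<and> last p = x \<and> successively E p \<and> set p \<subseteq> D}"
  have "?A = D"
  proof (rule connD[OF assms(1), of _ a])
    show "a \<in> ?A" using assms(2) by (auto intro!: exI[of _ "[a]"])
  next
    fix x y assume "x \<in> ?A" "y \<in> D" "E x y"
    then obtain p where "p \<noteq> []" "hd p = a" "last p = x" "successively E p" "set p \<subseteq> D" by auto
    with \<open>y \<in> D\<close> \<open>E x y\<close> show "y \<in> ?A"
      by (auto intro!: exI[of _ "p @ [y]"] simp: successively_append_iff)
  qed auto
  with assms(3) that show thesis by blast
qed

lemma shortest_path:
  assumes "conn D" "a \<in> D" "b \<in> D" "R a b"
  obtains p where "p \<noteq> []" "ipath p" "set p \<subseteq> D" "R (hd p) (last p)"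
    "\<And>p'. p' \<noteq> [] \<Longrightarrow> successively E p' \<Longrightarrow> set p' \<subseteq> D \<Longrightarrow> R (hd p') (last p') \<Longrightarrow> length p \<le> length p'"
  using conn_walk[OF assms(1-3)] shortest_walk[of R _ D] assms(4) by metis

lemma shortest_sub:
  assumes "\<And>p'. p' \<noteq> [] \<Longrightarrow> successively E p' \<Longrightarrow> set p' \<subseteq> D \<Longrightarrow> R (hd p') (last p') \<Longrightarrow> length p \<le> length p'"
    and "ipath p" "set p \<subseteq> D" "p = a @ m @ b" "m \<noteq> []" "a \<noteq> [] \<or> b \<noteq> []"
  shows "\<not> R (hd m) (last m)"
proof
  assume "R (hd m) (last m)"
  moreover have "successively E m"
    using assms(2,4) by (simp add: ipath_append ipath_imp_successively)
  ultimately have "length p \<le> length m" using assms(1)[of m] assms(3-5) by auto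
  with assms(4,6) show False by auto
qed

text \<open>
  When a connected set \<open>C\<close> is attached to nonadjacent vertices of \<open>L\<close>, a shortest path through \<open>C\<close> witnesses this. Its proper
  initial and final segments are not attached to nonadjacent vertices of \<open>L\<close> by their ends; hence every attachment of an
  inner vertex is a common neighbour of the attachments \<open>x\<close> and \<open>z\<close> of the two ends.
\<close>

lemma shortest_attaching_path:
  assumes C: "conn C" and uniq: "\<forall>c\<in>C. \<forall>s\<in>L. \<forall>t\<in>L. E c s \<longrightarrow> E c t \<longrightarrow> s = t"
    and at: "d \<in> C" "d' \<in> C" "E d x0" "E d' z0" "x0 \<in> L" "z0 \<in> L" "x0 \<noteq> z0" "\<not> E x0 z0"
  obtains P x z where "P \<noteq> []" "ipath P" "set P \<subseteq> C" "x \<in> L" "z \<in> L" "E (hd P) x" "E (last P) z" "x \<noteq> z" "\<not> E x z"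
    "\<And>s. s \<in> L \<Longrightarrow> E (hd P) s \<Longrightarrow> s = x" "\<And>s. s \<in> L \<Longrightarrow> E (last P) s \<Longrightarrow> s = z"
    "\<And>p s. p \<in> set P \<Longrightarrow> p \<noteq> hd P \<Longrightarrow> p \<noteq> last P \<Longrightarrow> s \<in> L \<Longrightarrow> E p s \<Longrightarrow> E x s \<and> E s z"
    "\<And>p' x z. p' \<noteq> [] \<Longrightarrow> successively E p' \<Longrightarrow> set p' \<subseteq> C \<Longrightarrow> x \<in> L \<Longrightarrow> z \<in> L \<Longrightarrow> E (hd p') x \<Longrightarrow> E (last p') z \<Longrightarrow>
      x \<noteq> z \<Longrightarrow> \<not> E x z \<Longrightarrow> length P \<le> length p'"
proof -
  let ?R = "\<lambda>a b. \<exists>x\<in>L. \<exists>z\<in>L. E a x \<and> E b z \<and> x \<noteq> z \<and> \<not> E x z"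
  have Rd: "?R d d'" using at by blast
  obtain P where P: "P \<noteq> []" "ipath P" "set P \<subseteq> C" "?R (hd P) (last P)"
    and min: "\<And>p'. p' \<noteq> [] \<Longrightarrow> successively E p' \<Longrightarrow> set p' \<subseteq> C \<Longrightarrow> ?R (hd p') (last p') \<Longrightarrow> length P \<le> length p'"
    by (rule shortest_path[OF C at(1,2), of ?R, OF Rd]) (rule that)
  note sub = shortest_sub[of C ?R, OF min P(2,3)]
  obtain x z where xz: "x \<in> L" "z \<in> L" "E (hd P) x" "E (last P) z" "x \<noteq> z" "\<not> E x z"
    using P(4) by blast
  have hl: "hd P \<in> C" "last P \<in> C" using P(1,3) by auto
  show thesis
  proof (rule that[OF P(1-3) xz])
    show "s = x" if "s \<in> L" "E (hd P) s" for s using uniq hl(1) that xz(1,3) by blast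
    show "s = z" if "s \<in> L" "E (last P) s" for s using uniq hl(2) that xz(2,4) by blast
    show "length P \<le> length p'" if "p' \<noteq> []" "successively E p'" "set p' \<subseteq> C" "x \<in> L" "z \<in> L"
      "E (hd p') x" "E (last p') z" "x \<noteq> z" "\<not> E x z" for p' x z
      using min[OF that(1-3)] that(4-) by blast
    show "E x s \<and> E s z" if p: "p \<in> set P" "p \<noteq> hd P" "p \<noteq> last P" "s \<in> L" "E p s" for p s
    proof -
      obtain a b where ab: "P = a @ p # b" using p(1) by (meson split_list)
      have ne: "a \<noteq> []" "b \<noteq> []" using ab p by auto
      have "\<not> ?R (hd (a @ [p])) (last (a @ [p]))" using sub[of "[]" "a @ [p]" b] ab ne by simp
      then have 1: "x = s \<or> E x s" using ne ab xz p(4,5) by auto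
      have "\<not> ?R (hd (p # b)) (last (p # b))" using sub[of a "p # b" "[]"] ab ne by simp
      then have 2: "s = z \<or> E s z" using ne ab xz p(4,5) by auto
      from 1 2 xz show ?thesis by auto
    qed
  qed
qed

lemma path_between:
  assumes "conn D" "a \<in> D" "b \<in> D" "a \<in> A" "b \<in> B"
  obtains p where "p \<noteq> []" "ipath p" "set p \<subseteq> D" "\<And>u. u \<in> set p \<Longrightarrow> u \<in> A \<longleftrightarrow> u = hd p"
    "\<And>u. u \<in> set p \<Longrightarrow> u \<in> B \<longleftrightarrow> u = last p"
proof -
  let ?R = "\<lambda>x y. x \<in> A \<and> y \<in> B"
  obtain p where p: "p \<noteq> []" "ipath p" "set p \<subseteq> D" "?R (hd p) (last p)"
    and min: "\<And>p'. p' \<noteq> [] \<Longrightarrow> successively E p' \<Longrightarrow> set p' \<subseteq> D \<Longrightarrow> ?R (hd p') (last p') \<Longrightarrow> length p \<le> length p'"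
    using shortest_path[OF assms(1-3), of ?R] assms(4,5) by blast
  note sub = shortest_sub[of D ?R, OF min p(2,3)]
  have 1: "u \<in> A \<longleftrightarrow> u = hd p" if u: "u \<in> set p" for u
  proof -
    obtain q r where eq: "p = q @ u # r" using u by (meson split_list)
    show ?thesis
    proof (cases "q = []")
      case False
      then have "u \<notin> A" using sub[of q "u # r" "[]"] p(4) eq by auto
      with p(4) show ?thesis by metis
    qed (use p(4) eq in auto)
  qed
  have 2: "u \<in> B \<longleftrightarrow> u = last p" if u: "u \<in> set p" for u
  proof -
    obtain q r where eq: "p = q @ u # r" using u by (meson split_list)
    show ?thesis
    proof (cases "r = []")
      case False
      then have "u \<notin> B" using sub[of "[]" "q @ [u]" r] p(4) eq by (auto simp: hd_append split: if_splits)
      with p(4) show ?thesis by metis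
    qed (use p(4) eq in auto)
  qed
  from p 1 2 that show thesis by blast
qed

lemma conn_insert:
  assumes "conn D" "x \<in> D" "E x y"
  shows "conn (insert y D)"
  unfolding conn_def
proof (intro allI impI)
  fix A assume A: "A \<subseteq> insert y D" "A \<noteq> {}" "\<forall>x\<in>A. \<forall>z\<in>insert y D. E x z \<longrightarrow> z \<in> A"
  have "x \<in> A \<or> A \<inter> D \<noteq> {}" using A assms(2,3) E_sym by blast
  then have "A \<inter> D \<noteq> {}" using assms by blast
  then have "A \<inter> D = D" using A connD[OF assms(1), of "A \<inter> D"] by blast
  then show "A = insert y D" using A assms by blast
qed

lemma conn_walk_set: "successively E p \<Longrightarrow> conn (set p)"
proof (induction p)
  case Nil
  show ?case by (simp add: conn_def)
next
  case (Cons x p)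
  show ?case
  proof (cases p)
    case Nil
    then show ?thesis by (auto simp: conn_def)
  next
    case (Cons y ys)
    then show ?thesis using Cons.prems Cons.IH conn_insert[of "set p" y x] E_sym by auto
  qed
qed

lemma conn_union_attached:
  assumes "conn D" "D \<noteq> {}" "\<And>r. r \<in> P \<Longrightarrow> \<exists>q. q \<noteq> [] \<and> hd q = r \<and> successively E q \<and> set q \<subseteq> D \<union> P \<and> last q \<in> D"
  shows "conn (D \<union> P)"
  unfolding conn_def
proof (intro allI impI)
  fix A assume A: "A \<subseteq> D \<union> P" "A \<noteq> {}" "\<forall>x\<in>A. \<forall>z\<in>D \<union> P. E x z \<longrightarrow> z \<in> A"
  have fwd: "q \<noteq> [] \<Longrightarrow> successively E q \<Longrightarrow> set q \<subseteq> D \<union> P \<Longrightarrow> hd q \<in> A \<Longrightarrow> set q \<subseteq> A" for q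
    using A(3) by (induction q rule: induct_list012) auto
  have "A \<inter> D \<noteq> {}"
  proof (cases "A \<subseteq> D")
    case False
    then obtain r where "r \<in> A" "r \<in> P" using A(1) by blast
    with assms(3)[of r] fwd show ?thesis by (metis disjoint_iff last_in_set subsetD)
  qed (use A in auto)
  then have D: "D \<subseteq> A" using A connD[OF assms(1), of "A \<inter> D"] by blast
  have "r \<in> A" if r: "r \<in> P" for r
  proof -
    obtain q where q: "q \<noteq> []" "hd q = r" "successively E q" "set q \<subseteq> D \<union> P" "last q \<in> D"
      using assms(3)[OF r] by blast
    have "successively E (rev q)"
      using q(3) unfolding successively_rev by (rule successively_mono) (auto intro: E_sym)
    then have "set (rev q) \<subseteq> A" using fwd[of "rev q"] q D by (simp add: hd_rev subset_iff)
    then show ?thesis using q by auto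
  qed
  with D A show "A = D \<union> P" by blast
qed

definition component :: "'a set \<Rightarrow> 'a \<Rightarrow> 'a set" where
  "component D r = \<Inter>{A. A \<subseteq> D \<and> r \<in> A \<and> (\<forall>x\<in>A. \<forall>y\<in>D. E x y \<longrightarrow> y \<in> A)}"

lemma
  assumes "r \<in> D"
  shows component_subset: "component D r \<subseteq> D"
    and component_root: "r \<in> component D r"
    and component_closed: "x \<in> component D r \<Longrightarrow> y \<in> D \<Longrightarrow> E x y \<Longrightarrow> y \<in> component D r"
    and component_conn: "conn (component D r)"
proof -
  let ?F = "{A. A \<subseteq> D \<and> r \<in> A \<and> (\<forall>x\<in>A. \<forall>y\<in>D. E x y \<longrightarrow> y \<in> A)}"
  have D: "D \<in> ?F" using assms by blast
  show s: "component D r \<subseteq> D" and rt: "r \<in> component D r" using D unfolding component_def by auto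
  show cl: "x \<in> component D r \<Longrightarrow> y \<in> D \<Longrightarrow> E x y \<Longrightarrow> y \<in> component D r" for x y
    unfolding component_def by blast
  show "conn (component D r)"
    unfolding conn_def
  proof (intro allI impI)
    fix A assume A: "A \<subseteq> component D r" "A \<noteq> {}" "\<forall>x\<in>A. \<forall>y\<in>component D r. E x y \<longrightarrow> y \<in> A"
    show "A = component D r"
    proof (cases "r \<in> A")
      case True
      then have "A \<in> ?F" using A s cl by blast
      then show ?thesis using A(1) unfolding component_def by blast
    next
      case False
      then have "component D r - A \<in> ?F" using A s cl rt E_sym by blast
      then have "component D r \<subseteq> component D r - A" unfolding component_def by blast
      then show ?thesis using A by blast
    qed
  qed
qed

text \<open>
  The first vertex of the cycle is singled out: a hole is an induced path together with a vertex that sees exactly the two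
  ends of the path.
\<close>

fun hole_list :: "'a list \<Rightarrow> bool" where
  "hole_list [] = False"
| "hole_list (v # p) = (ipath p \<and> v \<notin> set p \<and> 3 \<le> length p \<and>
     (\<forall>u\<in>set p. E v u \<longleftrightarrow> u = hd p \<or> u = last p))"

lemma hole_list_rev: "hole_list (v # p) \<Longrightarrow> hole_list (v # rev p)"
  by (auto simp: ipath_rev hd_rev last_rev)

lemma hole_list_rotate1: 
  assumes "hole_list (v # x # p)" shows "hole_list (x # p @ [v])"
proof -
  have "p \<noteq> []" using assms by auto
  then have h: "hd p \<in> set p" "last p \<in> set p" "hd (p @ [v]) = hd p" "last (x # p) = last p" by auto
  have x: "ipath p" "x \<notin> set p" "v \<noteq> x" "v \<notin> set p" "2 \<le> length p" 
    and xp: "\<And>u. u \<in> set p \<Longrightarrow> E x u \<longleftrightarrow> u = hd p"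
    and vp: "\<And>u. u \<in> set p \<Longrightarrow> E v u \<longleftrightarrow> u = last p" "E v x"
    using assms h by auto
  have "ipath (p @ [v])"
    using x vp h unfolding ipath_append by (auto simp: E_commute[of _ v])
  then show ?thesis using x xp vp h by (auto simp: E_commute[of x v])
qed

lemma hole_list_rotate:
  assumes "hole_list (a @ v # b)" shows "hole_list (v # b @ a)"
  using assms
proof (induction a arbitrary: b)
  case (Cons y a)
  then have "hole_list (a @ v # (b @ [y]))"
    using hole_list_rotate1[of y "hd (a @ v # b)" "tl (a @ v # b)"] by (cases a) auto
  from Cons.IH[OF this] show ?case by simp
qed simp

lemma hole_list_at:
  assumes "hole_list cs" "v \<in> set cs"
  obtains p where "hole_list (v # p)" "set (v # p) = set cs" "length (v # p) = length cs"
proof -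
  obtain a b where "cs = a @ v # b" using assms(2) by (meson split_list)
  with assms(1) hole_list_rotate that[of "b @ a"] show thesis by auto
qed

lemma hole_list_distinct: "hole_list cs \<Longrightarrow> distinct cs"
  by (cases cs) (auto dest: ipath_distinct)

lemma hole_arc:
  assumes "hole_list (u # a @ z # b)" "b \<noteq> []"
  shows "ipath (u # a @ [z])"
proof -
  have *: "ipath ((a @ [z]) @ b)" "u \<notin> set (a @ [z])"
      "\<And>v. v \<in> set ((a @ [z]) @ b) \<Longrightarrow> E u v \<longleftrightarrow> v = hd ((a @ [z]) @ b) \<or> v = last b"
    using assms by auto
  have "last b \<notin> set (a @ [z])" using *(1) assms(2) unfolding ipath_append[of "a @ [z]" b]
    using last_in_set by blast
  then have "E u v \<longleftrightarrow> v = hd (a @ [z])" if "v \<in> set (a @ [z])" for v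
    using *(3)[of v] that by (auto simp: hd_append)
  then show ?thesis using * unfolding ipath_append[of "a @ [z]" b] by simp
qed

end

section \<open>Parity in triangle-free graphs whose holes are odd\<close>

text \<open>
  A list is cut at the positions where \<open>Q\<close> holds. In the applications \<open>Q\<close> is adjacency to a vertex \<open>v\<close>, and the step adds a
  sector, the stretch between two consecutive neighbours of \<open>v\<close>.
\<close>

lemma sector_induct:
  assumes "p \<noteq> []" "Q (hd p)" "Q (last p)"
    and base: "\<And>x. Q x \<Longrightarrow> P [x]"
    and step: "\<And>x a y b. Q x \<Longrightarrow> Q y \<Longrightarrow> \<forall>z\<in>set a. \<not> Q z \<Longrightarrow> Q (last (y # b)) \<Longrightarrow> P (y # b) \<Longrightarrow> P (x # a @ y # b)"
  shows "P p"
  using assms(1-3)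
proof (induction p rule: length_induct)
  case (1 p)
  obtain x p' where p: "p = x # p'" using 1 by (cases p) auto
  show ?case
  proof (cases "p' = []")
    case True
    then show ?thesis using 1 p base by simp
  next
    case False
    then have "\<exists>u\<in>set p'. Q u" using 1 p by auto
    then obtain a y b where ayb: "p' = a @ y # b" "Q y" "\<forall>z\<in>set a. \<not> Q z"
      by (metis split_list_first_prop)
    then have l: "Q (last (y # b))" using 1 p by (auto split: if_splits)
    with 1(1)[rule_format, of "y # b"] ayb p have "P (y # b)" by simp
    then show ?thesis using step[of x y a b] ayb p l 1 by simp
  qed
qed

lemma card_filter: "distinct xs \<Longrightarrow> card {x \<in> set xs. P x} = length (filter P xs)"
  using distinct_card[of "filter P xs"] by simp

context simple_graph
begin

definition triangle_free :: "'a set \<Rightarrow> bool" where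
  "triangle_free X \<longleftrightarrow> (\<forall>u\<in>X. \<forall>v\<in>X. \<forall>w\<in>X. E u v \<longrightarrow> E v w \<longrightarrow> \<not> E u w)"

definition odd_holes :: "'a set \<Rightarrow> bool" where
  "odd_holes X \<longleftrightarrow> (\<forall>cs. hole_list cs \<longrightarrow> set cs \<subseteq> X \<longrightarrow> odd (length cs))"

lemma triangle_freeD: "triangle_free X \<Longrightarrow> u \<in> X \<Longrightarrow> v \<in> X \<Longrightarrow> w \<in> X \<Longrightarrow> E u v \<Longrightarrow> E v w \<Longrightarrow> \<not> E u w"
  unfolding triangle_free_def by blast

lemma odd_holesD: "odd_holes X \<Longrightarrow> hole_list cs \<Longrightarrow> set cs \<subseteq> X \<Longrightarrow> odd (length cs)"
  unfolding odd_holes_def by blast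

lemma triangle_free_mono: "triangle_free X \<Longrightarrow> Y \<subseteq> X \<Longrightarrow> triangle_free Y"
  unfolding triangle_free_def by blast

lemma odd_holes_mono: "odd_holes X \<Longrightarrow> Y \<subseteq> X \<Longrightarrow> odd_holes Y"
  unfolding odd_holes_def by blast

text \<open>
  The two ends of a sector are neighbours of \<open>v\<close>, hence not adjacent in a triangle-free graph; so the hole is not a triangle.
\<close>

lemma sector_hole:
  assumes "triangle_free X" "ipath (x # a @ [y])" "v \<notin> set (x # a @ [y])" "set (v # x # a @ [y]) \<subseteq> X"
    "E v x" "E v y" "\<forall>z\<in>set a. \<not> E v z"
  shows "hole_list (v # x # a @ [y])"
proof -
  have "a \<noteq> []"
    using assms triangle_freeD[of X v x y] by auto
  then have "3 \<le> length (x # a @ [y])" by (cases a) auto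
  then show ?thesis using assms by auto
qed

lemma sector_even:
  assumes "triangle_free X" "odd_holes X" "ipath (x # a @ [y])" "v \<notin> set (x # a @ [y])" "set (v # x # a @ [y]) \<subseteq> X"
    "E v x" "E v y" "\<forall>z\<in>set a. \<not> E v z"
  shows "even (length a)"
  using odd_holesD[OF assms(2) sector_hole[OF assms(1,3-8)] assms(5)] by simp

text \<open>
  Every sector closes through \<open>v\<close> to an odd hole and therefore has an even number of inner vertices.
\<close>

lemma path_parity:
  assumes "triangle_free X" "odd_holes X"
    and "p \<noteq> []" "E v (hd p)" "E v (last p)" "ipath p" "v \<notin> set p" "set p \<subseteq> X" "v \<in> X"
  shows "even (length p + length (filter (E v) p))"
  using assms(3-)
proof (induction p rule: sector_induct[of _ "E v", consumes 3, case_names base step])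
  case (step x a y b)
  have "ipath (x # a @ [y])" "ipath (y # b)"
    using step(6) ipath_append[of "x # a @ [y]" b] ipath_append[of "x # a" "y # b"] by auto
  moreover have "filter (E v) a = []" using step by auto
  moreover have "even (length a)"
    by (rule sector_even[OF assms(1,2) \<open>ipath (x # a @ [y])\<close>, of v]) (use step in auto)
  ultimately show ?case using step by auto
qed auto

lemma hole_last_nbr:
  assumes "triangle_free X" "hole_list (u # p)" "set (u # p) \<subseteq> X" "v \<in> X" "E v u" "\<exists>w\<in>set p. E v w"
  obtains a w b where "p = a @ w # b" "E v w" "\<forall>z\<in>set b. \<not> E v z" "ipath (u # a @ [w])" "ipath (w # b @ [u])"
proof -
  obtain a w b where w: "p = a @ w # b" "E v w" "\<forall>z\<in>set b. \<not> E v z"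
    using assms(6) by (metis split_list_last_prop)
  have "\<not> E u w" using triangle_freeD[OF assms(1), of v u w] assms(3-5) w by auto
  then have ne: "a \<noteq> []" "b \<noteq> []" using assms(2) w by auto
  have "ipath (u # a @ [w])" by (rule hole_arc[of _ _ _ b]) (use assms(2) w ne in simp_all)
  moreover have "ipath (w # b @ [u])"
    by (rule hole_arc[of _ _ _ a]) (use hole_list_rotate[of "u # a" w b] assms(2) w(1) ne in simp_all)
  ultimately show thesis using that[of a w b] w by blast
qed

text \<open>
  The hole is cut at \<open>u\<close> and at the last neighbour of \<open>v\<close> on the way around. On the arc before that neighbour,
  \<open>path_parity\<close> relates the length to the number of neighbours; the arc after it is one more sector. In particular, no vertex
  has exactly two neighbours on a hole.
\<close>

lemma hole_nbrs_odd:
  assumes "triangle_free X" "odd_holes X" "hole_list cs" "set cs \<subseteq> X" "v \<in> X" "v \<notin> set cs" "u \<in> set cs" "E v u"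
  shows "odd (card {w\<in>set cs. E v w})"
proof -
  obtain p where p: "hole_list (u # p)" "set (u # p) = set cs" using hole_list_at[OF assms(3,7)] .
  have d: "distinct (u # p)" using p hole_list_distinct by blast
  have "card {w\<in>set cs. E v w} = length (filter (E v) (u # p))"
    unfolding p(2)[symmetric] by (rule card_filter[OF d])
  also have "odd \<dots>"
  proof (cases "\<exists>w\<in>set p. E v w")
    case False
    then have "filter (E v) p = []" by (auto simp: filter_empty_conv)
    then show ?thesis using assms by simp
  next
    case True
    have X: "set (u # p) \<subseteq> X" "v \<notin> set (u # p)" using p assms by auto
    obtain a w b where w: "p = a @ w # b" "E v w" "\<forall>z\<in>set b. \<not> E v z"
      and arcs: "ipath (u # a @ [w])" "ipath (w # b @ [u])"
      using hole_last_nbr[OF assms(1) p(1) X(1) assms(5,8) True] .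
    have 1: "even (length a + length (filter (E v) a))"
      using path_parity[OF assms(1,2) _ _ _ arcs(1), of v] X assms w by auto
    have 2: "even (length b)"
      by (rule sector_even[OF assms(1,2) arcs(2), of v]) (use X assms w in auto)
    have "odd (length (u # p))" using odd_holesD[OF assms(2) p(1) X(1)] .
    then show ?thesis using 1 2 w assms by (auto simp: filter_empty_conv[THEN iffD2])
  qed
  finally show ?thesis .
qed

text \<open>
  Each sector of \<open>y\<close> closes through \<open>y\<close> to a hole. On it \<open>e\<close> sees \<open>y\<close>, hence an even number of other vertices by
  \<open>hole_nbrs_odd\<close>. The ends of the sectors are neighbours of \<open>y\<close> and therefore not of \<open>e\<close>, so adding up the sectors counts nothing
  twice.
\<close>

lemma path_nbrs_even:
  assumes "triangle_free X" "odd_holes X" "E y e" "y \<in> X" "e \<in> X"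
    and "p \<noteq> []" "E y (hd p)" "E y (last p)" "ipath p" "y \<notin> set p" "e \<notin> set p" "set p \<subseteq> X"
  shows "even (length (filter (E e) p))"
  using assms(6-)
proof (induction p rule: sector_induct[of _ "E y", consumes 3, case_names base step])
  case (base x)
  then show ?case using triangle_freeD[of X e y x] assms by (auto simp: E_commute)
next
  case (step x a z b)
  have ip: "ipath (x # a @ [z])" "ipath (z # b)"
    using step(6) ipath_append[of "x # a @ [z]" b] ipath_append[of "x # a" "z # b"] by auto
  have h: "hole_list (y # x # a @ [z])"
    by (rule sector_hole[OF assms(1) ip(1)]) (use step assms in auto)
  have z: "\<not> E e z" using triangle_freeD[of X e y z] assms step by (auto simp: E_commute)
  have d: "distinct (y # x # a @ [z])" using h hole_list_distinct by blast
  have s: "set (y # x # a @ [z]) \<subseteq> X" "e \<notin> set (y # x # a @ [z])" "y \<in> set (y # x # a @ [z])" "E e y"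
    using step assms E_sym[OF assms(3)] by auto
  have "odd (card {w \<in> set (y # x # a @ [z]). E e w})"
    by (rule hole_nbrs_odd[OF assms(1,2) h s(1) assms(5) s(2-4)])
  moreover have "card {w\<in>set (y # x # a @ [z]). E e w} = length (filter (E e) (y # x # a @ [z]))"
    by (rule card_filter[OF d])
  moreover have "even (length (filter (E e) (z # b)))" using step ip by simp
  ultimately show ?case using z \<open>E e y\<close> by (auto split: if_splits)
qed

text \<open>
  Once around the hole in sectors of \<open>y\<close>, the number of neighbours of \<open>e\<close> is even; by \<open>hole_nbrs_odd\<close> it is odd unless it is
  zero.
\<close>

lemma hole_two_hubs:
  assumes "triangle_free X" "odd_holes X" "hole_list cs" "set cs \<subseteq> X" "y \<in> X" "e \<in> X" "E y e"
    "y \<notin> set cs" "e \<notin> set cs" "u \<in> set cs" "w \<in> set cs" "u \<noteq> w" "E y u" "E y w" "z \<in> set cs"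
  shows "\<not> E e z"
proof
  assume "E e z"
  obtain p where p: "hole_list (u # p)" "set (u # p) = set cs" using hole_list_at[OF assms(3,10)] .
  have d: "distinct (u # p)" using p hole_list_distinct by blast
  have c: "card {w\<in>set cs. E e w} = length (filter (E e) (u # p))"
    unfolding p(2)[symmetric] by (rule card_filter[OF d])
  have "odd (card {w\<in>set cs. E e w})"
    by (rule hole_nbrs_odd[OF assms(1,2,3,4,6,9,15) \<open>E e z\<close>])
  then have o: "odd (length (filter (E e) (u # p)))" using c by simp
  have "\<exists>w\<in>set p. E y w" using p assms by auto
  then obtain a w b where w: "p = a @ w # b" "E y w" and arcs: "ipath (u # a @ [w])" "ipath (w # b @ [u])"
    using hole_last_nbr[OF assms(1) p(1) _ assms(5,13)] p(2) assms(4) by metis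
  have X: "set (u # p) \<subseteq> X" "y \<notin> set (u # p)" "e \<notin> set (u # p)" using p assms by auto
  have 1: "even (length (filter (E e) (u # a @ [w])))"
    by (rule path_nbrs_even[OF assms(1,2,7,5,6)]) (use X assms w arcs in auto)
  have 2: "even (length (filter (E e) (w # b @ [u])))"
    by (rule path_nbrs_even[OF assms(1,2,7,5,6)]) (use X assms w arcs in auto)
  have "\<not> E e u" "\<not> E e w"
    using triangle_freeD[OF assms(1), of e y] assms w X E_sym[OF assms(7)] by auto
  then show False using o 1 2 w by auto
qed

text \<open>
  If \<open>u\<close> and \<open>w\<close> were not adjacent, the two arcs of the hole and the path through \<open>Q\<close> would be three paths between \<open>u\<close> and \<open>w\<close>,
  any two of which close to a hole. The three lengths would have pairwise odd sums, which is impossible.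
\<close>

lemma no_theta:
  assumes "odd_holes X" "hole_list cs" "set cs \<subseteq> X" "set Q \<subseteq> X" "set Q \<inter> set cs = {}"
    "Q \<noteq> []" "ipath Q" "u \<in> set cs" "w \<in> set cs" "u \<noteq> w"
    "\<And>q s. q \<in> set Q \<Longrightarrow> s \<in> set cs \<Longrightarrow> E q s \<longleftrightarrow> (q = hd Q \<and> s = u) \<or> (q = last Q \<and> s = w)"
  shows "E u w"
proof (rule ccontr)
  assume nadj: "\<not> E u w"
  obtain p where p: "hole_list (u # p)" "set (u # p) = set cs" using hole_list_at[OF assms(2,8)] .
  then obtain a b where w: "p = a @ w # b" using assms by (metis split_list set_ConsD)
  have d: "distinct (u # p)" using p hole_list_distinct by blast
  have a: "a \<noteq> []" using p(1) w nadj by auto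
  have b: "b \<noteq> []" using p(1) w nadj by auto
  have h: "hole_list (u # a @ w # b)" "hole_list (w # b @ u # a)"
    using hole_list_rotate[of "u # a" w b] p(1) unfolding w append_Cons by blast+
  have arcs: "ipath (u # a @ [w])" "ipath (w # b @ [u])"
    by (rule hole_arc[OF h(1) b], rule hole_arc[OF h(2) a])
  have cs: "set cs = insert u (insert w (set a \<union> set b))" using p w by auto
  have Q: "hd Q \<in> set Q" "last Q \<in> set Q" using assms by auto
  have Qcs: "E s q \<longleftrightarrow> (q = hd Q \<and> s = u) \<or> (q = last Q \<and> s = w)" if "q \<in> set Q" "s \<in> set cs" for q s
    using assms(11)[OF that] E_commute by blast
  have rQ: "ipath (rev Q)" "rev Q \<noteq> []" "hd (rev Q) = last Q" "last (rev Q) = hd Q" "set (rev Q) = set Q"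
    using assms by (auto simp: ipath_rev hd_rev last_rev)
  have odd_arc: "odd (length A + length Q)"
    if A: "ipath (u # A @ [w])" "A \<noteq> []" "set A \<subseteq> set cs" for A
  proof -
    have hA: "hd (A @ [w]) = hd A" using A(2) by simp
    have ipA: "ipath (A @ [w])" "u \<notin> set (A @ [w])" "\<And>z. z \<in> set (A @ [w]) \<Longrightarrow> E u z \<longleftrightarrow> z = hd A"
      using A(1) unfolding ipath.simps hA by blast+
    have dis: "set (A @ [w]) \<inter> set Q = {}" "u \<notin> set Q" using assms(5,8,9) A(3) by auto
    have "ipath ((A @ [w]) @ rev Q)"
      unfolding ipath_append[of "A @ [w]" "rev Q"]
    proof (intro conjI ballI)
      show "set (A @ [w]) \<inter> set (rev Q) = {}" using dis by simp
      fix s q assume sq: "s \<in> set (A @ [w])" "q \<in> set (rev Q)"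
      then have "s \<in> set cs" "s \<noteq> u" "q \<in> set Q" using A(3) assms(9) ipA(2) by auto
      then show "E s q \<longleftrightarrow> s = last (A @ [w]) \<and> q = hd (rev Q)" using Qcs[of q s] rQ(3) by auto
    qed (rule ipA rQ)+
    moreover have "E u z \<longleftrightarrow> z = hd (A @ w # rev Q) \<or> z = last (A @ w # rev Q)" if z: "z \<in> set (A @ w # rev Q)" for z
    proof (cases "z \<in> set Q")
      case True
      then have "z \<noteq> hd A" using dis(1) hd_in_set[OF A(2)] by auto
      then show ?thesis using Qcs[OF True assms(8)] assms(10) A(2) rQ by simp
    next
      case False
      then have "z \<in> set (A @ [w])" "z \<noteq> hd Q" using z Q by auto
      then show ?thesis using ipA(3) A(2) rQ by simp
    qed
    moreover have "3 \<le> length (A @ w # rev Q)" using A(2) assms(6) by (cases A; cases Q) auto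
    ultimately have hQ: "hole_list (u # A @ w # rev Q)" using ipA(2) dis(2) by simp
    have "set (u # A @ w # rev Q) \<subseteq> X" using A(3) assms(3,4,8,9) by auto
    from odd_holesD[OF assms(1) hQ this] show ?thesis by simp
  qed
  have 1: "odd (length a + length Q)" by (rule odd_arc[OF arcs(1) a]) (use cs in auto)
  have "ipath (u # rev b @ [w])" using ipath_rev[OF arcs(2)] by simp
  then have 2: "odd (length b + length Q)" using odd_arc[of "rev b"] b cs by auto
  have "odd (length (u # p))" using odd_holesD[OF assms(1) p(1)] assms(3) unfolding p(2) by blast
  with 1 2 w show False by auto
qed

text \<open>
  Arbitrary colourings can only be expected to extend from such holes: an outside vertex with three neighbours on a hole
  needs a colour set disjoint from all of theirs.
\<close>

definition clean :: "'a set \<Rightarrow> 'a set \<Rightarrow> bool" where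
  "clean F H \<longleftrightarrow> (\<forall>f\<in>F - H. \<forall>u\<in>H. \<forall>w\<in>H. E f u \<longrightarrow> E f w \<longrightarrow> u = w)"

text \<open>
  A shortest path through \<open>D\<close> from a neighbour of \<open>A\<close> to a neighbour of \<open>B\<close> is attached at its ends only, so that \<open>no_theta\<close>
  makes these two attachments adjacent. In other words, the attachments of \<open>D\<close> induce a connected subgraph of the hole.
\<close>

lemma attachments_connected:
  assumes "odd_holes X" "hole_list cs" "set cs \<subseteq> X" "D \<subseteq> X - set cs" "conn D" "clean X (set cs)"
    and "x \<in> D" "y \<in> D" "E x u" "E y w" "u \<in> A" "w \<in> B" "A \<inter> B = {}" "A \<subseteq> set cs" "B \<subseteq> set cs"
    and "\<And>d s. d \<in> D \<Longrightarrow> s \<in> set cs \<Longrightarrow> E d s \<Longrightarrow> s \<in> A \<union> B"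
  obtains x y u w where "x \<in> D" "y \<in> D" "E x u" "E y w" "u \<in> A" "w \<in> B" "E u w"
proof -
  have uniq: "s = t" if "d \<in> D" "s \<in> set cs" "t \<in> set cs" "E d s" "E d t" for d s t
    using assms(4,6) that unfolding clean_def by blast
  obtain Q where Q: "Q \<noteq> []" "ipath Q" "set Q \<subseteq> D"
      "\<And>d. d \<in> set Q \<Longrightarrow> d \<in> {d. \<exists>s\<in>A. E d s} \<longleftrightarrow> d = hd Q" 
      "\<And>d. d \<in> set Q \<Longrightarrow> d \<in> {d. \<exists>s\<in>B. E d s} \<longleftrightarrow> d = last Q"
    by (rule path_between[OF assms(5,7,8), of "{d. \<exists>s\<in>A. E d s}" "{d. \<exists>s\<in>B. E d s}"]) (use assms in auto)
  have hl: "hd Q \<in> set Q" "last Q \<in> set Q" using Q by auto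
  obtain u' w' where u': "u' \<in> A" "E (hd Q) u'" and w': "w' \<in> B" "E (last Q) w'"
    using Q(4)[OF hl(1)] Q(5)[OF hl(2)] by blast
  have D: "hd Q \<in> D" "last Q \<in> D" using hl Q by auto
  have "E u' w'"
  proof (rule no_theta[OF assms(1-3) _ _ Q(1,2)])
    show "set Q \<subseteq> X" "set Q \<inter> set cs = {}" using Q assms by auto
    show "u' \<in> set cs" "w' \<in> set cs" "u' \<noteq> w'" using u' w' assms by auto
    fix q s assume q: "q \<in> set Q" "s \<in> set cs"
    show "E q s \<longleftrightarrow> (q = hd Q \<and> s = u') \<or> (q = last Q \<and> s = w')"
    proof
      assume "E q s"
      then have "s \<in> A \<or> s \<in> B" using assms(16)[of q s] q Q by blast
      then show "(q = hd Q \<and> s = u') \<or> (q = last Q \<and> s = w')"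
        using Q(4,5)[OF q(1)] \<open>E q s\<close> uniq[OF D(1), of u' s] uniq[OF D(2), of w' s] u' w' q assms(14,15) by blast
    qed (use u' w' in auto)
  qed
  with that u' w' D show thesis by blast
qed

end

section \<open>Colourings by sets of colours\<close>

lemma disjoint_families_bij:
  assumes "finite K" "\<And>k. k \<in> K \<Longrightarrow> finite (A k) \<and> finite (B k) \<and> card (A k) = card (B k)"
    "\<And>j k. j \<in> K \<Longrightarrow> k \<in> K \<Longrightarrow> j \<noteq> k \<Longrightarrow> A j \<inter> A k = {} \<and> B j \<inter> B k = {}"
  shows "\<exists>\<pi>. bij_betw \<pi> (\<Union>k\<in>K. A k) (\<Union>k\<in>K. B k) \<and> (\<forall>k\<in>K. \<pi> ` A k = B k)"
  using assms
proof (induction K)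
  case (insert k K)
  then obtain \<pi> where \<pi>: "bij_betw \<pi> (\<Union>k\<in>K. A k) (\<Union>k\<in>K. B k)" "\<And>j. j \<in> K \<Longrightarrow> \<pi> ` A j = B j"
    by (metis insert_iff)
  obtain g where g: "bij_betw g (A k) (B k)"
    using insert.prems(1)[of k] finite_same_card_bij by blast
  let ?h = "\<lambda>x. if x \<in> A k then g x else \<pi> x"
  have dis: "A j \<inter> A k = {}" "B j \<inter> B k = {}" if "j \<in> K" for j
    using insert.prems(2)[of j k] insert.hyps(2) that by auto
  have "bij_betw ?h (A k) (B k)" using g by (subst bij_betw_cong[of _ _ g]) auto
  moreover have "bij_betw ?h (\<Union>k\<in>K. A k) (\<Union>k\<in>K. B k)"
    using \<pi>(1) dis by (subst bij_betw_cong[of _ _ \<pi>]) auto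
  ultimately have "bij_betw ?h (A k \<union> (\<Union>k\<in>K. A k)) (B k \<union> (\<Union>k\<in>K. B k))"
    using dis by (intro bij_betw_combine) auto
  moreover have "?h ` A j = B j" if "j \<in> insert k K" for j
  proof (cases "j = k")
    case True
    then show ?thesis using g by (auto simp: bij_betw_def)
  next
    case False
    then have "?h ` A j = \<pi> ` A j" using that dis by (intro image_cong) auto
    then show ?thesis using \<pi>(2) that False by auto
  qed
  ultimately show ?case by (intro exI[of _ ?h]) auto
qed (simp add: bij_betw_def)

lemma disjoint_families_perm:
  fixes A B :: "'k \<Rightarrow> 'c set"
  assumes "finite N" "finite K" "\<And>k. k \<in> K \<Longrightarrow> A k \<subseteq> N \<and> B k \<subseteq> N \<and> card (A k) = card (B k)"
    "\<And>j k. j \<in> K \<Longrightarrow> k \<in> K \<Longrightarrow> j \<noteq> k \<Longrightarrow> A j \<inter> A k = {} \<and> B j \<inter> B k = {}"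
  obtains \<pi> where "bij_betw \<pi> N N" "\<And>k. k \<in> K \<Longrightarrow> \<pi> ` A k = B k"
proof -
  have fin: "finite (A k) \<and> finite (B k) \<and> card (A k) = card (B k)" if "k \<in> K" for k
    using assms(3)[OF that] assms(1) finite_subset by blast
  obtain \<pi> where \<pi>: "bij_betw \<pi> (\<Union>k\<in>K. A k) (\<Union>k\<in>K. B k)" "\<forall>k\<in>K. \<pi> ` A k = B k"
    using disjoint_families_bij[of K A B, OF assms(2) fin assms(4)] by blast
  let ?U = "\<Union>k\<in>K. A k" and ?W = "\<Union>k\<in>K. B k"
  have sub: "?U \<subseteq> N" "?W \<subseteq> N" using assms(3) by blast+
  have "card (N - ?U) = card (N - ?W)"
    using bij_betw_same_card[OF \<pi>(1)] sub assms(1) by (simp add: card_Diff_subset finite_subset)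
  then obtain g where g: "bij_betw g (N - ?U) (N - ?W)"
    using finite_same_card_bij assms(1) by (metis finite_Diff)
  let ?h = "\<lambda>x. if x \<in> ?U then \<pi> x else g x"
  have "bij_betw ?h ?U ?W" using \<pi>(1) by (subst bij_betw_cong[of _ _ \<pi>]) auto
  moreover have "bij_betw ?h (N - ?U) (N - ?W)" using g by (subst bij_betw_cong[of _ _ g]) auto
  ultimately have "bij_betw ?h (?U \<union> (N - ?U)) (?W \<union> (N - ?W))" by (rule bij_betw_combine) auto
  moreover have "?U \<union> (N - ?U) = N" "?W \<union> (N - ?W) = N" using sub by auto
  ultimately have "bij_betw ?h N N" by simp
  moreover have "?h ` A k = B k" if "k \<in> K" for k
  proof -
    have "?h ` A k = \<pi> ` A k" using that by (intro image_cong) auto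
    then show ?thesis using \<pi>(2) that by auto
  qed
  ultimately show thesis using that by blast
qed

context simple_graph
begin

definition is_clique :: "'a set \<Rightarrow> bool" where
  "is_clique K \<longleftrightarrow> (\<forall>u\<in>K. \<forall>v\<in>K. u \<noteq> v \<longrightarrow> E u v)"

text \<open>
  For constant \<open>s = q\<close> and \<open>n = 2 * q + 1\<close> these are the homomorphisms to the Kneser graph of the \<open>q\<close>-element subsets of a set
  with \<open>2 * q + 1\<close> elements.
\<close>

definition set_colouring :: "nat \<Rightarrow> ('a \<Rightarrow> nat) \<Rightarrow> ('a \<Rightarrow> nat set) \<Rightarrow> 'a set \<Rightarrow> bool" where
  "set_colouring n s \<phi> X \<longleftrightarrow> (\<forall>v\<in>X. \<phi> v \<subseteq> {..<n} \<and> card (\<phi> v) = s v) \<and>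
     (\<forall>u\<in>X. \<forall>v\<in>X. E u v \<longrightarrow> \<phi> u \<inter> \<phi> v = {})"

lemma set_colouring_mono: "set_colouring n s \<phi> X \<Longrightarrow> Y \<subseteq> X \<Longrightarrow> set_colouring n s \<phi> Y"
  unfolding set_colouring_def by blast

lemma set_colouring_cong: "set_colouring n s \<phi> X \<Longrightarrow> (\<And>x. x \<in> X \<Longrightarrow> \<psi> x = \<phi> x) \<Longrightarrow> set_colouring n s \<psi> X"
  unfolding set_colouring_def by simp

lemma set_colouring_union:
  assumes "set_colouring n s \<phi> X" "set_colouring n s \<psi> Y" "\<And>v. v \<in> X \<Longrightarrow> v \<in> Y \<Longrightarrow> \<phi> v = \<psi> v"
    "\<And>u v. u \<in> X - Y \<Longrightarrow> v \<in> Y - X \<Longrightarrow> \<not> E u v"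
  shows "set_colouring n s (\<lambda>v. if v \<in> X then \<phi> v else \<psi> v) (X \<union> Y)"
proof -
  let ?h = "\<lambda>v. if v \<in> X then \<phi> v else \<psi> v"
  have h: "?h v = \<psi> v" if "v \<in> Y" for v using assms(3) that by auto
  have "?h u \<inter> ?h v = {}" if uv: "u \<in> X \<union> Y" "v \<in> X \<union> Y" "E u v" for u v
  proof -
    have "u \<in> X \<and> v \<in> X \<or> u \<in> Y \<and> v \<in> Y" using assms(4) uv E_sym by blast
    then show ?thesis
    proof
      assume "u \<in> X \<and> v \<in> X" then show ?thesis using assms(1) uv(3) unfolding set_colouring_def by auto
    next
      assume "u \<in> Y \<and> v \<in> Y"
      then show ?thesis using assms(2) uv(3) h[of u] h[of v] unfolding set_colouring_def by metis
    qed
  qed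
  then show ?thesis using assms(1,2) unfolding set_colouring_def by auto
qed

text \<open>
  The colour sets of the vertices of a clique are pairwise disjoint and have prescribed sizes, so a permutation of the colours
  makes the two colourings agree on it.
\<close>

lemma set_colouring_glue:
  assumes "set_colouring n s \<phi> X" "set_colouring n s \<psi> Y" "finite (X \<inter> Y)" "is_clique (X \<inter> Y)"
    "\<And>u v. u \<in> X - Y \<Longrightarrow> v \<in> Y - X \<Longrightarrow> \<not> E u v"
  obtains \<chi> where "set_colouring n s \<chi> (X \<union> Y)" "\<And>v. v \<in> X \<Longrightarrow> \<chi> v = \<phi> v"
proof -
  obtain \<pi> where \<pi>: "bij_betw \<pi> {..<n} {..<n}" "\<And>k. k \<in> X \<inter> Y \<Longrightarrow> \<pi> ` \<psi> k = \<phi> k"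
  proof (rule disjoint_families_perm[of "{..<n}" "X \<inter> Y" \<psi> \<phi>])
    show "\<psi> j \<inter> \<psi> k = {} \<and> \<phi> j \<inter> \<phi> k = {}" if "j \<in> X \<inter> Y" "k \<in> X \<inter> Y" "j \<noteq> k" for j k
      using that assms(1,2,4) unfolding is_clique_def set_colouring_def by blast
  qed (use assms(1,2,3) in \<open>auto simp: set_colouring_def\<close>)
  have inj: "inj_on \<pi> {..<n}" and im: "\<pi> ` {..<n} = {..<n}" using \<pi>(1) by (auto simp: bij_betw_def)
  have "set_colouring n s (\<lambda>v. \<pi> ` \<psi> v) Y"
    unfolding set_colouring_def
  proof (intro conjI ballI impI)
    fix v assume v: "v \<in> Y"
    then have "\<psi> v \<subseteq> {..<n}" "card (\<psi> v) = s v" using assms(2) by (auto simp: set_colouring_def)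
    then show "\<pi> ` \<psi> v \<subseteq> {..<n}" "card (\<pi> ` \<psi> v) = s v"
      using im inj by (auto simp: card_image inj_on_subset)
  next
    fix u v assume uv: "u \<in> Y" "v \<in> Y" "E u v"
    then have "\<psi> u \<subseteq> {..<n}" "\<psi> v \<subseteq> {..<n}" "\<psi> u \<inter> \<psi> v = {}" using assms(2) by (auto simp: set_colouring_def)
    then show "\<pi> ` \<psi> u \<inter> \<pi> ` \<psi> v = {}" using inj inj_on_image_Int by (metis image_empty)
  qed
  from set_colouring_union[OF assms(1) this _ assms(5)] \<pi>(2) that show thesis by simp
qed

abbreviation kneser_col :: "nat \<Rightarrow> ('a \<Rightarrow> nat set) \<Rightarrow> 'a set \<Rightarrow> bool" where
  "kneser_col q \<equiv> set_colouring (2 * q + 1) (\<lambda>_. q)"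

text \<open>
  Two steps along the Kneser graph suffice to exchange one element of a colour set. After \<open>k\<close> exchanges the colour set at the
  start has become disjoint from \<open>B\<close>.
\<close>

lemma kneser_col_odd_path:
  assumes "ipath p" "length p = 2 * k + 2" "A \<subseteq> {..<2 * q + 1}" "B \<subseteq> {..<2 * q + 1}"
    "card A = q" "card B = q" "card (A \<inter> B) \<le> k"
  shows "\<exists>\<phi>. kneser_col q \<phi> (set p) \<and> \<phi> (hd p) = A \<and> \<phi> (last p) = B"
  using assms
proof (induction k arbitrary: p A)
  case 0
  then obtain x y where p: "p = [x, y]"
    by (cases p; cases "tl p") auto
  have "A \<inter> B = {}" using 0 finite_subset[OF 0(3)] by auto
  then show ?case
    using 0 p by (intro exI[of _ "\<lambda>z. if z = x then A else B"]) (auto simp: set_colouring_def)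
next
  case (Suc k)
  then obtain x y p' where p: "p = x # y # p'" and len: "length p' = 2 * k + 2"
    by (cases p; cases "tl p") auto
  have p': "p' \<noteq> []" using len by auto
  have fin: "finite A" "finite B" using Suc.prems finite_subset by blast+
  \<comment> \<open>\<open>A'\<close> is the colour set two steps later; the bound on \<open>A \<union> A'\<close> leaves room for a set \<open>M\<close> in between\<close>
  obtain A' where A': "A' \<subseteq> {..<2*q+1}" "card A' = q" "card (A \<union> A') \<le> q + 1" "card (A' \<inter> B) \<le> k"
  proof (cases "A \<inter> B = {}")
    case True
    then show ?thesis using that[of A] Suc.prems by auto
  next
    case False
    then obtain e where e: "e \<in> A" "e \<in> B" by blast
    have "card (A \<union> B) + card (A \<inter> B) = 2 * q"
      using card_Un_Int[OF fin] Suc.prems by simp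
    moreover have "card (A \<inter> B) \<noteq> 0" using False fin by simp
    ultimately have "card (A \<union> B) < card {..<2*q+1}" by simp
    then obtain f where f: "f \<in> {..<2*q+1}" "f \<notin> A \<union> B"
      by (metis card_mono fin finite_UnI linorder_not_less subsetI)
    have "card (insert f (A - {e})) = q"
      using f e fin Suc.prems card_Suc_Diff1[of A e] by simp
    moreover have "card (A \<union> insert f (A - {e})) \<le> q + 1"
    proof -
      have "A \<union> insert f (A - {e}) = insert f A" using e by auto
      then show ?thesis using fin Suc.prems f by simp
    qed
    moreover have "insert f (A - {e}) \<inter> B = (A \<inter> B) - {e}" using f by auto
    then have "card (insert f (A - {e}) \<inter> B) \<le> k" using e fin Suc.prems by simp
    ultimately show ?thesis using that[of "insert f (A - {e})"] f Suc.prems by auto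
  qed
  have "q \<le> card ({..<2*q+1} - (A \<union> A'))"
    using A' Suc.prems fin finite_subset[OF A'(1)] by (subst card_Diff_subset) auto
  then obtain M where M: "M \<subseteq> {..<2*q+1} - (A \<union> A')" "card M = q"
    by (meson obtain_subset_with_card_n)
  obtain \<phi> where \<phi>: "kneser_col q \<phi> (set p')" "\<phi> (hd p') = A'" "\<phi> (last p') = B"
    using Suc.IH[OF _ len A'(1) _ A'(2) _ A'(4)] Suc.prems p by auto
  let ?\<psi> = "\<phi>(x := A, y := M)"
  have x: "x \<notin> set p'" "y \<notin> set p'" "x \<noteq> y" "E x y" "\<And>z. z \<in> set p' \<Longrightarrow> \<not> E x z"
    "\<And>z. z \<in> set p' \<Longrightarrow> E y z \<longleftrightarrow> z = hd p'"
    using Suc.prems(1) p p' by auto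
  have x': "\<And>z. z \<in> set p' \<Longrightarrow> \<not> E z x" "\<And>z. z \<in> set p' \<Longrightarrow> E z y \<longleftrightarrow> z = hd p'" "E y x"
    using x E_commute by blast+
  have AM: "A \<inter> M = {}" "A' \<inter> M = {}" using M(1) by auto
  have "kneser_col q ?\<psi> (set p)"
    unfolding set_colouring_def
  proof (intro conjI ballI impI)
    fix v assume "v \<in> set p"
    then show "?\<psi> v \<subseteq> {..<2 * q + 1}" "card (?\<psi> v) = q"
      using \<phi>(1) M Suc.prems(3,5) p unfolding set_colouring_def by auto
  next
    fix u v assume uv: "u \<in> set p" "v \<in> set p" "E u v"
    consider "u = x" "v = y" | "u = y" "v = x" | "u = y" "v = hd p'" | "v = y" "u = hd p'"
      | "u \<in> set p'" "v \<in> set p'"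
      using uv x x' p by auto
    then show "?\<psi> u \<inter> ?\<psi> v = {}"
    proof cases
      case 5
      then have "\<phi> u \<inter> \<phi> v = {}" using \<phi>(1) uv(3) unfolding set_colouring_def by blast
      then show ?thesis using 5 x by auto
    qed (use AM \<phi>(2) x p' in auto)
  qed
  moreover have "last p' \<in> set p'" using p' by simp
  then have "?\<psi> (hd p) = A \<and> ?\<psi> (last p) = B" using x p \<phi> p' by auto
  ultimately show ?case by blast
qed

text \<open>
  The complement of \<open>Y\<close> has \<open>q + 1 \<ge> 3\<close> elements and so at least three subsets with \<open>q\<close> elements. The colouring
  of ears rests on this consequence of \<open>q \<ge> 2\<close>.
\<close>

lemma third_colour:
  assumes "2 \<le> q" "Y \<subseteq> {..<2 * q + 1}" "card Y = q"
  obtains M where "M \<subseteq> {..<2 * q + 1}" "card M = q" "M \<inter> Y = {}" "M \<noteq> A" "M \<noteq> B"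
proof -
  let ?N = "{..<2 * q + 1} - Y"
  have c: "card ?N = q + 1" using assms finite_subset[OF assms(2)] by (subst card_Diff_subset) auto
  have "inj_on (\<lambda>i. ?N - {i}) ?N" by (auto simp: inj_on_def)
  then have "card ((\<lambda>i. ?N - {i}) ` ?N) = q + 1" using c by (simp add: card_image)
  moreover have "card {A, B} \<le> 2" by (simp add: card_insert_if)
  ultimately have "\<not> (\<lambda>i. ?N - {i}) ` ?N \<subseteq> {A, B}"
    using assms(1) card_mono[of "{A, B}" "(\<lambda>i. ?N - {i}) ` ?N"] by auto
  then obtain i where i: "i \<in> ?N" "?N - {i} \<noteq> A" "?N - {i} \<noteq> B" by blast
  then show thesis using that[of "?N - {i}"] c by auto
qed

definition holes_ge :: "nat \<Rightarrow> 'a set \<Rightarrow> bool" where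
  "holes_ge n X \<longleftrightarrow> (\<forall>cs. hole_list cs \<longrightarrow> set cs \<subseteq> X \<longrightarrow> n \<le> length cs)"

lemma holes_ge_mono: "holes_ge n X \<Longrightarrow> Y \<subseteq> X \<Longrightarrow> holes_ge n Y"
  unfolding holes_ge_def by blast

text \<open>
  The path \<open>p\<close> runs around \<open>y\<close>, whose colour set is \<open>Y\<close>. By the bound on the lengths of holes, each sector is so long that
  \<open>kneser_col_odd_path\<close> joins any two different colour sets of its ends. Hence only the neighbours of \<open>y\<close> on \<open>p\<close> have to be coloured,
  consecutive ones differently. By \<open>third_colour\<close> this is possible as soon as there is one besides the ends of \<open>p\<close>, even if
  \<open>A = B\<close>.
\<close>

lemma kneser_col_ear:
  assumes X: "triangle_free X" "odd_holes X" "holes_ge (2 * q + 1) X" "2 \<le> q"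
    and Y: "Y \<subseteq> {..<2 * q + 1}" "card Y = q" and B: "B \<subseteq> {..<2 * q + 1}" "card B = q" "B \<inter> Y = {}"
    and "ipath p" "y \<notin> set p" "y \<in> X" "set p \<subseteq> X" "E y (hd p)" "E y (last p)" "p \<noteq> []" "hd p \<noteq> last p"
      "A \<subseteq> {..<2 * q + 1}" "card A = q" "A \<inter> Y = {}"
      "A \<noteq> B \<or> (\<exists>z\<in>set p. E y z \<and> z \<noteq> hd p \<and> z \<noteq> last p)"
  shows "\<exists>\<phi>. kneser_col q \<phi> (set p) \<and> \<phi> (hd p) = A \<and> \<phi> (last p) = B \<and> (\<forall>z\<in>set p. E y z \<longrightarrow> \<phi> z \<inter> Y = {})"
  using assms(10-)
proof (induction p arbitrary: A rule: length_induct)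
  case (1 p)
  note H = 1(2-)
  obtain x p' where p: "p = x # p'" using H by (cases p) auto
  have "\<exists>u\<in>set p'. E y u" using H p by (auto split: if_splits)
  then obtain a m b where m: "p' = a @ m # b" "E y m" "\<forall>z\<in>set a. \<not> E y z"
    by (metis split_list_first_prop)
  have ip: "ipath (x # a @ [m])" "ipath (m # b)"
    using H(1) ipath_append[of "x # a @ [m]" b] ipath_append[of "x # a" "m # b"] p m by auto
  have ev: "even (length a)"
    by (rule sector_even[OF X(1,2) ip(1), of y]) (use H p m in auto)
  have h: "hole_list (y # x # a @ [m])"
    by (rule sector_hole[OF X(1) ip(1)]) (use H p m in auto)
  have "set (y # x # a @ [m]) \<subseteq> X" using H p m by auto
  then have "2 * q + 1 \<le> length (y # x # a @ [m])"
    using X(3) h unfolding holes_ge_def by blast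
  then have "2 * q - 2 \<le> length a" by simp
  moreover obtain j where j: "length a = 2 * j" using ev by blast
  ultimately have la: "q - 1 \<le> j" "length (x # a @ [m]) = 2 * j + 2" by auto
  have sec: "\<exists>\<phi>. kneser_col q \<phi> (set (x # a @ [m])) \<and> \<phi> x = A \<and> \<phi> m = M"
    if M: "M \<subseteq> {..<2 * q + 1}" "card M = q" "A \<noteq> M" for M
  proof -
    have "finite A" "finite M" using finite_subset H(9) M(1) by blast+
    then have "A \<inter> M \<subset> A" using M H(10) by (metis Int_lower1 card_subset_eq inf.absorb_iff1 inf_commute psubsetI)
    then have "card (A \<inter> M) < q" using H(10) psubset_card_mono[OF \<open>finite A\<close>] by blast
    then show ?thesis
      using kneser_col_odd_path[OF ip(1) la(2) H(9) M(1) H(10) M(2)] la(1) by auto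
  qed
  show ?case
  proof (cases "b = []")
    case True
    then have "A \<noteq> B" using H(12) p m by auto
    from sec[OF B(1,2) this] obtain \<phi> where \<phi>: "kneser_col q \<phi> (set (x # a @ [m]))" "\<phi> x = A" "\<phi> m = B" by blast
    then show ?thesis
      using p m True B(3) H(11) by (intro exI[of _ \<phi>]) auto
  next
    case False
    obtain M where M: "M \<subseteq> {..<2 * q + 1}" "card M = q" "M \<inter> Y = {}" "M \<noteq> A" "M \<noteq> B"
      using third_colour[OF X(4) Y] .
    obtain \<phi> where \<phi>: "kneser_col q \<phi> (set (x # a @ [m]))" "\<phi> x = A" "\<phi> m = M" using sec[OF M(1,2)] M(4) by auto
    have lb: "last (m # b) = last p" "last b \<in> set b" using p m False by auto
    have "m \<notin> set b" using ip(2) by simp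
    then have mne: "m \<noteq> last p" using lb False by auto
    have "\<exists>\<psi>. kneser_col q \<psi> (set (m # b)) \<and> \<psi> (hd (m # b)) = M \<and> \<psi> (last (m # b)) = B \<and>
        (\<forall>z\<in>set (m # b). E y z \<longrightarrow> \<psi> z \<inter> Y = {})"
    proof (rule 1(1)[rule_format])
      show "y \<notin> set (m # b)" "set (m # b) \<subseteq> X" "length (m # b) < length p" using H(2,4) p m by auto
      show "E y (last (m # b))" "hd (m # b) \<noteq> last (m # b)" using H(6) lb(1) mne by simp_all
      show "M \<noteq> B \<or> (\<exists>z\<in>set (m # b). E y z \<and> z \<noteq> hd (m # b) \<and> z \<noteq> last (m # b))" using M(5) by blast
    qed (use ip(2) m(2) M H(3) in simp_all)
    then obtain \<psi> where \<psi>: "kneser_col q \<psi> (set (m # b))" "\<psi> m = M" "\<psi> (last p) = B"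
        "\<And>z. z \<in> set (m # b) \<Longrightarrow> E y z \<Longrightarrow> \<psi> z \<inter> Y = {}"
      unfolding lb(1) list.sel(1) by blast
    let ?P = "set (x # a @ [m])"
    let ?\<chi> = "\<lambda>v. if v \<in> ?P then \<phi> v else \<psi> v"
    have dis: "set (x # a) \<inter> set (m # b) = {}" "\<And>u v. u \<in> set (x # a) \<Longrightarrow> v \<in> set b \<Longrightarrow> \<not> E u v"
      using H(1) ipath_append[of "x # a" "m # b"] p m \<open>m \<notin> set b\<close> by auto
    have agree: "\<phi> v = \<psi> v" if "v \<in> ?P" "v \<in> set (m # b)" for v
    proof -
      have "v = m" using that dis(1) \<open>m \<notin> set b\<close> by auto
      then show ?thesis using \<phi>(3) \<psi>(2) by simp
    qed
    have U: "?P \<union> set (m # b) = set p" using p m by auto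
    have "kneser_col q ?\<chi> (?P \<union> set (m # b))"
    proof (rule set_colouring_union[OF \<phi>(1) \<psi>(1) agree])
      fix u v assume "u \<in> ?P - set (m # b)" "v \<in> set (m # b) - ?P"
      then have "u \<in> set (x # a)" "v \<in> set b" by auto
      then show "\<not> E u v" by (rule dis(2))
    qed
    then have "kneser_col q ?\<chi> (set p)" unfolding U .
    moreover have "last p \<notin> ?P"
    proof
      assume "last p \<in> ?P"
      then have "last p \<in> set (x # a)" using mne by auto
      then show False using lb(2) dis(1) p m False by auto
    qed
    then have "?\<chi> (last p) = B" using \<psi>(3) by simp
    moreover have "?\<chi> (hd p) = A" using p \<phi>(2) by simp
    moreover have "\<forall>z\<in>set p. E y z \<longrightarrow> ?\<chi> z \<inter> Y = {}"
    proof (intro ballI impI)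
      fix z assume z: "z \<in> set p" "E y z"
      show "?\<chi> z \<inter> Y = {}"
      proof (cases "z \<in> ?P")
        case True
        then have "z = x \<or> z = m" using z(2) m(3) by auto
        then show ?thesis using True \<phi>(2,3) M(3) H(11) by auto
      next
        case False
        then show ?thesis using \<psi>(4) z U by auto
      qed
    qed
    ultimately show ?thesis by blast
  qed
qed

section \<open>Kneser colourings of triangle-free graphs\<close>

lemma no_square:
  assumes "triangle_free X" "odd_holes X" "{a, b, c, d} \<subseteq> X" "E a b" "E b c" "E c d" "E d a" "a \<noteq> c"
  shows "b = d"
proof (rule ccontr)
  assume "b \<noteq> d"
  have "\<not> E a c" "\<not> E b d"
    using triangle_freeD[OF assms(1), of a b c] triangle_freeD[OF assms(1), of b c d] assms(3-7) by auto
  then have "hole_list [a, b, c, d]"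
    using assms(4-8) \<open>b \<noteq> d\<close> by (auto simp: E_commute)
  from odd_holesD[OF assms(2) this] assms(3) show False by simp
qed

text \<open>
  An outside vertex with two neighbours on a hole sees at least three vertices of it and cuts off a shorter hole.
\<close>

lemma shortest_hole_clean:
  assumes "triangle_free X" "odd_holes X" "hole_list cs0" "set cs0 \<subseteq> X"
  obtains cs where "hole_list cs" "set cs \<subseteq> X" "clean X (set cs)"
proof -
  let ?H = "\<lambda>cs. hole_list cs \<and> set cs \<subseteq> X"
  obtain cs where cs: "?H cs" and min: "\<And>cs'. ?H cs' \<Longrightarrow> length cs \<le> length cs'"
    using ex_has_least_nat[of ?H cs0 length] assms(3,4) by blast
  have "clean X (set cs)"
    unfolding clean_def
  proof (intro ballI impI, rule ccontr)
    fix f u w assume f: "f \<in> X - set cs" and uw: "u \<in> set cs" "w \<in> set cs" "E f u" "E f w" "u \<noteq> w"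
    obtain p where p: "hole_list (u # p)" "set (u # p) = set cs" "length (u # p) = length cs"
      using hole_list_at[of cs u] cs uw by blast
    then have "\<exists>z\<in>set p. E f z" using uw by auto
    then obtain a z b where z: "p = a @ z # b" "E f z" "\<forall>z\<in>set a. \<not> E f z"
      by (metis split_list_first_prop)
    have X: "set (u # p) \<subseteq> X" "f \<notin> set (u # p)" "f \<in> X" using p cs f by auto
    have nE: "\<not> E u z" "\<And>v. v \<in> set (u # p) \<Longrightarrow> E v u \<Longrightarrow> \<not> E f v"
      using triangle_freeD[OF assms(1), of f u z] triangle_freeD[OF assms(1), of f _ u] X uw z by auto
    have b: "b \<noteq> []" using p(1) z nE by auto
    have a: "a \<noteq> []" using p(1) z nE by auto
    have ip: "ipath (a @ [z])" "ipath (z # b)" "set a \<inter> set b = {}"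
      using p(1) z ipath_append[of "a @ [z]" b] ipath_append[of "a" "z # b"] by auto
    have nu: "E u v \<longleftrightarrow> v = hd a \<or> v = last b" if "v \<in> set (a @ z # b)" for v
      using p(1) z a b that by auto
    have "ipath (u # a @ [z])" using hole_arc[of u a z b] p(1) z(1) b by blast
    then have "hole_list (f # u # a @ [z])"
      by (rule sector_hole[OF assms(1)]) (use X z uw in auto)
    moreover have "set (f # u # a @ [z]) \<subseteq> X" using X z by auto
    ultimately have "length cs \<le> length (f # u # a @ [z])" using min by blast
    then have "length b \<le> 1" using p(3) z by simp
    then obtain r where r: "b = [r]" using b by (cases b) auto
    have "f = r"
      by (rule no_square[OF assms(1,2), of z f u r]) (use r X z uw nu[of r] ip p(1) in \<open>auto simp: E_commute\<close>)
    then show False using X z r by auto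
  qed
  with cs that show thesis by blast
qed

lemma tree_attachment:
  assumes "triangle_free X" "\<And>cs. hole_list cs \<Longrightarrow> \<not> set cs \<subseteq> X" "conn C" "C \<subseteq> X" "v \<in> X - C"
    "u \<in> C" "w \<in> C" "E v u" "E v w"
  shows "u = w"
proof (rule ccontr)
  assume "u \<noteq> w"
  let ?R = "\<lambda>a b. a \<noteq> b \<and> E v a \<and> E v b"
  obtain p where p: "p \<noteq> []" "ipath p" "set p \<subseteq> C" "?R (hd p) (last p)"
    and min: "\<And>p'. p' \<noteq> [] \<Longrightarrow> successively E p' \<Longrightarrow> set p' \<subseteq> C \<Longrightarrow> ?R (hd p') (last p') \<Longrightarrow> length p \<le> length p'"
    using shortest_path[OF assms(3,6,7), of ?R] assms(8,9) \<open>u \<noteq> w\<close> by blast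
  note sub = shortest_sub[of C ?R, OF min p(2,3)]
  obtain x t where t: "p = x # t" using p by (cases p) auto
  then have "t \<noteq> []" using p by auto
  then obtain a z where z: "p = x # a @ [z]" using t by (metis rev_exhaust)
  have "\<forall>s\<in>set a. \<not> E v s"
  proof
    fix s assume "s \<in> set a"
    then obtain a1 a2 where "a = a1 @ s # a2" by (meson split_list)
    then show "\<not> E v s" using sub[of "[]" "x # a1 @ [s]" "a2 @ [z]"] p z by auto
  qed
  then have "hole_list (v # x # a @ [z])"
    by (intro sector_hole[OF assms(1)]) (use p z assms(4,5) in auto)
  moreover have "set (v # x # a @ [z]) \<subseteq> X" using p z assms(4,5) by auto
  ultimately show False using assms(2) by blast
qed

lemma component_eq:
  assumes "r \<in> D" "s \<in> component D r" shows "component D s = component D r"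
proof -
  have s: "s \<in> D" using component_subset[OF assms(1)] assms(2) by blast
  have "component D s \<inter> component D r = component D r"
    by (rule connD[OF component_conn[OF assms(1)], of _ s])
       (use assms s component_root[OF s] component_closed[OF s] component_closed[OF assms(1)] component_subset[OF assms(1)] in blast)+
  moreover have "component D r \<inter> component D s = component D s"
    by (rule connD[OF component_conn[OF s], of _ s])
       (use assms s component_root[OF s] component_closed[OF s] component_closed[OF assms(1)] component_subset[OF s] in blast)+
  ultimately show ?thesis by blast
qed

text \<open>
  Distinct components of \<open>X - W\<close> are not joined by edges, so the extensions over the components can be chosen independently.
\<close>

lemma set_colouring_extend_components:
  assumes "set_colouring n s \<phi> W" "W \<subseteq> X"
    and "\<And>r. r \<in> X - W \<Longrightarrow> \<exists>\<psi>. set_colouring n s \<psi> (W \<union> component (X - W) r) \<and> (\<forall>v\<in>W. \<psi> v = \<phi> v)"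
  shows "\<exists>\<psi>. set_colouring n s \<psi> X \<and> (\<forall>v\<in>W. \<psi> v = \<phi> v)"
proof -
  let ?C = "component (X - W)"
  define g where "g K = (SOME \<psi>. set_colouring n s \<psi> (W \<union> K) \<and> (\<forall>v\<in>W. \<psi> v = \<phi> v))" for K
  have g: "set_colouring n s (g (?C r)) (W \<union> ?C r)" "\<And>v. v \<in> W \<Longrightarrow> g (?C r) v = \<phi> v" if "r \<in> X - W" for r
    using someI_ex[OF assms(3)[OF that]] unfolding g_def by blast+
  let ?h = "\<lambda>v. if v \<in> W then \<phi> v else g (?C v) v"
  have eq: "?h v = g (?C r) v" if "r \<in> X - W" "v \<in> W \<union> ?C r" for r v
  proof (cases "v \<in> W")
    case True
    then show ?thesis using g(2)[OF that(1)] by simp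
  next
    case False
    then have "v \<in> ?C r" using that(2) by blast
    then show ?thesis using False component_eq[OF that(1)] by simp
  qed
  have hs: "set_colouring n s ?h (W \<union> ?C r)" if "r \<in> X - W" for r
    by (rule set_colouring_cong[OF g(1)[OF that]]) (rule eq[OF that])
  have "set_colouring n s ?h X"
    unfolding set_colouring_def
  proof (intro conjI ballI impI)
    fix v assume v: "v \<in> X"
    have "?h v \<subseteq> {..<n} \<and> card (?h v) = s v"
    proof (cases "v \<in> W")
      case True then show ?thesis using assms(1) by (auto simp: set_colouring_def)
    next
      case False
      then show ?thesis using hs[of v] component_root[of v "X - W"] v unfolding set_colouring_def by blast
    qed
    then show "?h v \<subseteq> {..<n}" "card (?h v) = s v" by auto
  next
    fix u v assume uv: "u \<in> X" "v \<in> X" "E u v"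
    consider "u \<in> W" "v \<in> W" | "u \<in> X - W" | "v \<in> X - W" using uv by blast
    then show "?h u \<inter> ?h v = {}"
    proof cases
      case 1
      then show ?thesis using assms(1) uv(3) by (auto simp: set_colouring_def)
    next
      case 2
      then have "v \<in> W \<union> ?C u" "u \<in> W \<union> ?C u"
        using component_root[OF 2] component_closed[OF 2, of u v] uv by blast+
      then show ?thesis using hs[OF 2] uv(3) unfolding set_colouring_def by blast
    next
      case 3
      then have "u \<in> W \<union> ?C v" "v \<in> W \<union> ?C v"
        using component_root[OF 3] component_closed[OF 3, of v u] uv E_sym by blast+
      then show ?thesis using hs[OF 3] uv(3) unfolding set_colouring_def by blast
    qed
  qed
  then show ?thesis by (intro exI[of _ ?h]) simp
qed

lemma sector_containing:
  assumes "triangle_free X" "hole_list R" "set R \<subseteq> X" "y \<in> X - set R" "u \<in> set R"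
    "r \<in> set R" "r' \<in> set R" "r \<noteq> r'" "E y r" "E y r'"
  obtains S T where "hole_list (S @ T)" "set (S @ T) = set R" "hole_list (y # S)" "u \<in> set S" "T \<noteq> []"
    "E y (hd S)" "E y (last S)"
proof -
  obtain p where p: "hole_list (u # p)" "set (u # p) = set R" using hole_list_at[OF assms(2,5)] by blast
  have X: "set (u # p) \<subseteq> X" "y \<notin> set (u # p)" "y \<in> X" using p assms by auto
  have rr: "r \<in> set (u # p)" "r' \<in> set (u # p)" unfolding p(2) by fact+
  then have "\<exists>z\<in>set p. E y z" using assms(8-10) by auto
  then obtain a z b where z: "p = a @ z # b" "E y z" "\<forall>z\<in>set a. \<not> E y z"
    by (metis split_list_first_prop)
  show thesis
  proof (cases "E y u")
    case True
    have "\<not> E u z" using triangle_freeD[OF assms(1), of y u z] X True z by auto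
    then have b: "b \<noteq> []" and a: "a \<noteq> []" using p(1) z by auto
    have "ipath (u # a @ [z])"
      using hole_arc[of u a z b] p(1) z(1) b by blast
    then have "hole_list (y # u # a @ [z])"
      by (rule sector_hole[OF assms(1)]) (use X True z in auto)
    moreover have "hole_list ((u # a @ [z]) @ b)" "set ((u # a @ [z]) @ b) = set R" using p z(1) by simp_all
    ultimately show thesis using that[of "u # a @ [z]" b] b z True by simp
  next
    case False
    then have "\<exists>w\<in>set b. E y w" using rr assms(8-10) z by auto
    then obtain m w c where w: "b = m @ w # c" "E y w" "\<forall>z\<in>set c. \<not> E y z"
      by (metis split_list_last_prop)
    have rot: "hole_list ((w # c) @ u # a @ z # m)"
      using hole_list_rotate[of "u # a @ z # m" w c] p(1) z w by simp
    have st: "set ((w # c) @ u # a @ z # m) = set R" using p(2) z w by auto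
    have "\<not> E z w" using triangle_freeD[OF assms(1), of y z w] X w z by auto
    moreover have "ipath (z # m @ w # c)" using p(1) z w by (simp add: ipath_append)
    ultimately have m: "m \<noteq> []" by auto
    have "ipath (w # (c @ u # a) @ [z])"
      by (rule hole_arc[of w "c @ u # a" z m]) (use rot m in simp_all)
    then have "hole_list (y # w # (c @ u # a) @ [z])"
      by (rule sector_hole[OF assms(1)]) (use X False z w in auto)
    moreover have "hole_list ((w # (c @ u # a) @ [z]) @ m)" "set ((w # (c @ u # a) @ [z]) @ m) = set R"
      using rot st by simp_all
    ultimately show thesis using that[of "w # (c @ u # a) @ [z]" m] m w z by simp
  qed
qed

declare hole_list.simps(2) [simp del]

lemma clean_mono: "clean F H \<Longrightarrow> F' \<subseteq> F \<Longrightarrow> clean F' H"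
  unfolding clean_def by blast

lemma cleanD: "clean F H \<Longrightarrow> f \<in> F \<Longrightarrow> f \<notin> H \<Longrightarrow> u \<in> H \<Longrightarrow> w \<in> H \<Longrightarrow> E f u \<Longrightarrow> E f w \<Longrightarrow> u = w"
  unfolding clean_def by blast

text \<open>
  By \<open>attachments_connected\<close>, the attachments of \<open>D\<close> form a connected part of the rim \<open>R\<close>. If they were not contained in a single
  sector of the hub \<open>y\<close>, a path \<open>Q\<close> through \<open>D\<close> would pass some end \<open>e\<close> of a sector: its ends are attached to the two
  neighbours of \<open>e\<close> on the rim, and its inner vertices to no other rim vertex than \<open>e\<close>. Replacing \<open>e\<close> by \<open>Q\<close> gives a hole that
  avoids the adjacent vertices \<open>y\<close> and \<open>e\<close>, on which \<open>y\<close> keeps at least two neighbours and \<open>e\<close> has some; this contradicts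
  \<open>hole_two_hubs\<close>.
\<close>

lemma wheel_attachments:
  assumes X: "triangle_free X" "odd_holes X" and R: "hole_list R" "set R \<subseteq> X" and y: "y \<in> X - set R"
    and rr: "r \<in> set R" "r' \<in> set R" "r \<noteq> r'" "E y r" "E y r'"
    and D: "conn D" "D \<subseteq> X - insert y (set R)" "clean (set R \<union> D) (set R)"
  obtains S where "hole_list (y # S)" "set S \<subset> set R"
    "\<And>d s. d \<in> D \<Longrightarrow> s \<in> set R \<Longrightarrow> E d s \<Longrightarrow> s \<in> set S"
proof -
  let ?L = "{s\<in>set R. \<exists>d\<in>D. E d s}"
  have sec: "\<exists>S. hole_list (y # S) \<and> set S \<subset> set R \<and> u \<in> set S" if u: "u \<in> set R" for u
  proof -
    obtain S T where S: "hole_list (S @ T)" "set (S @ T) = set R" "hole_list (y # S)" "u \<in> set S" "T \<noteq> []"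
      using sector_containing[OF X(1) R y u rr] by blast
    then have "set S \<subset> set R" using hole_list_distinct[OF S(1)] by (cases T) auto
    then show ?thesis using S by blast
  qed
  show thesis
  proof (cases "\<exists>u\<in>?L. \<not> E y u")
    case False
    have "s = t" if st: "s \<in> ?L" "t \<in> ?L" for s t
    proof (rule ccontr)
      assume "s \<noteq> t"
      obtain d d' where d: "d \<in> D" "E d s" "d' \<in> D" "E d' t" using st by blast
      obtain a b where "E a b" "a \<in> ?L" "b \<in> ?L"
        by (rule attachments_connected[of "set R \<union> D" R D d d' s t "{s}" "?L - {s}"])
           (use R D d st \<open>s \<noteq> t\<close> X(2) in \<open>auto intro: odd_holes_mono\<close>)
      then show False using False triangle_freeD[OF X(1), of y a b] R y by auto
    qed
    then obtain u where u: "u \<in> set R" "?L \<subseteq> {u}" using rr by blast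
    with sec[OF u(1)] that show thesis by blast
  next
    case True
    then obtain u where u: "u \<in> ?L" "\<not> E y u" by blast
    obtain S T where S: "hole_list (S @ T)" "set (S @ T) = set R" "hole_list (y # S)" "u \<in> set S" "T \<noteq> []"
        "E y (hd S)" "E y (last S)"
      using sector_containing[OF X(1) R y _ rr] u by blast
    have dST: "set S \<inter> set T = {}" using hole_list_distinct[OF S(1)] by auto
    let ?c = "hd S" and ?c' = "last S"
    have Sne: "S \<noteq> []" using S(4) by auto
    have SE: "E y s \<longleftrightarrow> s = ?c \<or> s = ?c'" if "s \<in> set S" for s
      using S(3) that by (simp add: hole_list.simps(2))
    have cS: "?c \<in> set S" "?c' \<in> set S" using Sne by auto
    have SX: "set S \<subseteq> X" "y \<notin> set S" "set S \<subseteq> set R" using S(2) R y by auto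
    have "length S \<ge> 3" "ipath S" using S(3) by (simp_all add: hole_list.simps(2))
    then have cc: "?c \<noteq> ?c'" using ipath_distinct[of S] by (cases S) auto
    have two: "\<not> (E s ?c \<and> E s ?c')" if s: "s \<in> X" "s \<noteq> y" for s
    proof
      assume *: "E s ?c \<and> E s ?c'"
      then show False
        using cc no_square[OF X, of y ?c s ?c'] * S(6,7) s y SX cS by (auto simp: E_commute)
    qed
    have "?L \<subseteq> set S"
    proof (rule ccontr)
      assume "\<not> ?thesis"
      then obtain w where w: "w \<in> set T" "w \<in> ?L" using S(2) by auto
      let ?So = "set S - {?c, ?c'}"
      obtain d d' where d: "d \<in> D" "E d u" "d' \<in> D" "E d' w" using w u by blast
      have uSo: "u \<in> ?So" using u(2) S(4,6,7) by auto
      have dd: "d \<in> {d. \<exists>s\<in>?So. E d s}" "d' \<in> {d. \<exists>s\<in>set T. E d s}" using d uSo w by blast+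
      obtain Q where Q: "Q \<noteq> []" "ipath Q" "set Q \<subseteq> D"
          "\<And>d. d \<in> set Q \<Longrightarrow> d \<in> {d. \<exists>s\<in>?So. E d s} \<longleftrightarrow> d = hd Q"
          "\<And>d. d \<in> set Q \<Longrightarrow> d \<in> {d. \<exists>s\<in>set T. E d s} \<longleftrightarrow> d = last Q"
        by (rule path_between[OF D(1) d(1,3) dd]) (rule that)
      have hl: "hd Q \<in> set Q" "last Q \<in> set Q" using Q(1) by auto
      obtain u' where u': "u' \<in> ?So" "E (hd Q) u'" using Q(4)[OF hl(1)] by auto
      obtain w' where w': "w' \<in> set T" "E (last Q) w'" using Q(5)[OF hl(2)] by auto
      have inR: "u' \<in> set R" "w' \<in> set R" "?c \<in> set R" "?c' \<in> set R" using u' w' S(2) cS by auto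
      have uniq: "s = t" if "q \<in> set Q" "s \<in> set R" "t \<in> set R" "E q s" "E q t" for q s t
        using cleanD[OF D(3), of q s t] that Q(3) D(2) by blast
      \<comment> \<open>The attachments of \<open>Q\<close>: one inside the sector, one beyond it, and otherwise only the two ends of the sector.\<close>
      define lab where "lab s \<longleftrightarrow> (\<exists>q\<in>set Q. E q s)" for s
      have labs: "s \<in> {u', w', ?c, ?c'}" if q: "q \<in> set Q" "s \<in> set R" "E q s" for q s
      proof -
        consider "s \<in> ?So" | "s \<in> set T" | "s \<in> {?c, ?c'}" using q(2) S(2) by auto
        then show ?thesis
        proof cases
          case 1
          then have "q = hd Q" using Q(4)[OF q(1)] q(3) by blast
          then show ?thesis using uniq[OF q(1,2) inR(1)] q u' by auto
        next
          case 2
          then have "q = last Q" using Q(5)[OF q(1)] q(3) by blast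
          then show ?thesis using uniq[OF q(1,2) inR(2)] q w' by auto
        qed auto
      qed
      have lab_uw: "lab u'" "lab w'" using u' w' hl unfolding lab_def by blast+
      have uw: "u' \<noteq> w'" "u' \<noteq> ?c" "u' \<noteq> ?c'" "w' \<noteq> ?c" "w' \<noteq> ?c'" "?c \<noteq> ?c'"
        using u'(1) w'(1) dST cS cc by auto
      have att: "\<exists>a\<in>A. \<exists>b\<in>B. lab a \<and> lab b \<and> E a b"
        if H: "a \<in> A" "b \<in> B" "lab a" "lab b" "A \<inter> B = {}" "A \<subseteq> set R" "B \<subseteq> set R"
          "\<And>s. s \<in> {u', w', ?c, ?c'} \<Longrightarrow> lab s \<Longrightarrow> s \<in> A \<union> B" for a b A B
      proof -
        obtain q q' where q: "q \<in> set Q" "E q a" "q' \<in> set Q" "E q' b" using H(3,4) lab_def by blast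
        show ?thesis
        proof (rule attachments_connected[of "set R \<union> set Q" R "set Q" q q' a b A B])
          show "odd_holes (set R \<union> set Q)" using X(2) R(2) Q(3) D(2) by (auto intro: odd_holes_mono)
          show "clean (set R \<union> set Q) (set R)" using D(3) Q(3) by (auto intro: clean_mono)
          show "conn (set Q)" using Q(2) by (simp add: conn_walk_set ipath_imp_successively)
          show "set Q \<subseteq> (set R \<union> set Q) - set R" using Q(3) D(2) by auto
          show "s \<in> A \<union> B" if "d \<in> set Q" "s \<in> set R" "E d s" for d s
            using H(8)[OF labs[OF that]] that(1,3) unfolding lab_def by blast
        qed (use R q H in \<open>auto simp: lab_def\<close>)
      qed
      have nuw: "\<not> E u' w'"
      proof -
        obtain S1 S2 where S12: "S = S1 @ u' # S2" using u'(1) by (meson DiffD1 split_list)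
        have "S1 \<noteq> []" "S2 \<noteq> []" using u'(1) S12 by auto
        have "hole_list (u' # S2 @ T @ S1)" using hole_list_rotate[of S1 u' "S2 @ T"] S(1) S12 by simp
        then have "E u' w' \<longleftrightarrow> w' = hd S2 \<or> w' = last S1"
          using w'(1) \<open>S1 \<noteq> []\<close> \<open>S2 \<noteq> []\<close> by (simp add: hole_list.simps(2))
        moreover have "hd S2 \<in> set S" "last S1 \<in> set S" using \<open>S1 \<noteq> []\<close> \<open>S2 \<noteq> []\<close> S12 by auto
        ultimately show ?thesis using w'(1) dST by auto
      qed
      have no_clique_cutset: "\<not> E ?c ?c'" using triangle_freeD[OF X(1), of y ?c ?c'] S(6,7) y SX cS by auto
      have key: False if e: "{e, e'} = {?c, ?c'}" "E u' e" "lab e" for e e'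
      proof -
        have ee: "e \<noteq> e'" "e \<in> set R" "e' \<in> set R" "E y e" "E y e'" "\<not> E e e'"
          using e(1) uw inR S(6,7) no_clique_cutset E_sym by (auto simp: doubleton_eq_iff)
        have ne: "u' \<noteq> e" "u' \<noteq> e'" "w' \<noteq> e" "w' \<noteq> e'" using e(1) uw by (auto simp: doubleton_eq_iff)
        have two': "\<not> (E s e \<and> E s e')" if "s \<in> X" "s \<noteq> y" for s
          using two[OF that] e(1) by (auto simp: doubleton_eq_iff)
        have sX: "u' \<in> X" "u' \<noteq> y" "w' \<in> X" "w' \<noteq> y" using inR R(2) y by auto
        have set4: "{u', w', ?c, ?c'} = {u', w', e, e'}" using e(1) by auto
        have ue': "\<not> E u' e'" using two'[OF sX(1,2)] e(2) by blast
        have "\<exists>a\<in>{u', e}. \<exists>b\<in>{w', e'}. lab a \<and> lab b \<and> E a b"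
          by (rule att[of u' _ w']) (use inR ee ne uw lab_uw set4 in auto)
        then have we: "E w' e" using nuw ue' ee E_sym by auto
        then have we': "\<not> E w' e'" using two'[OF sX(3,4)] by blast
        have e': "\<not> lab e'"
        proof
          assume "lab e'"
          have "\<exists>a\<in>{e'}. \<exists>b\<in>{u', w', e}. lab a \<and> lab b \<and> E a b"
            by (rule att[of e' _ u']) (use inR ee ne lab_uw set4 \<open>lab e'\<close> in auto)
          then show False using ue' we' ee E_sym by auto
        qed
        obtain p0 where p0: "hole_list (e # p0)" "set (e # p0) = set R"
          using hole_list_at[OF R(1) ee(2)] by blast
        have uwp: "u' \<in> set p0" "w' \<in> set p0" using inR ne p0(2) by auto
        have ends: "{hd p0, last p0} = {u', w'}"
          using p0(1) uwp e(2) we uw(1) E_sym[of u' e] E_sym[of w' e] by (auto simp: hole_list.simps(2))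
        obtain p where p: "hole_list (e # p)" "set (e # p) = set R" "hd p = u'" "last p = w'"
        proof (cases "hd p0 = u'")
          case True
          then have "last p0 = w'" using ends by (auto simp: doubleton_eq_iff)
          then show ?thesis using that[of p0] p0 True by blast
        next
          case False
          then have "hd p0 = w'" "last p0 = u'" using ends by (auto simp: doubleton_eq_iff)
          moreover have "p0 \<noteq> []" using uwp by auto
          ultimately show ?thesis using that[of "rev p0"] p0 hole_list_rev[OF p0(1)] 
            by (simp add: hd_rev last_rev)
        qed
        have pp: "ipath p" "e \<notin> set p" "3 \<le> length p" using p(1) by (simp_all add: hole_list.simps(2))
        have t: "p = u' # tl p" "tl p \<noteq> []" using pp(3) p(3) by (cases p; cases "tl p"; auto)+
        define t where "t = tl p"
        note t = t[folded t_def]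
        have lt: "last t = w'" using t p(4) by simp
        have QR: "set Q \<inter> set R = {}" "y \<notin> set Q" using Q(3) D(2) by auto
        have hlne: "hd Q \<noteq> last Q" using uniq[OF hl(1) inR(1,2)] u' w' uw by auto
        have Qp: "E s q \<longleftrightarrow> (s = u' \<and> q = hd Q) \<or> (s = w' \<and> q = last Q)" if "s \<in> set p" "q \<in> set Q" for s q
        proof
          assume "E s q"
          then have "E q s" by (rule E_sym)
          have "s \<in> set R" using that p(2) by auto
          then have "s \<in> {u', w', e, e'}" using labs[OF that(2) _ \<open>E q s\<close>] set4 by blast
          moreover have "s \<noteq> e" using pp that by auto
          moreover have "s \<noteq> e'" using e' \<open>E q s\<close> that(2) unfolding lab_def by blast
          moreover have "q = hd Q" if "s = u'" using Q(4)[OF \<open>q \<in> set Q\<close>] \<open>E q s\<close> u'(1) that by blast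
          moreover have "q = last Q" if "s = w'" using Q(5)[OF \<open>q \<in> set Q\<close>] \<open>E q s\<close> w'(1) that by blast
          ultimately show "(s = u' \<and> q = hd Q) \<or> (s = w' \<and> q = last Q)" by blast
        next
          assume "(s = u' \<and> q = hd Q) \<or> (s = w' \<and> q = last Q)"
          then show "E s q" using u' w' E_sym by blast
        qed
        let ?R' = "u' # t @ rev Q"
        have disj: "set p \<inter> set Q = {}" using QR p(2) by auto
        have h1: "hd (rev Q) = last Q" "last (rev Q) = hd Q" "ipath (rev Q)" 
          using Q(1,2) by (simp_all add: hd_rev last_rev ipath_rev)
        have "ipath (t @ rev Q)"
          unfolding ipath_append
        proof (intro conjI ballI)
          show "ipath t" using pp(1) t by simp
          show "set t \<inter> set (rev Q) = {}" using disj t by auto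
          fix a b assume ab: "a \<in> set t" "b \<in> set (rev Q)"
          then have "a \<in> set p" "b \<in> set Q" "a \<noteq> u'" using t pp(1) by auto
          then show "E a b \<longleftrightarrow> a = last t \<and> b = hd (rev Q)" using Qp[of a b] lt h1 by auto
        qed (rule h1)
        moreover have "E u' b \<longleftrightarrow> b = hd (t @ rev Q) \<or> b = last (t @ rev Q)" if "b \<in> set (t @ rev Q)" for b
        proof (cases "b \<in> set t")
          case True
          have "b \<noteq> hd Q" using True disj hl t by auto
          moreover have "E u' b \<longleftrightarrow> b = hd t" using pp(1) t True by auto
          ultimately show ?thesis using t h1 Q(1) by simp
        next
          case False
          then have "b \<in> set Q" "u' \<in> set p" "b \<noteq> hd t" using that t by auto
          then show ?thesis using Qp[of u' b] t uw(1) h1 Q(1) by auto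
        qed
        moreover have "u' \<notin> set (t @ rev Q)" using disj t pp(1) by auto
        moreover have "3 \<le> length (t @ rev Q)" using pp(3) t Q(1) by (cases Q) auto
        ultimately have R': "hole_list ?R'" by (simp add: hole_list.simps(2))
        have sR': "set ?R' = set R - {e} \<union> set Q" using p(2) pp(2) t by auto
        have odd: "odd (card {s\<in>set R. E y s})"
          by (rule hole_nbrs_odd[OF X R, of y r]) (use y rr in auto)
        have "{r, r'} \<subseteq> {s\<in>set R. E y s}" using rr by auto
        then have "2 \<le> card {s\<in>set R. E y s}" using card_mono[of "{s\<in>set R. E y s}" "{r, r'}"] rr(3) by auto
        then have "3 \<le> card {s\<in>set R. E y s}" using odd by (metis even_numeral le_neq_implies_less not_less_eq_eq numeral_2_eq_2 numeral_3_eq_3 Suc_leI)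
        moreover have "{s\<in>set R. E y s} \<subseteq> {e, e'} \<or> (\<exists>z\<in>set R. E y z \<and> z \<noteq> e \<and> z \<noteq> e')" by blast
        moreover have "card {e, e'} \<le> 2" by (simp add: card_insert_if)
        ultimately obtain z where z: "z \<in> set R" "E y z" "z \<noteq> e" "z \<noteq> e'"
          using card_mono[of "{e, e'}" "{s\<in>set R. E y s}"] by auto
        have "\<not> E e u'"
          by (rule hole_two_hubs[OF X R', of y e e' z])
             (use sR' z ee R(2) Q(3) D(2) y QR in auto)
        then show False using e(2) E_sym by blast
      qed
      have "\<exists>a\<in>{u'}. \<exists>b\<in>{w', ?c, ?c'}. lab a \<and> lab b \<and> E a b"
        by (rule att[of u' _ w']) (use inR uw lab_uw in auto)
      then show False using nuw key[of ?c ?c'] key[of ?c' ?c] by auto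
    qed
    moreover have "set S \<subset> set R" using S(2,5) dST by (cases T) auto
    ultimately show thesis using that[of S] S(3) by blast
  qed
qed

text \<open>
  By \<open>shortest_attaching_path\<close>, the inner vertices of \<open>P\<close> can only be attached to a common neighbour of the attachments of the two
  ends. There is at most one, because the graph has no squares, and there is an attached inner vertex by \<open>no_theta\<close>. This common
  neighbour is \<open>y\<close>, and \<open>h\<close> is the rest of the hole. The last conclusion holds because a further vertex with two neighbours on \<open>P\<close> would
  yield a shortcut; it makes all holes of the resulting wheel clean.
\<close>

lemma shortest_ear:
  assumes X: "triangle_free X" "odd_holes X" and cs: "hole_list cs" "set cs \<subseteq> X" "clean X (set cs)"
    and C: "conn C" "C \<subseteq> X - set cs"
    and at: "d \<in> C" "d' \<in> C" "E d x0" "E d' z0" "x0 \<in> set cs" "z0 \<in> set cs" "x0 \<noteq> z0" "\<not> E x0 z0"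
  obtains y h P where "hole_list (y # h)" "set (y # h) = set cs" "P \<noteq> []" "ipath P" "set P \<subseteq> C"
    "\<And>p s. p \<in> set P \<Longrightarrow> s \<in> set h \<Longrightarrow> E p s \<longleftrightarrow> p = hd P \<and> s = hd h \<or> p = last P \<and> s = last h"
    "\<not> E y (hd P)" "\<not> E y (last P)" "\<exists>p\<in>set P. E y p"
    "\<And>f p r. f \<in> C - set P \<Longrightarrow> p \<in> set P \<Longrightarrow> r \<in> set P \<Longrightarrow> E f p \<Longrightarrow> E f r \<Longrightarrow> p = r"
proof -
  have uniq: "\<forall>c\<in>C. \<forall>s\<in>set cs. \<forall>t\<in>set cs. E c s \<longrightarrow> E c t \<longrightarrow> s = t"
    using cleanD[OF cs(3)] C(2) by blast
  obtain P x z where P: "P \<noteq> []" "ipath P" "set P \<subseteq> C"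
    and xz: "x \<in> set cs" "z \<in> set cs" "E (hd P) x" "E (last P) z" "x \<noteq> z" "\<not> E x z"
    and lab: "\<And>s. s \<in> set cs \<Longrightarrow> E (hd P) s \<Longrightarrow> s = x" and lab': "\<And>s. s \<in> set cs \<Longrightarrow> E (last P) s \<Longrightarrow> s = z"
    and inner: "\<And>p s. p \<in> set P \<Longrightarrow> p \<noteq> hd P \<Longrightarrow> p \<noteq> last P \<Longrightarrow> s \<in> set cs \<Longrightarrow> E p s \<Longrightarrow> E x s \<and> E s z"
    and min: "\<And>p' x z. p' \<noteq> [] \<Longrightarrow> successively E p' \<Longrightarrow> set p' \<subseteq> C \<Longrightarrow> x \<in> set cs \<Longrightarrow> z \<in> set cs \<Longrightarrow>
      E (hd p') x \<Longrightarrow> E (last p') z \<Longrightarrow> x \<noteq> z \<Longrightarrow> \<not> E x z \<Longrightarrow> length P \<le> length p'"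
    by (rule shortest_attaching_path[OF C(1) uniq at]) (rule that)
  have hl: "hd P \<in> set P" "last P \<in> set P" using P(1) by auto
  have "\<exists>p\<in>set P. p \<noteq> hd P \<and> p \<noteq> last P \<and> (\<exists>s\<in>set cs. E p s)"
  proof (rule ccontr)
    assume no: "\<not> ?thesis"
    have "E x z"
    proof (rule no_theta[OF X(2) cs(1,2) _ _ P(1,2) xz(1,2,5)])
      show "set P \<subseteq> X" "set P \<inter> set cs = {}" using P(3) C(2) by auto
      show "E q s \<longleftrightarrow> q = hd P \<and> s = x \<or> q = last P \<and> s = z" if "q \<in> set P" "s \<in> set cs" for q s
        using no lab[of s] lab'[of s] that xz by metis
    qed
    with xz(6) show False by contradiction
  qed
  then obtain p y where p: "p \<in> set P" "p \<noteq> hd P" "p \<noteq> last P" and y: "y \<in> set cs" "E p y" by blast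
  have xyz: "E x y" "E y z" using inner[OF p y] by auto
  obtain h0 where h0: "hole_list (y # h0)" "set (y # h0) = set cs" using hole_list_at[OF cs(1) y(1)] by blast
  have xzh: "x \<in> set h0" "z \<in> set h0" using xz(1,2)[folded h0(2)] xyz by auto
  have "E y x" using xyz E_sym by blast
  then have ends: "{hd h0, last h0} = {x, z}"
    using h0(1) xzh xyz(2) xz(5) by (auto simp: hole_list.simps(2))
  obtain h where h: "hole_list (y # h)" "set (y # h) = set cs" "hd h = x" "last h = z"
  proof (cases "hd h0 = x")
    case True
    then have "last h0 = z" using ends by (auto simp: doubleton_eq_iff)
    then show ?thesis using that[of h0] h0 True by blast
  next
    case False
    then have "hd h0 = z" "last h0 = x" using ends by (auto simp: doubleton_eq_iff)
    moreover have "h0 \<noteq> []" using xzh by auto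
    ultimately show ?thesis using that[of "rev h0"] h0 hole_list_rev[OF h0(1)] by (simp add: hd_rev last_rev)
  qed
  have hh: "ipath h" "y \<notin> set h" "3 \<le> length h" using h(1) by (simp_all add: hole_list.simps(2))
  have only_y: "s = y" if s: "s \<in> set cs" "E x s" "E s z" for s
  proof -
    have "{x, y, z, s} \<subseteq> X" using cs(2) xz(1,2) y(1) s(1) by auto
    then show ?thesis using no_square[OF X, of x s z y] s xyz xz(5) by (auto simp: E_commute)
  qed
  show thesis
  proof (rule that[OF h(1,2) P(1-3)])
    fix p s assume ps: "p \<in> set P" "s \<in> set h"
    have s: "s \<in> set cs" "s \<noteq> y" using ps(2) h(2) hh(2) by auto
    show "E p s \<longleftrightarrow> p = hd P \<and> s = hd h \<or> p = last P \<and> s = last h"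
      unfolding h(3,4) using lab[of s] lab'[of s] inner[OF ps(1), of s] only_y[of s] s xz by metis
  next
    have "x \<noteq> y" "z \<noteq> y" using xyz by auto
    then show "\<not> E y (hd P)" "\<not> E y (last P)" using lab[of y] lab'[of y] y(1) E_sym by blast+
    show "\<exists>p\<in>set P. E y p" using p y E_sym by blast
  next
    fix f p r assume f: "f \<in> C - set P" and pr: "p \<in> set P" "r \<in> set P" "E f p" "E f r"
    have gap: False if eq: "P = a @ p # m @ r # b" and E: "E f p" "E f r" for a p m r b
    proof -
      have pmr: "p \<in> C" "r \<in> C" "set m \<subseteq> C" using eq P(3) by auto
      have sX: "f \<in> X" "p \<in> X" "r \<in> X" "set m \<subseteq> X" using f pmr C(2) by auto
      have ip: "ipath (p # m @ [r])" using P(2) ipath_sublist[of a "p # m @ [r]" b] eq by simp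
      have "2 \<le> length m"
      proof (rule ccontr)
        assume "\<not> ?thesis"
        then consider "m = []" | c where "m = [c]" by (cases m; cases "tl m") auto
        then show False
        proof cases
          case 1
          then show False using ip triangle_freeD[OF X(1), of f p r] sX E by auto
        next
          case 2
          then have "c = f"
            using no_square[OF X, of p c r f] ip sX E by (auto simp: E_commute)
          then show False using f eq 2 by auto
        qed
      qed
      let ?P' = "a @ p # f # r # b"
      have "successively E P" using P(2) by (rule ipath_imp_successively)
      then have "successively E ?P'" using E E_sym[OF E(1)] unfolding eq
        by (auto simp: successively_append_iff successively_Cons)
      moreover have "hd ?P' = hd P" "last ?P' = last P" by (auto simp: eq hd_append)
      moreover have "set ?P' \<subseteq> C" using P(3) f eq by auto
      ultimately have "length P \<le> length ?P'" using min[of ?P' x z] xz by simp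
      with \<open>2 \<le> length m\<close> show False by (simp add: eq)
    qed
    show "p = r"
    proof (rule ccontr)
      assume "p \<noteq> r"
      obtain a b where ab: "P = a @ p # b" using pr(1) by (meson split_list)
      then consider "r \<in> set a" | "r \<in> set b" using pr(2) \<open>p \<noteq> r\<close> by auto
      then show False
      proof cases
        case 1
        then obtain a1 a2 where "a = a1 @ r # a2" by (meson split_list)
        then show False using gap[of a1 r a2 p b] ab pr by simp
      next
        case 2
        then obtain b1 b2 where "b = b1 @ r # b2" by (meson split_list)
        then show False using gap[of a p b1 r b2] ab pr by simp
      qed
    qed
  qed
qed

lemma kneser_col_hole:
  assumes X: "triangle_free X" "odd_holes X" "holes_ge (2 * q + 1) X" "2 \<le> q" and cs: "hole_list cs" "set cs \<subseteq> X"
  shows "\<exists>\<phi>. kneser_col q \<phi> (set cs)"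
proof -
  obtain y p where yp: "cs = y # p" using cs(1) by (cases cs) auto
  have p: "ipath p" "y \<notin> set p" "3 \<le> length p" "\<And>u. u \<in> set p \<Longrightarrow> E y u \<longleftrightarrow> u = hd p \<or> u = last p"
    using cs(1) yp by (simp_all add: hole_list.simps(2))
  have pe: "p \<noteq> []" using p(3) by auto
  have ne: "hd p \<noteq> last p" using p(3) ipath_distinct[OF p(1)] by (cases p) auto
  let ?Y = "{..<q}"
  have Y: "?Y \<subseteq> {..<2 * q + 1}" "card ?Y = q" by auto
  obtain A where A: "A \<subseteq> {..<2 * q + 1}" "card A = q" "A \<inter> ?Y = {}" using third_colour[OF X(4) Y] .
  obtain B where B: "B \<subseteq> {..<2 * q + 1}" "card B = q" "B \<inter> ?Y = {}" "B \<noteq> A" using third_colour[OF X(4) Y] .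
  have sX: "y \<in> X" "set p \<subseteq> X" "E y (hd p)" "E y (last p)" using cs(2) yp p(4) pe by auto
  have "A \<noteq> B \<or> (\<exists>z\<in>set p. E y z \<and> z \<noteq> hd p \<and> z \<noteq> last p)" using B(4) by blast
  from kneser_col_ear[OF X Y B(1-3) p(1,2) sX pe ne A this]
  obtain \<phi> where \<phi>: "kneser_col q \<phi> (set p)" "\<forall>z\<in>set p. E y z \<longrightarrow> \<phi> z \<inter> ?Y = {}" by blast
  have "kneser_col q (\<phi>(y := ?Y)) (set cs)"
    using \<phi> p(2) Y E_sym unfolding set_colouring_def yp by auto
  then show ?thesis by blast
qed

text \<open>
  If the attachments of \<open>C\<close> form a clique, then \<open>C\<close> is coloured together with them and glued to the hole. Otherwise an ear is
  coloured first. Each component of what remains is attached within one hole of the resulting wheel, the rim or a sector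
  together with the hub, and this hole is again clean and misses a vertex of the wheel.
\<close>

lemma kneser_col_extend_component:
  assumes X: "triangle_free X" "odd_holes X" "holes_ge (2 * q + 1) X" "2 \<le> q"
    and cs: "hole_list cs" "set cs \<subseteq> X" "clean X (set cs)"
    and C: "conn C" "C \<subseteq> X - set cs" "X = set cs \<union> C" and \<phi>: "kneser_col q \<phi> (set cs)"
    and IH1: "\<And>Y. Y \<subset> X \<Longrightarrow> \<exists>\<psi>. kneser_col q \<psi> Y"
    and IH2: "\<And>Y cs \<phi>. Y \<subset> X \<Longrightarrow> hole_list cs \<Longrightarrow> set cs \<subseteq> Y \<Longrightarrow> clean Y (set cs) \<Longrightarrow> kneser_col q \<phi> (set cs) \<Longrightarrow>
      \<exists>\<psi>. kneser_col q \<psi> Y \<and> (\<forall>v\<in>set cs. \<psi> v = \<phi> v)"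
  shows "\<exists>\<psi>. kneser_col q \<psi> X \<and> (\<forall>v\<in>set cs. \<psi> v = \<phi> v)"
proof -
  let ?L = "{s\<in>set cs. \<exists>d\<in>C. E d s}"
  show ?thesis
  proof (cases "is_clique ?L")
    case True
    obtain v p where "cs = v # p" using cs(1) by (cases cs) auto
    then have vp: "ipath p" "3 \<le> length p" "cs = v # p" using cs(1) by (simp_all add: hole_list.simps(2))
    then obtain a b c t where "p = a # b # c # t" by (cases p; cases "tl p"; cases "tl (tl p)") auto
    then have "a \<in> set cs" "c \<in> set cs" "a \<noteq> c" "\<not> E a c" using vp by auto
    then have "a \<notin> ?L \<or> c \<notin> ?L" using True unfolding is_clique_def by blast
    then have "C \<union> ?L \<subset> X" using \<open>a \<in> set cs\<close> \<open>c \<in> set cs\<close> C(2) cs(2) by blast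
    then obtain \<psi> where \<psi>: "kneser_col q \<psi> (C \<union> ?L)" using IH1 by blast
    have I: "set cs \<inter> (C \<union> ?L) = ?L" using C(2) by auto
    obtain \<chi> where \<chi>: "kneser_col q \<chi> (set cs \<union> (C \<union> ?L))" "\<And>v. v \<in> set cs \<Longrightarrow> \<chi> v = \<phi> v"
    proof (rule set_colouring_glue[OF \<phi> \<psi>])
      show "is_clique (set cs \<inter> (C \<union> ?L))" unfolding I by (rule True)
      show "\<not> E u v" if "u \<in> set cs - (C \<union> ?L)" "v \<in> C \<union> ?L - set cs" for u v
        using that E_sym by blast
    qed (use that in auto)
    moreover have "set cs \<union> (C \<union> ?L) = X" using C(3) by auto
    ultimately show ?thesis by metis
  next
    case False
    then obtain x0 z0 where xz: "x0 \<in> ?L" "z0 \<in> ?L" "x0 \<noteq> z0" "\<not> E x0 z0" unfolding is_clique_def by blast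
    then obtain d d' where dd: "d \<in> C" "d' \<in> C" "E d x0" "E d' z0" by blast
    from xz have xz': "x0 \<in> set cs" "z0 \<in> set cs" by auto
    obtain y h P where h: "hole_list (y # h)" "set (y # h) = set cs" and P: "P \<noteq> []" "ipath P" "set P \<subseteq> C"
      and hP: "\<And>p s. p \<in> set P \<Longrightarrow> s \<in> set h \<Longrightarrow> E p s \<longleftrightarrow> p = hd P \<and> s = hd h \<or> p = last P \<and> s = last h"
      and yP: "\<not> E y (hd P)" "\<not> E y (last P)" "\<exists>p\<in>set P. E y p"
      and fP: "\<And>f p r. f \<in> C - set P \<Longrightarrow> p \<in> set P \<Longrightarrow> r \<in> set P \<Longrightarrow> E f p \<Longrightarrow> E f r \<Longrightarrow> p = r"
      using shortest_ear[OF X(1,2) cs C(1,2) dd xz' xz(3,4)] by blast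
    have hh: "ipath h" "y \<notin> set h" "3 \<le> length h" "\<And>u. u \<in> set h \<Longrightarrow> E y u \<longleftrightarrow> u = hd h \<or> u = last h"
      using h(1) by (simp_all add: hole_list.simps(2))
    have hne: "h \<noteq> []" using hh(3) by auto
    let ?x = "hd h" and ?z = "last h"
    have xz: "?x \<in> set h" "?z \<in> set h" "?x \<noteq> ?z" using hne hh(3) ipath_distinct[OF hh(1)] by (cases h; auto)+
    have Eyx: "E y ?x" "E y ?z" using hh(4) xz by auto
    have dis: "set cs \<inter> set P = {}" "y \<notin> set P" "set h \<inter> set P = {}" using P(3) C(2) h(2) by auto
    have sX: "y \<in> X" "set h \<subseteq> X" "set P \<subseteq> X" using h(2) cs(2) P(3) C(2) by auto
    have hlP: "hd P \<in> set P" "last P \<in> set P" using P(1) by auto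
    let ?p = "?x # P @ [?z]"
    have PE: "E ?x p \<longleftrightarrow> p = hd P" "E p ?z \<longleftrightarrow> p = last P" if "p \<in> set P" for p
      using hP[OF that xz(1)] hP[OF that xz(2)] xz(3) E_commute[of ?x p] by auto
    have nxz: "\<not> E ?x ?z" using triangle_freeD[OF X(1), of y ?x ?z] sX xz Eyx by auto
    have ip: "ipath ?p"
      using P(1,2) PE nxz dis xz hlP by (auto simp: ipath_append hd_append)
    have sp: "set ?p \<subseteq> X" "y \<notin> set ?p" using sX xz dis hh(2) by auto
    have Pin: "\<exists>u\<in>set ?p. E y u \<and> u \<noteq> hd ?p \<and> u \<noteq> last ?p" using yP(3) dis xz by fastforce
    \<comment> \<open>The colours on \<open>P\<close> have to be disjoint from the colours of \<open>y\<close> wherever \<open>y\<close> sees \<open>P\<close>.\<close>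
    obtain \<omega> where \<omega>: "kneser_col q \<omega> (set cs \<union> set P)" "\<And>v. v \<in> set cs \<Longrightarrow> \<omega> v = \<phi> v"
    proof -
      have k: "\<phi> v \<subseteq> {..<2 * q + 1}" "card (\<phi> v) = q" if "v \<in> set cs" for v using \<phi> that by (auto simp: set_colouring_def)
      have ycs: "y \<in> set cs" "?x \<in> set cs" "?z \<in> set cs" using h(2) xz by auto
      have d: "\<phi> ?z \<inter> \<phi> y = {}" "\<phi> ?x \<inter> \<phi> y = {}" using \<phi> Eyx ycs unfolding set_colouring_def by blast+
      obtain \<psi> where \<psi>: "kneser_col q \<psi> (set ?p)" "\<psi> (hd ?p) = \<phi> ?x" "\<psi> (last ?p) = \<phi> ?z"
          "\<forall>u\<in>set ?p. E y u \<longrightarrow> \<psi> u \<inter> \<phi> y = {}"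
        using kneser_col_ear[OF X k[OF ycs(1)] k[OF ycs(3)] d(1) ip sp(2) sX(1) sp(1) _ _ _ _ k[OF ycs(2)] d(2)] Pin Eyx xz by auto
      let ?\<psi> = "\<psi>(y := \<phi> y)"
      have 1: "kneser_col q ?\<psi> (insert y (set ?p))"
        unfolding set_colouring_def
      proof (intro conjI ballI impI)
        fix v assume "v \<in> insert y (set ?p)"
        then show "?\<psi> v \<subseteq> {..<2 * q + 1}" "card (?\<psi> v) = q"
          using \<psi>(1) k[OF ycs(1)] unfolding set_colouring_def by (auto simp del: set_append set_simps)
      next
        fix u v assume "u \<in> insert y (set ?p)" "v \<in> insert y (set ?p)" "E u v"
        then consider "u = y" "v \<in> set ?p" | "v = y" "u \<in> set ?p" "E y u" | "u \<in> set ?p" "v \<in> set ?p"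
          using E_sym E_irrefl by blast
        then show "?\<psi> u \<inter> ?\<psi> v = {}"
        proof cases
          case 1
          then have "v \<noteq> y" "\<psi> v \<inter> \<phi> y = {}" using \<psi>(4) \<open>E u v\<close> sp(2) by blast+
          then show ?thesis using 1 by auto
        next
          case 2
          then have "u \<noteq> y" "\<psi> u \<inter> \<phi> y = {}" using \<psi>(4) sp(2) by blast+
          then show ?thesis using 2 by auto
        next
          case 3
          then have "u \<noteq> y" "v \<noteq> y" "\<psi> u \<inter> \<psi> v = {}" using \<psi>(1) \<open>E u v\<close> sp(2) unfolding set_colouring_def by blast+
          then show ?thesis by simp
        qed
      qed
      have I: "insert y (set ?p) \<inter> set cs = {y, ?x, ?z}" using ycs dis by auto
      have U: "set cs \<union> insert y (set ?p) = set cs \<union> set P" using ycs by auto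
      have "kneser_col q (\<lambda>v. if v \<in> set cs then \<phi> v else ?\<psi> v) (set cs \<union> insert y (set ?p))"
      proof (rule set_colouring_union[OF \<phi> 1])
        fix v assume "v \<in> set cs" "v \<in> insert y (set ?p)"
        then have "v \<in> {y, ?x, ?z}" using I by blast
        then show "\<phi> v = ?\<psi> v" using \<psi>(2,3) xz hh(2) by auto
      next
        fix u v assume u: "u \<in> set cs - insert y (set ?p)" and v: "v \<in> insert y (set ?p) - set cs"
        have "u \<in> set h" "u \<noteq> ?x" "u \<noteq> ?z" "v \<in> set P" using u v h(2) ycs by auto
        then show "\<not> E u v" using hP[of v u] E_sym by blast
      qed
      then show thesis using that unfolding U by fastforce
    qed
    \<comment> \<open>The rim of the wheel is the hole with \<open>y\<close> replaced by \<open>P\<close>.\<close>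
    let ?R = "h @ rev P"
    obtain t where t: "h = ?x # t" "t \<noteq> []" using hh(3) by (cases h; cases "tl h") auto
    have Rr: "hole_list ?R"
    proof -
      have "last (?x # t) = ?z" using t(1) by (rule arg_cong[OF sym])
      then have lt: "last t = ?z" "hd t \<in> set t" using t(2) by simp_all
      have h1: "hd (rev P) = last P" "last (rev P) = hd P" "ipath (rev P)" "rev P \<noteq> []"
        using P(1,2) by (simp_all add: hd_rev last_rev ipath_rev)
      have tx: "ipath t" "?x \<notin> set t" "\<And>u. u \<in> set t \<Longrightarrow> E ?x u \<longleftrightarrow> u = hd t"
        using hh(1) t(1) by (metis ipath.simps(2))+
      have st: "set t \<subseteq> set h" using t(1) by (metis set_subset_Cons)
      have "ipath (t @ rev P)"
        unfolding ipath_append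
      proof (intro conjI ballI)
        fix u v assume uv: "u \<in> set t" "v \<in> set (rev P)"
        then have "u \<in> set h" "v \<in> set P" "u \<noteq> ?x" using st tx by auto
        then show "E u v \<longleftrightarrow> u = last t \<and> v = hd (rev P)"
          using hP[of v u] lt h1 xz(3) E_commute by auto
      qed (use tx h1 st dis in auto)
      moreover have "E ?x u \<longleftrightarrow> u = hd (t @ rev P) \<or> u = last (t @ rev P)" if "u \<in> set (t @ rev P)" for u
      proof (cases "u \<in> set t")
        case True
        have "u \<noteq> hd P" using True st dis hlP by auto
        then show ?thesis using tx(3)[OF True] t(2) h1 by auto
      next
        case False
        then have "u \<in> set P" "u \<noteq> hd t" using that lt by auto
        then show ?thesis using PE(1)[of u] t(2) h1 by auto
      qed
      moreover have "?x \<notin> set (t @ rev P)" using tx(2) xz(1) dis by auto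
      moreover have "3 \<le> length (t @ rev P)"
      proof -
        have "length h = length t + 1" using t(1) by (metis Suc_eq_plus1 length_Cons)
        moreover have "1 \<le> length P" using P(1) by (cases P) auto
        ultimately show ?thesis using hh(3) by (simp only: length_append length_rev)
      qed
      ultimately have "hole_list (?x # t @ rev P)" by (simp add: hole_list.simps(2))
      then show ?thesis by (metis t(1) append_Cons)
    qed
    have sR: "set ?R = set h \<union> set P" by auto
    have ycs: "y \<in> set cs" using h(2) by auto
    have W: "set cs \<union> set P = insert y (set ?R)" using h(2) by auto
    have yR: "y \<in> X - set ?R" using sX dis hh(2) by auto
    have cleanW: "clean (set c \<union> D) (set c)"
      if c: "hole_list c" "set c \<subseteq> set cs \<union> set P" and D: "D \<subseteq> X - (set cs \<union> set P)" for c D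
      unfolding clean_def
    proof (intro ballI impI, rule ccontr)
      fix f u w assume f: "f \<in> set c \<union> D - set c" and uw: "u \<in> set c" "w \<in> set c" "E f u" "E f w" "u \<noteq> w"
      have fD: "f \<in> D" "f \<in> X" "f \<notin> set cs" "f \<in> C - set P" "f \<notin> set c" using f D C(3) by auto
      have one: "a = b" if "a \<in> set cs" "b \<in> set cs" "E f a" "E f b" for a b
        using cleanD[OF cs(3) fD(2,3) that] .
      have two: "a = b" if "a \<in> set P" "b \<in> set P" "E f a" "E f b" for a b using fP[OF fD(4) that] .
      have "{s\<in>set c. E f s} = {u, w}"
      proof
        show "{s\<in>set c. E f s} \<subseteq> {u, w}"
        proof
          fix s assume "s \<in> {s\<in>set c. E f s}"
          then have s: "s \<in> set cs \<or> s \<in> set P" "E f s" using c(2) by auto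
          have "u \<in> set cs \<or> u \<in> set P" "w \<in> set cs \<or> w \<in> set P" using uw c(2) by auto
          then show "s \<in> {u, w}" using s uw one[of u w] two[of u w] one[of s u] one[of s w] two[of s u] two[of s w] by blast
        qed
      qed (use uw in auto)
      moreover have "odd (card {s\<in>set c. E f s})"
        by (rule hole_nbrs_odd[OF X(1,2) c(1) _ fD(2,5) uw(1,3)]) (use c(2) cs(2) sX in auto)
      ultimately show False using uw(5) by simp
    qed
    have "\<exists>\<psi>. kneser_col q \<psi> X \<and> (\<forall>v\<in>set cs \<union> set P. \<psi> v = \<omega> v)"
    proof (rule set_colouring_extend_components[OF \<omega>(1)])
      show "set cs \<union> set P \<subseteq> X" using cs(2) sX by auto
      fix r assume r: "r \<in> X - (set cs \<union> set P)"
      let ?D = "component (X - (set cs \<union> set P)) r"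
      have D: "conn ?D" "?D \<subseteq> X - (set cs \<union> set P)" using component_conn[OF r] component_subset[OF r] by auto
      obtain c where c: "hole_list c" "set c \<subset> set cs \<union> set P"
          "\<And>d s. d \<in> ?D \<Longrightarrow> s \<in> set cs \<union> set P \<Longrightarrow> E d s \<Longrightarrow> s \<in> set c"
      proof (cases "\<exists>d\<in>?D. E d y")
        case False
        show thesis
        proof (rule that[OF Rr])
          show "set ?R \<subset> set cs \<union> set P" using W yR by auto
          show "s \<in> set ?R" if "d \<in> ?D" "s \<in> set cs \<union> set P" "E d s" for d s
            using False that W by auto
        qed
      next
        case True
        obtain S where S: "hole_list (y # S)" "set S \<subset> set ?R" "\<And>d s. d \<in> ?D \<Longrightarrow> s \<in> set ?R \<Longrightarrow> E d s \<Longrightarrow> s \<in> set S"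
        proof (rule wheel_attachments[OF X(1,2) Rr _ yR _ _ xz(3) Eyx D(1)])
          show "set ?R \<subseteq> X" "?D \<subseteq> X - insert y (set ?R)" using sX D(2) W by auto
          show "clean (set ?R \<union> ?D) (set ?R)" using cleanW[OF Rr _ D(2)] W by blast
        qed (use xz that in auto)
        show thesis
        proof (rule that[OF S(1)])
          show "set (y # S) \<subset> set cs \<union> set P" using S(2) W yR by auto
          show "s \<in> set (y # S)" if "d \<in> ?D" "s \<in> set cs \<union> set P" "E d s" for d s
            using S(3)[of d s] that W by auto
        qed
      qed
      have sub: "set c \<union> ?D \<subset> X" using c(2) D(2) cs(2) sX by blast
      have "kneser_col q \<omega> (set c)" using set_colouring_mono[OF \<omega>(1)] c(2) by blast
      moreover have "clean (set c \<union> ?D) (set c)" using cleanW[OF c(1) _ D(2)] c(2) by blast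
      ultimately obtain \<psi> where \<psi>: "kneser_col q \<psi> (set c \<union> ?D)" "\<forall>v\<in>set c. \<psi> v = \<omega> v"
        using IH2[OF sub c(1)] by blast
      let ?W = "set cs \<union> set P"
      have "kneser_col q (\<lambda>v. if v \<in> ?W then \<omega> v else \<psi> v) (?W \<union> (set c \<union> ?D))"
      proof (rule set_colouring_union[OF \<omega>(1) \<psi>(1)])
        show "\<omega> v = \<psi> v" if "v \<in> ?W" "v \<in> set c \<union> ?D" for v using that \<psi>(2) D(2) by auto
        show "\<not> E u v" if "u \<in> ?W - (set c \<union> ?D)" "v \<in> set c \<union> ?D - ?W" for u v
          using that c(2) c(3)[of v u] E_sym by blast
      qed
      moreover have "?W \<union> (set c \<union> ?D) = ?W \<union> ?D" using c(2) by blast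
      ultimately show "\<exists>\<psi>. kneser_col q \<psi> (?W \<union> ?D) \<and> (\<forall>v\<in>?W. \<psi> v = \<omega> v)"
        by (intro exI[of _ "\<lambda>v. if v \<in> ?W then \<omega> v else \<psi> v"]) auto
    qed
    then show ?thesis using \<omega>(2) by (metis UnI1)
  qed
qed

text \<open>
  The first part follows from the second because a shortest hole is clean; without holes, the graph is a forest and can be
  coloured by attaching one vertex at a time to components in which it has at most one neighbour. The induction for the
  second part uses the first for components attached to a clique.
\<close>

theorem kneser_colouring_extends:
  assumes "finite X" "triangle_free X" "odd_holes X" "holes_ge (2 * q + 1) X" "2 \<le> q"
  shows "(\<exists>\<phi>. kneser_col q \<phi> X) \<and> (\<forall>cs \<phi>. hole_list cs \<longrightarrow> set cs \<subseteq> X \<longrightarrow> clean X (set cs) \<longrightarrow> kneser_col q \<phi> (set cs) \<longrightarrow>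
     (\<exists>\<psi>. kneser_col q \<psi> X \<and> (\<forall>v\<in>set cs. \<psi> v = \<phi> v)))"
  using assms
proof (induction X rule: finite_psubset_induct)
  case (psubset X)
  note X = psubset.prems
  have IH1: "\<exists>\<psi>. kneser_col q \<psi> Y" if "Y \<subset> X" for Y
    using psubset.IH[OF that] X triangle_free_mono odd_holes_mono holes_ge_mono that by (metis psubset_imp_subset)
  have IH2: "\<exists>\<psi>. kneser_col q \<psi> Y \<and> (\<forall>v\<in>set cs. \<psi> v = \<phi> v)"
    if "Y \<subset> X" "hole_list cs" "set cs \<subseteq> Y" "clean Y (set cs)" "kneser_col q \<phi> (set cs)" for Y cs \<phi>
    using psubset.IH[OF that(1)] X triangle_free_mono odd_holes_mono holes_ge_mono that by (metis psubset_imp_subset)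
  have ext: "\<exists>\<psi>. kneser_col q \<psi> X \<and> (\<forall>v\<in>set cs. \<psi> v = \<phi> v)"
    if cs: "hole_list cs" "set cs \<subseteq> X" "clean X (set cs)" "kneser_col q \<phi> (set cs)" for cs \<phi>
  proof (rule set_colouring_extend_components[OF cs(4,2)])
    fix r assume r: "r \<in> X - set cs"
    let ?C = "component (X - set cs) r"
    let ?X = "set cs \<union> ?C"
    have C: "conn ?C" "?C \<subseteq> X - set cs" using component_conn[OF r] component_subset[OF r] by auto
    have sub: "?X \<subseteq> X" using C cs by auto
    have m: "triangle_free ?X" "odd_holes ?X" "holes_ge (2 * q + 1) ?X"
      using triangle_free_mono[OF X(1) sub] odd_holes_mono[OF X(2) sub] holes_ge_mono[OF X(3) sub]
      by simp_all
    show "\<exists>\<psi>. kneser_col q \<psi> ?X \<and> (\<forall>v\<in>set cs. \<psi> v = \<phi> v)"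
    proof (rule kneser_col_extend_component[OF m(1-3) X(4) cs(1) _ _ C(1) _ refl cs(4)])
      show "clean ?X (set cs)" using clean_mono[OF cs(3) sub] .
      show "?C \<subseteq> ?X - set cs" using C by auto
      show "\<exists>\<psi>. kneser_col q \<psi> Y" if "Y \<subset> ?X" for Y using IH1[of Y] that sub by blast
      show "\<exists>\<psi>. kneser_col q \<psi> Y \<and> (\<forall>v\<in>set cs. \<psi> v = \<phi> v)"
        if "Y \<subset> ?X" "hole_list cs" "set cs \<subseteq> Y" "clean Y (set cs)" "kneser_col q \<phi> (set cs)" for Y cs \<phi>
        using IH2[of Y cs \<phi>] that sub by blast
    qed auto
  qed
  moreover have "\<exists>\<phi>. kneser_col q \<phi> X"
  proof (cases "\<exists>cs. hole_list cs \<and> set cs \<subseteq> X")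
    case True
    then obtain cs where cs: "hole_list cs" "set cs \<subseteq> X" "clean X (set cs)"
      using shortest_hole_clean[OF X(1,2)] by metis
    then show ?thesis using kneser_col_hole[OF X cs(1,2)] ext by blast
  next
    case False
    show ?thesis
    proof (cases "X = {}")
      case True
      then show ?thesis by (simp add: set_colouring_def)
    next
      case ne: False
      then obtain v where v: "v \<in> X" by blast
      have "kneser_col q (\<lambda>_. {..<q}) {v}" by (simp add: set_colouring_def)
      then have "\<exists>\<psi>. kneser_col q \<psi> X \<and> (\<forall>u\<in>{v}. \<psi> u = {..<q})"
      proof (rule set_colouring_extend_components)
        show "{v} \<subseteq> X" using v by auto
        fix r assume r: "r \<in> X - {v}"
        let ?C = "component (X - {v}) r"
        have C: "conn ?C" "?C \<subseteq> X - {v}" using component_conn[OF r] component_subset[OF r] by auto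
        then have "?C \<subset> X" using v by blast
        then obtain \<psi> where \<psi>: "kneser_col q \<psi> ?C" using IH1 by blast
        have one: "u = w" if "u \<in> ?C" "w \<in> ?C" "E v u" "E v w" for u w
          using tree_attachment[OF X(1) _ C(1) _ _ that] False C v by blast
        obtain A where A: "A \<subseteq> {..<2 * q + 1}" "card A = q" "A \<inter> {..<q} = {}" 
          by (rule third_colour[OF X(4), of "{..<q}"]) auto
        let ?N = "{u\<in>?C. E v u}"
        let ?\<phi> = "\<lambda>u. if u = v then {..<q} else A"
        have vC: "v \<notin> ?C" using C by auto
        have "kneser_col q ?\<phi> (insert v ?N)"
          unfolding set_colouring_def
        proof (intro conjI ballI impI)
          fix u w assume uw: "u \<in> insert v ?N" "w \<in> insert v ?N" "E u w"
          then have "u = v \<or> w = v" using one[of u w] by auto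
          moreover have "u \<noteq> w" using uw(3) by auto
          ultimately show "?\<phi> u \<inter> ?\<phi> w = {}" using A(3) by auto
        qed (use A in auto)
        moreover have I: "insert v ?N \<inter> ?C = ?N" using vC by auto
        moreover have "finite ?N"
        proof (rule finite_subset[OF _ psubset.hyps])
          show "?N \<subseteq> X" using C by auto
        qed
        moreover have "is_clique ?N" using one unfolding is_clique_def by blast
        ultimately obtain \<chi> where "kneser_col q \<chi> (insert v ?N \<union> ?C)" "\<And>u. u \<in> insert v ?N \<Longrightarrow> \<chi> u = ?\<phi> u"
          using set_colouring_glue[of "2 * q + 1" "\<lambda>_. q" ?\<phi> "insert v ?N" \<psi> ?C] \<psi> unfolding I by blast
        moreover have "insert v ?N \<union> ?C = {v} \<union> ?C" by auto
        ultimately show "\<exists>\<psi>. kneser_col q \<psi> ({v} \<union> ?C) \<and> (\<forall>u\<in>{v}. \<psi> u = {..<q})" by auto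
      qed
      then show ?thesis by blast
    qed
  qed
  ultimately show ?case by blast
qed

section \<open>Graphs without caps and even holes\<close>

text \<open>
  The vertex \<open>v\<close> would form a cap with the hole if it saw \<open>d\<close> and \<open>a\<close> only.
\<close>

definition no_caps :: "'a set \<Rightarrow> bool" where
  "no_caps X \<longleftrightarrow> (\<forall>d a p v. hole_list (d # a # p) \<longrightarrow> set (d # a # p) \<subseteq> X \<longrightarrow> v \<in> X - set (d # a # p) \<longrightarrow>
     E v d \<longrightarrow> E v a \<longrightarrow> (\<exists>s\<in>set p. E v s))"

lemma no_capsD:
  "no_caps X \<Longrightarrow> hole_list (d # a # p) \<Longrightarrow> set (d # a # p) \<subseteq> X \<Longrightarrow> v \<in> X - set (d # a # p) \<Longrightarrow>
     E v d \<Longrightarrow> E v a \<Longrightarrow> \<exists>s\<in>set p. E v s"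
  unfolding no_caps_def by blast

lemma square_chord:
  assumes "odd_holes X" "{a, b, c, d} \<subseteq> X" "E a b" "E b c" "E c d" "E d a" "a \<noteq> c" "\<not> E a c" "b \<noteq> d"
  shows "E b d"
proof (rule ccontr)
  assume "\<not> E b d"
  then have "hole_list [a, b, c, d]"
    using assms E_commute[of d a] by (auto simp: hole_list.simps(2))
  from odd_holesD[OF assms(1) this] assms(2) show False by simp
qed

definition no_clique_cutset :: "'a set \<Rightarrow> bool" where
  "no_clique_cutset F \<longleftrightarrow> (\<forall>K\<subseteq>F. is_clique K \<longrightarrow> conn (F - K))"

lemma no_clique_cutsetD: "no_clique_cutset F \<Longrightarrow> K \<subseteq> F \<Longrightarrow> is_clique K \<Longrightarrow> conn (F - K)"
  unfolding no_clique_cutset_def by blast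

lemma path_through:
  assumes "conn B" "b \<in> B" "b' \<in> B" "E u b" "E w b'"
  obtains Q where "Q \<noteq> []" "ipath Q" "set Q \<subseteq> B" "\<And>q. q \<in> set Q \<Longrightarrow> E u q \<longleftrightarrow> q = hd Q"
    "\<And>q. q \<in> set Q \<Longrightarrow> E w q \<longleftrightarrow> q = last Q"
  using path_between[of B b b' "{q. E u q}" "{q. E w q}"] assms by (metis mem_Collect_eq)

text \<open>
  A shortest path through \<open>B\<close> from a neighbour of \<open>u\<close> to a neighbour of \<open>u'\<close> closes with the edge between \<open>u\<close> and \<open>u'\<close> to a hole,
  with which \<open>v\<close> forms a cap.
\<close>

lemma edge_cap:
  assumes "no_caps X" "{u, u', v} \<subseteq> X" "B \<subseteq> X" "u \<notin> B" "u' \<notin> B" "v \<notin> B" "E u u'" "E v u" "E v u'"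
    "conn B" "b \<in> B" "E u b" "b' \<in> B" "E u' b'" "\<And>x. x \<in> B \<Longrightarrow> \<not> E v x" "\<And>x. x \<in> B \<Longrightarrow> E u x \<Longrightarrow> \<not> E u' x"
  shows False
proof -
  obtain Q where Q: "Q \<noteq> []" "ipath Q" "set Q \<subseteq> B" "\<And>q. q \<in> set Q \<Longrightarrow> E u q \<longleftrightarrow> q = hd Q"
    "\<And>q. q \<in> set Q \<Longrightarrow> E u' q \<longleftrightarrow> q = last Q"
    by (rule path_through[OF assms(10,11,13,12,14)]) (rule that)
  have hl: "hd Q \<in> set Q" "last Q \<in> set Q" using Q(1) by auto
  then have "hd Q \<noteq> last Q" using Q(3-5) assms(16) by blast
  then have "2 \<le> length Q" using Q(1) by (cases Q; cases "tl Q") auto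
  moreover have "u \<notin> set Q" "u' \<notin> set Q" "u \<noteq> u'" using Q(3) assms(4,5,7) by auto
  ultimately have "hole_list (u' # u # Q)"
    using Q E_sym[OF assms(7)] hl by (auto simp: hole_list.simps(2))
  moreover have "set (u' # u # Q) \<subseteq> X" "v \<in> X - set (u' # u # Q)" using Q(3) assms by auto
  ultimately have "\<exists>s\<in>set Q. E v s" using no_capsD[OF assms(1)] assms(8,9) by blast
  then show False using Q(3) assms(15) by blast
qed

text \<open>
  The vertex \<open>d\<close> needs a further neighbour on \<open>p\<close>, since otherwise it forms a cap with the whole hole. If the first one
  were not the last vertex of \<open>p\<close>, the path \<open>p\<close> up to it would close with \<open>d\<close> to a hole on which \<open>v\<close> sees exactly \<open>d\<close> and
  the first vertex of \<open>p\<close>.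
\<close>

lemma cap_third:
  assumes "no_caps X" "hole_list (v # p)" "d \<in> X - set (v # p)" "set (v # p) \<subseteq> X" "E d v" "E d (hd p)"
    "triangle_free (insert d (set p))"
  shows "E d (last p)"
proof (rule ccontr)
  assume no: "\<not> E d (last p)"
  obtain a t where p: "p = a # t" using assms(2) by (cases p) (auto simp: hole_list.simps(2))
  have hp: "ipath p" "v \<notin> set p" "3 \<le> length p" "\<And>u. u \<in> set p \<Longrightarrow> E v u \<longleftrightarrow> u = hd p \<or> u = last p"
    using assms(2) by (simp_all add: hole_list.simps(2))
  have "\<exists>s\<in>set t. E d s" using no_capsD[OF assms(1), of v a t d] assms(2-6) p by auto
  then obtain m b r where t: "t = m @ b # r" "E d b" "\<forall>z\<in>set m. \<not> E d z"
    by (metis split_list_first_prop)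
  have da: "E d a" using assms(6) p by simp
  have "r \<noteq> []" using no p t by auto
  have "\<not> E a b" using triangle_freeD[OF assms(7), of d a b] da t p by auto
  then have "m \<noteq> []" using hp(1) p t by auto
  have ip: "ipath ((a # m @ [b]) @ r)" using hp(1) p t by simp
  then have ipm: "ipath (a # m @ [b])" "last r \<notin> set (a # m @ [b])"
    unfolding ipath_append using last_in_set[OF \<open>r \<noteq> []\<close>] by blast+
  have h: "hole_list (d # a # m @ [b])"
    using ipm(1) \<open>m \<noteq> []\<close> t da assms(3) p by (cases m) (auto simp: hole_list.simps(2))
  have "E v d" "E v a" using assms(5) E_sym hp(4)[of a] p by auto
  moreover have "set (d # a # m @ [b]) \<subseteq> X" "v \<in> X - set (d # a # m @ [b])" using assms(3,4) p t hp(2) by auto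
  ultimately obtain s where s: "s \<in> set (m @ [b])" "E v s" using no_capsD[OF assms(1) h] by blast
  then have "s = hd p \<or> s = last p" using hp(4)[of s] p t by auto
  moreover have "s \<noteq> hd p" using s(1) ipm(1) p by auto
  moreover have "last p = last r" using p t \<open>r \<noteq> []\<close> by simp
  ultimately show False using ipm(2) s(1) by auto
qed

text \<open>
  A clique of attachments would separate the component from the rest of \<open>Z\<close>.
\<close>

lemma attachments_nonclique:
  assumes "no_clique_cutset F" "r \<in> F - Z" "Z \<subseteq> F" "\<not> is_clique Z"
  shows "\<not> is_clique {z\<in>Z. \<exists>b\<in>component (F - Z) r. E z b}"
proof
  let ?N = "{z\<in>Z. \<exists>b\<in>component (F - Z) r. E z b}"
  assume K: "is_clique ?N"
  have "conn (F - ?N)" by (rule no_clique_cutsetD[OF assms(1) _ K]) (use assms(3) in blast)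
  then have "component (F - Z) r = F - ?N"
  proof (rule connD[of _ _ r])
    show "component (F - Z) r \<subseteq> F - ?N" "r \<in> component (F - Z) r"
      using component_subset[OF assms(2)] component_root[OF assms(2)] by auto
    fix x y assume "x \<in> component (F - Z) r" "y \<in> F - ?N" "E x y"
    then show "y \<in> component (F - Z) r" using component_closed[OF assms(2), of x y] E_sym[of x y] by blast
  qed
  then have "Z \<subseteq> ?N" using component_subset[OF assms(2)] assms(3) by blast
  then have "Z = ?N" by blast
  then show False using K assms(4) by simp
qed

text \<open>
  Cores are the triangle-free graphs around which a graph without caps and even holes is organised. The bound on the size
  excludes complete graphs and squares and admits all longer holes.
\<close>

definition core :: "'a set \<Rightarrow> bool" where
  "core F \<longleftrightarrow> finite F \<and> triangle_free F \<and> no_clique_cutset F \<and> 5 \<le> card F"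

lemma core_degree:
  assumes "core F" "d \<in> F"
  obtains a where "a \<in> F" "E d a" "a \<noteq> e"
proof -
  let ?N = "{a\<in>F. E d a}"
  have "\<not> ?N \<subseteq> {e}"
  proof
    assume N: "?N \<subseteq> {e}"
    then have "is_clique ?N" unfolding is_clique_def by blast
    then have "conn (F - ?N)" using assms(1) unfolding core_def by (intro no_clique_cutsetD) auto
    then have "{d} = F - ?N" by (rule connD[of _ _ d]) (use assms(2) in auto)
    then have "F \<subseteq> {d, e}" using N by blast
    then have "card F \<le> card {d, e}" by (intro card_mono) auto
    then show False using assms(1) unfolding core_def by (auto simp: card_insert_if split: if_splits)
  qed
  then show thesis using that by blast
qed

lemma core_triangle_free: "core F \<Longrightarrow> u \<in> F \<Longrightarrow> v \<in> F \<Longrightarrow> w \<in> F \<Longrightarrow> E u v \<Longrightarrow> E v w \<Longrightarrow> \<not> E u w"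
  unfolding core_def using triangle_freeD by blast

text \<open>
  Let \<open>Z \<noteq> F\<close> be the set of neighbours of \<open>v\<close> in \<open>F\<close>. If nonadjacent vertices \<open>a\<close>, \<open>c\<close> of \<open>Z\<close> are attached to the same component
  of \<open>F - Z\<close>, then \<open>v\<close> lies on a hole through \<open>a\<close>, the component and \<open>c\<close>, and \<open>cap_third\<close> shows that every neighbour of
  \<open>a\<close> in \<open>Z\<close> is also a neighbour of \<open>c\<close>. As there are no squares, \<open>a\<close> and \<open>c\<close> then have at most one neighbour in \<open>Z\<close>. The
  edge in \<open>Z\<close> and the connectedness of \<open>F\<close> provide such \<open>a\<close> and \<open>c\<close> with a neighbour \<open>d\<close> in \<open>Z\<close>. Since \<open>F - {d}\<close> is
  connected, this situation propagates with the same \<open>d\<close> to all components of \<open>F - Z\<close>, and so \<open>Z\<close> consists of \<open>d\<close> and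
  neighbours of \<open>d\<close>. No neighbour of \<open>d\<close> is missing, by \<open>edge_cap\<close>, which also shows that \<open>Z\<close> is not just an edge.
\<close>

lemma core_attachment:
  assumes X: "no_caps X" "odd_holes X" and F: "core F" "F \<subseteq> X" and v: "v \<in> X - F"
    and Z: "Z = {z\<in>F. E v z}" and u: "u \<in> Z" "u' \<in> Z" "E u u'"
  shows "Z = F \<or> (\<exists>d\<in>F. Z = {z\<in>F. z = d \<or> E d z})"
proof (cases "Z = F")
  case True
  then show ?thesis by simp
next
  case False
  note tri = core_triangle_free[OF F(1)]
  have ZF: "Z \<subseteq> F" using Z by auto
  have no_clique_cutset: "no_clique_cutset F" "triangle_free F" using F(1) unfolding core_def by auto
  have Znc: "\<not> is_clique Z"
  proof
    assume K: "is_clique Z"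
    have Zeq: "Z = {u, u'}"
    proof (rule ccontr)
      assume "Z \<noteq> {u, u'}"
      then have "\<not> Z \<subseteq> {u, u'}" using u by auto
      then obtain w where w: "w \<in> Z" "w \<noteq> u" "w \<noteq> u'" by blast
      then have "E u' w" "E u w" using K u unfolding is_clique_def by metis+
      then show False using u ZF tri[of u u' w] w by blast
    qed
    have c: "conn (F - Z)" by (rule no_clique_cutsetD[OF no_clique_cutset(1) ZF K])
    obtain a where a: "a \<in> F" "E u a" "a \<noteq> u'" using core_degree[OF F(1)] u ZF by blast
    obtain a' where a': "a' \<in> F" "E u' a'" "a' \<noteq> u" using core_degree[OF F(1)] u ZF by blast
    show False
    proof (rule edge_cap[where v = v, OF X(1) _ _ _ _ _ u(3) _ _ c _ a(2) _ a'(2)])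
      show "a \<in> F - Z" "a' \<in> F - Z" using a a' Zeq by auto
      show "\<And>x. x \<in> F - Z \<Longrightarrow> E u x \<Longrightarrow> \<not> E u' x" using tri[of u' u] u ZF E_sym by blast
    qed (use u Z F v in auto)
  qed
  let ?C = "component (F - Z)"
  define N where "N r = {z\<in>Z. \<exists>b\<in>?C r. E z b}" for r
  have N_F: "z \<in> F" "z \<in> Z" if "z \<in> N r" for z r using that ZF unfolding N_def by auto
  have N1: "\<not> is_clique (N r)" if "r \<in> F - Z" for r
    using attachments_nonclique[OF no_clique_cutset(1) that ZF Znc] unfolding N_def .
  have dagger: "E d c" if r: "r \<in> F - Z" and ac: "a \<in> N r" "c \<in> N r" "a \<noteq> c" "\<not> E a c" and d: "d \<in> Z" "E d a" for r a c d
  proof -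
    obtain b b' where b: "b \<in> ?C r" "b' \<in> ?C r" "E a b" "E c b'" using ac unfolding N_def by blast
    obtain Q where Q: "Q \<noteq> []" "ipath Q" "set Q \<subseteq> ?C r" "\<And>q. q \<in> set Q \<Longrightarrow> E a q \<longleftrightarrow> q = hd Q"
        "\<And>q. q \<in> set Q \<Longrightarrow> E c q \<longleftrightarrow> q = last Q"
      by (rule path_through[OF component_conn[OF r] b]) (rule that)
    have QF: "set Q \<subseteq> F - Z" using Q(3) component_subset[OF r] by blast
    have acZ: "a \<in> Z" "c \<in> Z" using N_F ac by auto
    have aQ: "a \<notin> set Q" "c \<notin> set Q" "v \<notin> set Q" "v \<noteq> a" "v \<noteq> c" using acZ QF ZF v by auto
    have "\<not> E v q" if "q \<in> set Q" for q using that QF Z by auto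
    moreover have "E v a" "E v c" using acZ Z by auto
    moreover have "ipath (Q @ [c])" using Q aQ E_commute[of _ c] by (auto simp: ipath_append)
    then have "ipath (a # Q @ [c])" using Q(1,4) aQ(1) ac(3,4) by (auto simp: hd_append)
    moreover have "3 \<le> length (a # Q @ [c])" using Q(1) by (cases Q) auto
    ultimately have h: "hole_list (v # a # Q @ [c])" using aQ by (auto simp: hole_list.simps(2))
    have "d \<noteq> a" "d \<noteq> v" using d v ZF by auto
    show ?thesis
    proof (cases "d = c")
      case True
      then show ?thesis using d(2) ac(4) E_sym by blast
    next
      case False
      have "E d (last (a # Q @ [c]))"
      proof (rule cap_third[OF X(1) h])
        show "d \<in> X - set (v # a # Q @ [c])" "set (v # a # Q @ [c]) \<subseteq> X"
          using d QF ZF acZ F(2) v False \<open>d \<noteq> a\<close> \<open>d \<noteq> v\<close> by auto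
        show "E d v" "E d (hd (a # Q @ [c]))" using d Z E_sym by auto
        show "triangle_free (insert d (set (a # Q @ [c])))"
          by (rule triangle_free_mono[OF no_clique_cutset(2)]) (use d QF acZ ZF in auto)
      qed
      then show ?thesis by simp
    qed
  qed
  have oF: "odd_holes F" using X(2) F(2) odd_holes_mono by blast
  have "\<exists>x0\<in>F - Z. \<exists>a0\<in>N x0. \<exists>d0\<in>Z. E a0 d0"
  proof -
    let ?M = "component Z u"
    have M: "?M \<subseteq> Z" "u \<in> ?M" using component_subset[OF u(1)] component_root[OF u(1)] by auto
    have "{z\<in>?M. \<exists>d\<in>Z. E z d} = ?M"
    proof (rule connD[OF component_conn[OF u(1)], of _ u])
      show "u \<in> {z\<in>?M. \<exists>d\<in>Z. E z d}" using M u by blast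
      show "y \<in> {z\<in>?M. \<exists>d\<in>Z. E z d}" if "x \<in> {z\<in>?M. \<exists>d\<in>Z. E z d}" "y \<in> ?M" "E x y" for x y
        using that M(1) E_sym[of x y] by blast
    qed auto
    moreover have "\<exists>a\<in>?M. \<exists>x\<in>F. E a x \<and> x \<notin> ?M"
    proof (rule ccontr)
      assume "\<not> ?thesis"
      moreover have "conn F" using no_clique_cutsetD[OF no_clique_cutset(1), of "{}"] unfolding is_clique_def by simp
      ultimately have "?M = F" by (intro connD[of F _ u]) (use M ZF in auto)
      then show False using M ZF \<open>Z \<noteq> F\<close> by blast
    qed
    then obtain a x where ax: "a \<in> ?M" "x \<in> F" "E a x" "x \<notin> ?M" by blast
    then have x: "x \<in> F - Z" using component_closed[OF u(1), of a x] by blast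
    moreover have "a \<in> N x" using ax M component_root[OF x] unfolding N_def by blast
    moreover have "a \<in> {z\<in>?M. \<exists>d\<in>Z. E z d}" using ax(1) calculation(1) by simp
    then have "\<exists>d\<in>Z. E a d" by blast
    ultimately show ?thesis by blast
  qed
  then obtain a0 x0 d0 where a0: "x0 \<in> F - Z" "a0 \<in> N x0" "d0 \<in> Z" "E a0 d0" by blast
  \<comment> \<open>If \<open>a0\<close> itself is adjacent to all other attachments of its component, it can play the part of \<open>d\<close>.\<close>
  have "\<exists>r\<in>F - Z. \<exists>a\<in>N r. \<exists>c\<in>N r. \<exists>d\<in>Z. a \<noteq> c \<and> \<not> E a c \<and> E d a"
  proof (cases "\<exists>c\<in>N x0. c \<noteq> a0 \<and> \<not> E a0 c")
    case True
    then obtain c where "c \<in> N x0" "a0 \<noteq> c" "\<not> E a0 c" by blast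
    moreover have "E d0 a0" using a0(4) by (rule E_sym)
    ultimately show ?thesis using a0(1,2,3) by meson
  next
    case False
    obtain e f where ef: "e \<in> N x0" "f \<in> N x0" "e \<noteq> f" "\<not> E e f"
      using N1[OF a0(1)] unfolding is_clique_def by meson
    have "e \<noteq> a0" using False ef by metis
    then have "E a0 e" using False ef(1) by metis
    moreover have "a0 \<in> Z" using N_F(2)[OF a0(2)] .
    ultimately show ?thesis using a0(1) ef by meson
  qed
  then obtain r0 d where d: "r0 \<in> F - Z" "d \<in> Z" "\<exists>a\<in>N r0. \<exists>c\<in>N r0. a \<noteq> c \<and> \<not> E a c \<and> E d a" by blast
  have dF: "d \<in> F" using d ZF by auto
  define good where "good r \<longleftrightarrow> r \<in> F - Z \<and> (\<exists>a\<in>N r. \<exists>c\<in>N r. a \<noteq> c \<and> \<not> E a c \<and> E d a)" for r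
  have uniq: "y = d" if "r \<in> F - Z" "a \<in> N r" "c \<in> N r" "a \<noteq> c" "\<not> E a c" "E d a" "y \<in> Z" "E a y" for r a c y
  proof -
    have "E d c" by (rule dagger[OF that(1-5) d(2) that(6)])
    have "E y c" by (rule dagger[OF that(1-5,7) E_sym[OF that(8)]])
    then show ?thesis using no_square[OF no_clique_cutset(2) oF, of a y c d] that(4,8) E_sym[OF \<open>E d c\<close>] E_sym[OF that(6)] E_sym[OF \<open>E y c\<close>]
        N_F(1)[OF that(2)] N_F(1)[OF that(3)] dF subsetD[OF ZF that(7)] that(6) \<open>E y c\<close> \<open>E d c\<close> by auto
  qed
  have G: "(z = d \<or> E d z) \<and> (z \<noteq> d \<longrightarrow> (\<forall>y\<in>Z. E z y \<longrightarrow> y = d))" if g: "good r" "z \<in> N r" for r z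
  proof -
    obtain a c where ac: "r \<in> F - Z" "a \<in> N r" "c \<in> N r" "a \<noteq> c" "\<not> E a c" "E d a"
      using g(1) unfolding good_def by blast
    show ?thesis
    proof (cases "z = a")
      case True
      then show ?thesis using uniq[OF ac] ac by blast
    next
      case za: False
      show ?thesis
      proof (cases "E a z")
        case True
        then show ?thesis using uniq[OF ac _ True] N_F(2)[OF g(2)] by blast
      next
        case False
        then have "E d z" using dagger[OF ac(1,2) g(2)] za d(2) ac(6) by blast
        then show ?thesis using uniq[OF ac(1) g(2) ac(2) za] False E_sym by blast
      qed
    qed
  qed
  let ?M = "{x\<in>F - {d}. good x \<or> (\<exists>r. good r \<and> x \<in> N r)}"
  have M: "?M = F - {d}"
  proof (rule connD[of _ _ r0])
    have "is_clique {d}" unfolding is_clique_def by blast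
    then show "conn (F - {d})" using no_clique_cutsetD[OF no_clique_cutset(1), of "{d}"] dF by simp
    show "r0 \<in> ?M" using d unfolding good_def by auto
    fix x y assume x: "x \<in> ?M" and y: "y \<in> F - {d}" "E x y"
    show "y \<in> ?M"
    proof (cases "good x")
      case True
      then have xr: "x \<in> F - Z" unfolding good_def by blast
      show ?thesis
      proof (cases "y \<in> Z")
        case True
        then have "y \<in> N x" using component_root[OF xr] y E_sym unfolding N_def by blast
        then show ?thesis using \<open>good x\<close> y by blast
      next
        case False
        then have "y \<in> ?C x" using component_closed[OF xr component_root[OF xr]] y by blast
        then have "N y = N x" unfolding N_def using component_eq[OF xr] by simp
        then show ?thesis using \<open>good x\<close> y False unfolding good_def by auto
      qed
    next
      case False
      then obtain r where r: "good r" "x \<in> N r" "x \<noteq> d" using x by blast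
      show ?thesis
      proof (cases "y \<in> Z")
        case True
        then show ?thesis using G[OF r(1,2)] r(3) y by blast
      next
        case yZ: False
        then have yr: "y \<in> F - Z" using y by blast
        have xN: "x \<in> N y" using component_root[OF yr] y N_F(2)[OF r(2)] unfolding N_def by blast
        have dx: "E d x" using G[OF r(1,2)] r(3) by blast
        have "\<exists>c\<in>N y. c \<noteq> x \<and> \<not> E x c"
        proof (rule ccontr)
          assume *: "\<not> ?thesis"
          have "N y \<subseteq> {x, d}"
          proof
            fix c assume c: "c \<in> N y"
            then have "c = x \<or> E x c" using * by blast
            moreover have "E x c \<Longrightarrow> c = d" using G[OF r(1,2)] r(3) N_F(2)[OF c] by blast
            ultimately show "c \<in> {x, d}" by blast
          qed
          moreover have "is_clique {x, d}" using dx E_sym[OF dx] unfolding is_clique_def by simp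
          ultimately have "is_clique (N y)" unfolding is_clique_def by blast
          then show False using N1[OF yr] by blast
        qed
        then obtain c where "c \<in> N y" "x \<noteq> c" "\<not> E x c" by metis
        then have "\<exists>a\<in>N y. \<exists>c\<in>N y. a \<noteq> c \<and> \<not> E a c \<and> E d a" using xN dx by meson
        then have "good y" using yr unfolding good_def by simp
        then show ?thesis using y by blast
      qed
    qed
  qed (rule Collect_restrict)
  have "Z = {z\<in>F. z = d \<or> E d z}"
  proof (intro equalityI subsetI)
    fix z assume z: "z \<in> Z"
    show "z \<in> {z\<in>F. z = d \<or> E d z}"
    proof (cases "z = d")
      case False
      then have "z \<in> ?M" unfolding M using z ZF by blast
      moreover have "\<not> good z" using z unfolding good_def by blast
      ultimately show ?thesis using G z ZF by blast
    qed (use z ZF in auto)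
  next
    fix z assume z: "z \<in> {z\<in>F. z = d \<or> E d z}"
    show "z \<in> Z"
    proof (rule ccontr)
      assume "z \<notin> Z"
      then have dz: "E d z" "z \<in> F - Z" "z \<noteq> d" using z d(2) by auto
      then have "z \<in> ?M" unfolding M by blast
      then have "good z" using dz N_F(2) by blast
      then obtain a where a: "a \<in> N z" "E d a" unfolding good_def by blast
      obtain b where b: "b \<in> ?C z" "E a b" using a unfolding N_def by blast
      have aZ: "a \<in> Z" "a \<in> F" using N_F a by auto
      note C = component_subset[OF dz(2)]
      show False
      proof (rule edge_cap[where v = v, OF X(1) _ _ _ _ _ a(2) _ _ component_conn[OF dz(2)] component_root[OF dz(2)] dz(1) b])
        show "\<And>x. x \<in> ?C z \<Longrightarrow> E d x \<Longrightarrow> \<not> E a x" using tri[of a d] a(2) aZ dF C E_sym by blast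
        show "\<And>x. x \<in> ?C z \<Longrightarrow> \<not> E v x" using C Z by blast
      qed (use C Z aZ d F v in auto)
    qed
  qed
  then show ?thesis using dF by blast
qed

lemma conn_image:
  assumes "conn D" "\<And>u v. u \<in> D \<Longrightarrow> v \<in> D \<Longrightarrow> E u v \<Longrightarrow> E (f u) (f v)"
  shows "conn (f ` D)"
  unfolding conn_def
proof (intro allI impI)
  fix A assume A: "A \<subseteq> f ` D" "A \<noteq> {}" "\<forall>x\<in>A. \<forall>y\<in>f ` D. E x y \<longrightarrow> y \<in> A"
  then obtain a where "a \<in> D" "f a \<in> A" by blast
  then have "{x\<in>D. f x \<in> A} = D"
    by (intro connD[OF assms(1), of _ a]) (use A(3) assms(2) in auto)
  then show "A = f ` D" using A(1) by blast
qed

lemma core_image: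
  assumes "core F" "inj_on f F" "\<And>x y. x \<in> F \<Longrightarrow> y \<in> F \<Longrightarrow> E (f x) (f y) \<longleftrightarrow> E x y"
  shows "core (f ` F)"
  unfolding core_def
proof (intro conjI)
  show "finite (f ` F)" "5 \<le> card (f ` F)" using assms(1,2) unfolding core_def by (auto simp: card_image)
  show "triangle_free (f ` F)"
    unfolding triangle_free_def
  proof (intro ballI impI)
    fix u v w assume "u \<in> f ` F" "v \<in> f ` F" "w \<in> f ` F" and e: "E u v" "E v w"
    then obtain x y z where "x \<in> F" "y \<in> F" "z \<in> F" "u = f x" "v = f y" "w = f z" by blast
    then show "\<not> E u w" using e assms(3) core_triangle_free[OF assms(1), of x y z] by simp
  qed
  show "no_clique_cutset (f ` F)"
    unfolding no_clique_cutset_def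
  proof (intro allI impI)
    fix K assume K: "K \<subseteq> f ` F" "is_clique K"
    let ?K = "{x\<in>F. f x \<in> K}"
    have "is_clique ?K"
      unfolding is_clique_def
    proof (intro ballI impI)
      fix u v assume "u \<in> ?K" "v \<in> ?K" "u \<noteq> v"
      then show "E u v" using K(2) assms(2,3) unfolding is_clique_def inj_on_def by (metis (mono_tags, lifting) mem_Collect_eq)
    qed
    then have "conn (F - ?K)" using assms(1) unfolding core_def by (intro no_clique_cutsetD) auto
    then have "conn (f ` (F - ?K))" by (rule conn_image) (use assms(3) in auto)
    moreover have "f ` (F - ?K) = f ` F - K" by auto
    ultimately show "conn (f ` F - K)" by simp
  qed
qed

text \<open>
  A clique contains at most one of the two nonadjacent neighbours of \<open>v\<close>, so it does not cut \<open>v\<close> off.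
\<close>

lemma core_insert:
  assumes F: "core F" and v: "v \<notin> F" and stable: "\<And>a c. a \<in> F \<Longrightarrow> c \<in> F \<Longrightarrow> E v a \<Longrightarrow> E v c \<Longrightarrow> \<not> E a c"
    and ac: "a \<in> F" "c \<in> F" "E v a" "E v c" "a \<noteq> c"
  shows "core (insert v F)"
  unfolding core_def
proof (intro conjI)
  have f: "finite F" "5 \<le> card F" "triangle_free F" "no_clique_cutset F" using F unfolding core_def by auto
  then show "finite (insert v F)" "5 \<le> card (insert v F)" using v by auto
  show "triangle_free (insert v F)"
    using f(3) stable unfolding triangle_free_def by (metis E_irrefl E_sym insert_iff)
  show "no_clique_cutset (insert v F)"
    unfolding no_clique_cutset_def
  proof (intro allI impI)
    fix K assume K: "K \<subseteq> insert v F" "is_clique K"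
    show "conn (insert v F - K)"
    proof (cases "v \<in> K")
      case True
      have "is_clique (K - {v})" using K(2) unfolding is_clique_def by blast
      then have "conn (F - (K - {v}))" using no_clique_cutsetD[OF f(4), of "K - {v}"] K(1) by blast
      moreover have "F - (K - {v}) = insert v F - K" using True v by auto
      ultimately show ?thesis by simp
    next
      case False
      then have c: "conn (F - K)" using no_clique_cutsetD[OF f(4), of K] K by blast
      obtain x where "x \<in> F - K" "E v x"
        using K(2) stable[of a c] ac unfolding is_clique_def by blast
      then have "conn (insert v (F - K))" using conn_insert[OF c, of x v] E_sym by blast
      moreover have "insert v (F - K) = insert v F - K" using False by auto
      ultimately show ?thesis by simp
    qed
  qed
qed

text \<open>
  A clique of a hole has at most two vertices, consecutive ones, and its removal leaves a path.
\<close>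

lemma hole_core:
  assumes cs: "hole_list cs" "5 \<le> length cs"
  shows "core (set cs)"
  unfolding core_def
proof (intro conjI)
  show "finite (set cs)" by simp
  show "5 \<le> card (set cs)" using cs(2) distinct_card[OF hole_list_distinct[OF cs(1)]] by simp
  have rot: "\<exists>p. ipath p \<and> set cs = insert u (set p) \<and> u \<notin> set p \<and> p \<noteq> [] \<and>
      \<not> E (hd p) (last p) \<and> (\<forall>w\<in>set p. E u w \<longleftrightarrow> w = hd p \<or> w = last p)" if u: "u \<in> set cs" for u
  proof -
    obtain p where p: "hole_list (u # p)" "set (u # p) = set cs" using hole_list_at[OF cs(1) u] by blast
    then have q: "ipath p" "u \<notin> set p" "3 \<le> length p" "\<forall>w\<in>set p. E u w \<longleftrightarrow> w = hd p \<or> w = last p"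
      by (simp_all add: hole_list.simps(2))
    then obtain a b t where t: "p = a # b # t" "t \<noteq> []" by (cases p; cases "tl p"; force)
    have "last t \<in> set t" "b \<notin> set t" using t q(1) by auto
    then have "\<not> E (hd p) (last p)" using q(1) t by auto
    moreover have "set cs = insert u (set p)" using p(2) by simp
    moreover have "p \<noteq> []" using t by simp
    ultimately show ?thesis using q by blast
  qed
  show "triangle_free (set cs)"
    unfolding triangle_free_def
  proof (intro ballI impI)
    fix u v w assume uvw: "u \<in> set cs" "v \<in> set cs" "w \<in> set cs" "E u v" "E v w"
    show "\<not> E u w"
    proof
      assume "E u w"
      obtain p where p: "set cs = insert u (set p)" "\<not> E (hd p) (last p)" "\<forall>w\<in>set p. E u w \<longleftrightarrow> w = hd p \<or> w = last p"
        using rot[OF uvw(1)] by blast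
      have "v \<in> set p" "w \<in> set p" using uvw p(1) \<open>E u w\<close> by auto
      then have "v = hd p \<or> v = last p" "w = hd p \<or> w = last p" using p(3) uvw(4) \<open>E u w\<close> by blast+
      then show False using uvw(5) p(2) E_sym[OF uvw(5)] by auto
    qed
  qed
  show "no_clique_cutset (set cs)"
    unfolding no_clique_cutset_def
  proof (intro allI impI)
    fix K assume K: "K \<subseteq> set cs" "is_clique K"
    show "conn (set cs - K)"
    proof (cases "K = {}")
      case True
      obtain u t where "cs = u # t" using cs(1) by (cases cs) auto
      moreover have "ipath t" "3 \<le> length t" "E u (hd t)" if "hole_list (u # t)"
      proof -
        show 1: "ipath t" "3 \<le> length t" using that by (simp_all add: hole_list.simps(2))
        then have "hd t \<in> set t" by (cases t) auto
        then show "E u (hd t)" using that by (simp add: hole_list.simps(2))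
      qed
      ultimately have "successively E cs" using cs(1) ipath_imp_successively[of t] by (cases t) auto
      then show ?thesis using conn_walk_set True by simp
    next
      case False
      then obtain k where k: "k \<in> K" by blast
      obtain p where p: "ipath p" "set cs = insert k (set p)" "k \<notin> set p" "p \<noteq> []" "\<not> E (hd p) (last p)"
          "\<forall>w\<in>set p. E k w \<longleftrightarrow> w = hd p \<or> w = last p"
        using rot[of k] k K(1) by blast
      have ends: "K \<subseteq> {k, hd p, last p}"
      proof
        fix w assume w: "w \<in> K"
        show "w \<in> {k, hd p, last p}"
        proof (cases "w = k")
          case False
          then have "E k w" using K(2) k w unfolding is_clique_def by metis
          moreover have "w \<in> set p" using w K(1) p(2) False by auto
          ultimately show ?thesis using p(6) by auto
        qed simp
      qed
      obtain a t where at: "p = a # t" using p(4) by (cases p) auto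
      obtain s z where sz: "p = s @ [z]" using p(4) by (cases p rule: rev_cases) auto
      have w: "successively E p" using p(1) by (rule ipath_imp_successively)
      have d: "distinct p" using p(1) by (rule ipath_distinct)
      consider "K = {k}" | "K = {k, hd p}" | "K = {k, last p}"
      proof -
        have "hd p = last p \<or> hd p \<notin> K \<or> last p \<notin> K" using K(2) p(5) unfolding is_clique_def by metis
        then show thesis using ends k that by (cases "hd p \<in> K"; cases "last p \<in> K") auto
      qed
      then show ?thesis
      proof cases
        case 1
        then have "set cs - K = set p" using p by auto
        then show ?thesis using conn_walk_set[OF w] by simp
      next
        case 2
        then have "set cs - K = set t" using p at d by auto
        moreover have "successively E t" using w at by (cases t) auto
        ultimately show ?thesis using conn_walk_set by simp
      next
        case 3
        then have "set cs - K = set s" using p sz d by auto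
        moreover have "successively E s" using w sz by (simp add: successively_append_iff)
        ultimately show ?thesis using conn_walk_set by simp
      qed
    qed
  qed
qed

definition max_core :: "'a set \<Rightarrow> 'a set \<Rightarrow> bool" where
  "max_core X F \<longleftrightarrow> F \<subseteq> X \<and> core F \<and> (\<forall>F'\<subseteq>X. core F' \<longrightarrow> card F' \<le> card F)"

definition twin_of :: "'a set \<Rightarrow> 'a \<Rightarrow> 'a \<Rightarrow> bool" where
  "twin_of F d t \<longleftrightarrow> t \<notin> F \<and> d \<in> F \<and> (\<forall>z\<in>F. E t z \<longleftrightarrow> z = d \<or> E d z)"

definition loose :: "'a set \<Rightarrow> 'a \<Rightarrow> bool" where
  "loose F r \<longleftrightarrow> r \<notin> F \<and> (\<forall>a\<in>F. \<forall>c\<in>F. E r a \<longrightarrow> E r c \<longrightarrow> a = c)"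

text \<open>
  A vertex whose neighbours in a largest core form a stable set with at least two elements could be added to the core.
\<close>

lemma max_core_types:
  assumes "no_caps X" "odd_holes X" "max_core X F" "v \<in> X - F"
  obtains "\<forall>z\<in>F. E v z" | d where "twin_of F d v" | "loose F v"
proof (cases "\<exists>a\<in>F. \<exists>c\<in>F. E v a \<and> E v c \<and> E a c")
  case True
  have F: "core F" "F \<subseteq> X" using assms(3) unfolding max_core_def by auto
  obtain a c where ac: "a \<in> {z\<in>F. E v z}" "c \<in> {z\<in>F. E v z}" "E a c" using True by blast
  consider "{z\<in>F. E v z} = F" | d where "d \<in> F" "{z\<in>F. E v z} = {z\<in>F. z = d \<or> E d z}"
    using core_attachment[OF assms(1,2) F assms(4) refl ac] by blast
  then show thesis
  proof cases
    case 1
    then show thesis using that(1) by blast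
  next
    case 2
    then have "twin_of F d v" using assms(4) unfolding twin_of_def by blast
    then show thesis by (rule that(2))
  qed
next
  case False
  have F: "core F" "F \<subseteq> X" "\<And>F'. F' \<subseteq> X \<Longrightarrow> core F' \<Longrightarrow> card F' \<le> card F" using assms(3) unfolding max_core_def by auto
  have "loose F v"
  proof (rule ccontr)
    assume "\<not> ?thesis"
    then obtain a c where ac: "a \<in> F" "c \<in> F" "E v a" "E v c" "a \<noteq> c" using assms(4) unfolding loose_def by blast
    have "core (insert v F)" by (rule core_insert[OF F(1) _ _ ac]) (use False assms(4) in blast)+
    then have "card (insert v F) \<le> card F" using F(2,3) assms(4) by simp
    then show False using assms(4) F(1) unfolding core_def by simp
  qed
  then show thesis by (rule that(3))
qed

text \<open>
  A twin can take the place of the vertex that it doubles. This allows statements about a largest core to be applied to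
  twins as well.
\<close>

lemma max_core_swap:
  assumes "max_core X F" "twin_of F d t" "t \<in> X"
  shows "max_core X (insert t (F - {d}))"
proof -
  let ?f = "\<lambda>x. if x = d then t else x"
  have F: "core F" "F \<subseteq> X" "\<And>F'. F' \<subseteq> X \<Longrightarrow> core F' \<Longrightarrow> card F' \<le> card F" using assms(1) unfolding max_core_def by auto
  have t: "t \<notin> F" "d \<in> F" "\<And>z. z \<in> F \<Longrightarrow> E t z \<longleftrightarrow> z = d \<or> E d z" using assms(2) unfolding twin_of_def by auto
  have im: "?f ` F = insert t (F - {d})" using t(2) by auto
  have inj: "inj_on ?f F" using t(1) unfolding inj_on_def by auto
  have tz: "E z t \<longleftrightarrow> z = d \<or> E z d" if "z \<in> F" for z using t(3)[OF that] E_sym by blast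
  have "E (?f x) (?f y) \<longleftrightarrow> E x y" if "x \<in> F" "y \<in> F" for x y
    using t(3)[OF that(2)] tz[OF that(1)] by auto
  from core_image[OF F(1) inj this] have "core (insert t (F - {d}))" unfolding im .
  moreover have "card (insert t (F - {d})) = card F" using card_image[OF inj] unfolding im .
  ultimately show ?thesis using F(2,3) assms(3) unfolding max_core_def by auto
qed

text \<open>
  If \<open>r\<close> were of another type after the exchange, it would see a vertex of the new core together with all its neighbours,
  at least three vertices, of which at least two belong to \<open>F\<close>.
\<close>

lemma loose_swap:
  assumes X: "no_caps X" "odd_holes X" "max_core X F" and t: "twin_of F d t" "t \<in> X"
    and r: "loose F r" "r \<in> X" "r \<noteq> t"
  shows "loose (insert t (F - {d})) r"
proof -
  let ?F = "insert t (F - {d})"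
  have m: "max_core X ?F" by (rule max_core_swap[OF X(3) t])
  then have c: "core ?F" unfolding max_core_def by blast
  have rF: "r \<in> X - ?F" using r unfolding loose_def by auto
  have bad: False if e: "e \<in> ?F" "\<And>z. z \<in> ?F \<Longrightarrow> z = e \<or> E e z \<Longrightarrow> E r z" for e
  proof -
    obtain a where a: "a \<in> ?F" "E e a" "a \<noteq> t" using core_degree[OF c e(1)] by blast
    obtain b where b: "b \<in> ?F" "E e b" "b \<noteq> a" using core_degree[OF c e(1)] by blast
    have "E r a" "E r b" "E r e" using e a b by auto
    moreover have "a \<in> F" "b \<in> F \<or> e \<in> F" "a \<noteq> e" using a b e(1) by auto
    ultimately show False using r(1) b(3) unfolding loose_def by metis
  qed
  show ?thesis
  proof (rule max_core_types[OF X(1,2) m rF])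
    assume "\<forall>z\<in>?F. E r z"
    then show ?thesis using bad[of t] by blast
  next
    fix e assume "twin_of ?F e r"
    then show ?thesis using bad[of e] unfolding twin_of_def by blast
  qed
qed

text \<open>
  Otherwise the four vertices induce a square.
\<close>

lemma common_nonadjacent_nbrs:
  assumes "odd_holes X" "{u, v, a, c} \<subseteq> X" "E u a" "E u c" "E v a" "E v c" "a \<noteq> c" "\<not> E a c" "u \<noteq> v"
  shows "E u v"
  by (rule square_chord[of X a u c v]) (use assms E_sym in auto)

lemma core_two_nbrs:
  assumes "core F" "d \<in> F"
  obtains a c where "a \<in> F" "c \<in> F" "E d a" "E d c" "a \<noteq> c" "\<not> E a c"
proof -
  obtain a where a: "a \<in> F" "E d a" using core_degree[OF assms] by blast
  obtain c where c: "c \<in> F" "E d c" "c \<noteq> a" using core_degree[OF assms] by blast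
  show thesis using that[of a c] a c core_triangle_free[OF assms(1), of a d c] assms(2) E_sym[OF a(2)] by blast
qed

text \<open>
  Let \<open>s\<close> be nonadjacent to \<open>t\<close>, and exchange \<open>d\<close> for \<open>t\<close> in the core. None of the types of \<open>max_core_types\<close> fits \<open>s\<close>: it sees an edge
  of the new core but not \<open>t\<close>, and if it doubled a vertex \<open>f\<close>, then \<open>f\<close> would be in a triangle with \<open>e\<close> and a
  second neighbour of \<open>f\<close>.
\<close>

lemma twins_adjacent:
  assumes X: "no_caps X" "odd_holes X" "max_core X F"
    and t: "twin_of F d t" "t \<in> X" and s: "twin_of F e s" "s \<in> X" and de: "E d e"
  shows "E t s"
proof (rule ccontr)
  assume no: "\<not> E t s"
  let ?F = "insert t (F - {d})"
  have F: "core F" "F \<subseteq> X" using X(3) unfolding max_core_def by auto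
  note tri = core_triangle_free[OF F(1)]
  have m: "max_core X ?F" by (rule max_core_swap[OF X(3) t])
  then have c: "core ?F" unfolding max_core_def by blast
  have T: "t \<notin> F" "d \<in> F" "\<And>z. z \<in> F \<Longrightarrow> E t z \<longleftrightarrow> z = d \<or> E d z" using t(1) unfolding twin_of_def by auto
  have S: "s \<notin> F" "e \<in> F" "\<And>z. z \<in> F \<Longrightarrow> E s z \<longleftrightarrow> z = e \<or> E e z" using s(1) unfolding twin_of_def by auto
  have ne: "d \<noteq> e" using de by auto
  obtain a where a: "a \<in> F" "E d a" "a \<noteq> e" using core_degree[OF F(1) T(2)] by blast
  have "\<not> E e a" using tri[of e d a] a T S E_sym[OF de] by blast
  then have "s \<noteq> t" using T(3)[OF a(1)] S(3)[OF a(1)] a by auto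
  then have sF: "s \<in> X - ?F" using S s(2) by auto
  obtain y where y: "y \<in> F" "E e y" "y \<noteq> d" using core_degree[OF F(1) S(2)] by blast
  have sE: "E s e" "E s y" "\<not> E s t" using S y no E_sym by auto
  show False
  proof (rule max_core_types[OF X(1,2) m sF])
    assume "\<forall>z\<in>?F. E s z"
    then show False using sE by blast
  next
    assume "loose ?F s"
    then have l: "\<And>a c. a \<in> ?F \<Longrightarrow> c \<in> ?F \<Longrightarrow> E s a \<Longrightarrow> E s c \<Longrightarrow> a = c" unfolding loose_def by blast
    have "e = y" by (rule l) (use sE S(2) y ne in auto)
    with y(2) show False by (metis E_irrefl)
  next
    fix f assume "twin_of ?F f s"
    then have f: "f \<in> ?F" "\<And>z. z \<in> ?F \<Longrightarrow> E s z \<longleftrightarrow> z = f \<or> E f z" unfolding twin_of_def by blast+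
    have te: "E t e" using T(3)[OF S(2)] de by simp
    have fs: "E s f" using f(2)[OF f(1)] by simp
    then have ft: "f \<noteq> t" "f \<in> F" using sE f(1) by auto
    have fe: "f \<noteq> e" using f(2)[of t] sE(3) E_sym[OF te] by auto
    then have fe': "E f e" using f(2)[of e] sE(1) S(2) ne by blast
    obtain w where w: "w \<in> ?F" "E f w" "w \<noteq> e" using core_degree[OF c f(1)] by blast
    have sw: "E s w" using f(2)[OF w(1)] w(2) by blast
    then have "w \<noteq> t" using sE by auto
    then have wF: "w \<in> F" using w(1) by blast
    then have "E e w" using S(3)[OF wF] sw w(3) by blast
    then show False using tri[of e f w] ft(2) wF S(2) w(2) E_sym[OF fe'] by blast
  qed
qed

text \<open>
  Again \<open>d\<close> is exchanged for \<open>t\<close>. If \<open>s\<close> were adjacent to \<open>t\<close>, it would see \<open>t\<close>, \<open>e\<close> and all neighbours of \<open>e\<close>. If it saw the whole new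
  core, then \<open>d\<close> and \<open>e\<close> would have two common neighbours. If it doubled a vertex \<open>f\<close>, then \<open>f\<close> would be in a triangle
  with \<open>e\<close> and another neighbour of \<open>e\<close>.
\<close>

lemma twins_nonadjacent:
  assumes X: "no_caps X" "odd_holes X" "max_core X F"
    and t: "twin_of F d t" "t \<in> X" and s: "twin_of F e s" "s \<in> X" and de: "\<not> E d e" "d \<noteq> e"
  shows "\<not> E t s"
proof
  assume ts: "E t s"
  let ?F = "insert t (F - {d})"
  have F: "core F" "F \<subseteq> X" using X(3) unfolding max_core_def by auto
  note tri = core_triangle_free[OF F(1)]
  have m: "max_core X ?F" by (rule max_core_swap[OF X(3) t])
  have T: "t \<notin> F" "d \<in> F" "\<And>z. z \<in> F \<Longrightarrow> E t z \<longleftrightarrow> z = d \<or> E d z" using t(1) unfolding twin_of_def by auto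
  have S: "s \<notin> F" "e \<in> F" "\<And>z. z \<in> F \<Longrightarrow> E s z \<longleftrightarrow> z = e \<or> E e z" using s(1) unfolding twin_of_def by auto
  have "s \<noteq> t" using ts by auto
  then have sF: "s \<in> X - ?F" using S s(2) by auto
  have te: "\<not> E t e" "t \<noteq> e" using T(3)[OF S(2)] de T(1) S(2) by auto
  have sE: "E s e" "E s t" "e \<in> ?F" "t \<in> ?F" using S ts E_sym de by auto
  show False
  proof (rule max_core_types[OF X(1,2) m sF])
    assume all: "\<forall>z\<in>?F. E s z"
    obtain a c where ac: "a \<in> F" "c \<in> F" "E d a" "E d c" "a \<noteq> c" "\<not> E a c" using core_two_nbrs[OF F(1) T(2)] .
    have "E e z" if "z \<in> F" "E d z" for z
      using all S(3)[OF that(1)] that de by auto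
    then have "E e a" "E e c" using ac by auto
    then have "E d e" by (intro common_nonadjacent_nbrs[OF X(2), of d e a c]) (use ac F(2) T S de in auto)
    then show False using de by simp
  next
    assume "loose ?F s"
    then show False using sE te(2) unfolding loose_def by metis
  next
    fix f assume "twin_of ?F f s"
    then have f: "f \<in> ?F" "\<And>z. z \<in> ?F \<Longrightarrow> E s z \<longleftrightarrow> z = f \<or> E f z" unfolding twin_of_def by blast+
    have 1: "t = f \<or> E f t" "e = f \<or> E f e" using f(2)[OF sE(4)] f(2)[OF sE(3)] sE by auto
    then have ft: "f \<noteq> t" "f \<noteq> e" "E f e" using te E_sym by blast+
    then have fF: "f \<in> F" using f(1) by auto
    obtain y where y: "y \<in> F" "E e y" "y \<noteq> f" using core_degree[OF F(1) S(2)] by blast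
    have "y \<noteq> d" using y de E_sym by blast
    then have "y \<in> ?F" using y by auto
    moreover have "E s y" using S(3)[OF y(1)] y by blast
    ultimately have "E f y" using f(2)[of y] y by blast
    then show False using tri[of f e y] fF y S(2) ft(3) by blast
  qed
qed

lemma is_cliqueD: "is_clique K \<Longrightarrow> u \<in> K \<Longrightarrow> v \<in> K \<Longrightarrow> u \<noteq> v \<Longrightarrow> E u v"
  unfolding is_clique_def by blast

text \<open>
  Suppose that a clique \<open>K\<close> separates a part \<open>J\<close> of \<open>D\<close> from \<open>F\<close>. As \<open>D\<close> is connected and attached to nonadjacent vertices,
  \<open>K\<close> meets \<open>D\<close>. All attachments of \<open>J\<close> lie in \<open>K\<close> and are therefore
  attachments of \<open>K \<inter> D\<close> too. Removing \<open>J\<close> from \<open>D\<close> then leaves a connected set with the same attachments, contrary to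
  the minimality of \<open>D\<close>.
\<close>

lemma core_extend_path:
  assumes F: "core F" and D: "conn D" "finite D" "D \<inter> F = {}" and tf: "triangle_free (F \<union> D)"
    and lab: "p \<in> D" "r \<in> D" "E p x" "E r z" "x \<in> F" "z \<in> F" "x \<noteq> z" "\<not> E x z"
    and min: "\<And>S p r x z. S \<subset> D \<Longrightarrow> conn S \<Longrightarrow> p \<in> S \<Longrightarrow> r \<in> S \<Longrightarrow> E p x \<Longrightarrow> E r z \<Longrightarrow>
      x \<in> F \<Longrightarrow> z \<in> F \<Longrightarrow> x \<noteq> z \<Longrightarrow> E x z"
  shows "core (F \<union> D)"
  unfolding core_def
proof (intro conjI)
  have f: "finite F" "5 \<le> card F" "triangle_free F" "no_clique_cutset F" using F unfolding core_def by auto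
  then show fin: "finite (F \<union> D)" using D by auto
  show "5 \<le> card (F \<union> D)" using f(2) card_mono[OF fin, of F] by auto
  show "triangle_free (F \<union> D)" by (rule tf)
  show "no_clique_cutset (F \<union> D)"
    unfolding no_clique_cutset_def
  proof (intro allI impI)
    fix K assume K: "K \<subseteq> F \<union> D" "is_clique K"
    have "is_clique (K \<inter> F)" using K(2) unfolding is_clique_def by blast
    then have c: "conn (F - K)" using no_clique_cutsetD[OF f(4), of "K \<inter> F"] by (simp add: Diff_Int_distrib Diff_Int)
    have ne: "F - K \<noteq> {}" using K(2) lab(5-8) unfolding is_clique_def by blast
    have "conn ((F - K) \<union> (D - K))"
    proof (rule conn_union_attached[OF c ne])
      fix j assume j: "j \<in> D - K"
      let ?J = "component (D - K) j"
      have J: "?J \<subseteq> D - K" "j \<in> ?J" "conn ?J" using component_subset[OF j] component_root[OF j] component_conn[OF j] by auto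
      show "\<exists>q. q \<noteq> [] \<and> hd q = j \<and> successively E q \<and> set q \<subseteq> F - K \<union> (D - K) \<and> last q \<in> F - K"
      proof (cases "\<exists>k\<in>?J. \<exists>s\<in>F - K. E k s")
        case True
        then obtain k s where k: "k \<in> ?J" "s \<in> F - K" "E k s" by blast
        obtain q where q: "q \<noteq> []" "hd q = j" "last q = k" "successively E q" "set q \<subseteq> ?J"
          using conn_walk[OF J(3,2) k(1)] .
        then show ?thesis
          using k J(1) by (intro exI[of _ "q @ [s]"]) (auto simp: successively_append_iff)
      next
        case False
        then have JK: "s \<in> K" if "k \<in> ?J" "s \<in> F" "E k s" for k s using that by blast
        have "K \<inter> D \<noteq> {}"
        proof
          assume KD: "K \<inter> D = {}"
          have DK: "D - K = D" using KD by blast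
          have "?J = D" using connD[OF D(1), of ?J j] J(1,2) component_closed[OF j] unfolding DK by blast
          then have "x \<in> K" "z \<in> K" using JK lab by blast+
          then show False using is_cliqueD[OF K(2) _ _ lab(7)] lab(8) by blast
        qed
        then obtain k where k: "k \<in> K" "k \<in> D" by blast
        let ?D' = "D - ?J"
        have kD': "k \<in> ?D'" using k J(1) by blast
        have sub: "?D' \<subset> D" using J(1,2) by blast
        have lab': "\<exists>k'\<in>?D'. E k' s" if s: "p' \<in> D" "E p' s" "s \<in> F" for p' s
        proof (cases "p' \<in> ?J")
          case True
          then have "s \<in> K" using JK s by blast
          moreover have "s \<noteq> k" using s(3) k(2) D(3) by blast
          ultimately have "E k s" using is_cliqueD[OF K(2) k(1), of s] by simp
          then show ?thesis using kD' by blast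
        qed (use s in blast)
        have "conn ?D'"
          unfolding conn_def
        proof (intro allI impI)
          fix A assume A: "A \<subseteq> ?D'" "A \<noteq> {}" "\<forall>u\<in>A. \<forall>v\<in>?D'. E u v \<longrightarrow> v \<in> A"
          show "A = ?D'"
          proof (cases "A \<inter> K = {}")
            case True
            obtain a where a: "a \<in> A" using A(2) by blast
            have "A = D"
            proof (rule connD[OF D(1) _ a])
              show "A \<subseteq> D" using A(1) by blast
              fix u v assume uv: "u \<in> A" "v \<in> D" "E u v"
              have "v \<notin> ?J"
              proof
                assume "v \<in> ?J"
                moreover have "u \<in> D - K" using uv(1) A(1) True by blast
                ultimately have "u \<in> ?J" using component_closed[OF j, of v u] E_sym[OF uv(3)] by blast
                then show False using uv(1) A(1) by blast
              qed
              then show "v \<in> A" using A(3) uv by blast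
            qed
            then show ?thesis using A(1) sub by blast
          next
            case False
            then obtain a where a: "a \<in> A" "a \<in> K" by blast
            have KA: "K \<inter> D \<subseteq> A"
            proof
              fix b assume b: "b \<in> K \<inter> D"
              then have "b \<in> ?D'" using J(1) by blast
              moreover have "b = a \<or> E a b" using is_cliqueD[OF K(2) a(2), of b] b by blast
              ultimately show "b \<in> A" using A(3) a(1) by blast
            qed
            have "A \<union> ?J = D"
            proof (rule connD[OF D(1), of _ a])
              show "A \<union> ?J \<subseteq> D" using A(1) J(1) by blast
              show "a \<in> A \<union> ?J" using a by blast
              fix u v assume uv: "u \<in> A \<union> ?J" "v \<in> D" "E u v"
              show "v \<in> A \<union> ?J"
              proof (cases "v \<in> ?J \<or> v \<in> K")
                case True
                then show ?thesis using KA uv(2) by blast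
              next
                case False
                then have v: "v \<in> ?D'" "v \<in> D - K" using uv(2) by auto
                then have "u \<notin> ?J" using component_closed[OF j, of u v] uv(3) False by blast
                then show ?thesis using A(3) uv v by blast
              qed
            qed
            then show ?thesis using A(1) by blast
          qed
        qed
        moreover obtain p' r' where "p' \<in> ?D'" "E p' x" "r' \<in> ?D'" "E r' z"
          using lab'[OF lab(1,3,5)] lab'[OF lab(2,4,6)] by blast
        ultimately have "E x z" using min[OF sub] lab(5-7) by blast
        then show ?thesis using lab(8) by contradiction
      qed
    qed
    moreover have "(F - K) \<union> (D - K) = F \<union> D - K" by blast
    ultimately show "conn (F \<union> D - K)" by simp
  qed
qed

text \<open>
  Otherwise adding to \<open>F\<close> a shortest path \<open>P\<close> through \<open>C\<close> between nonadjacent attachments gives a larger core. Triangles are the only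
  obstacle, and since loose vertices have at most one neighbour in \<open>F\<close>, one could only arise from two consecutive vertices of \<open>P\<close> with a
  common neighbour in \<open>F\<close>. The first such pair yields a cap.
\<close>

lemma loose_component_clique:
  assumes X: "no_caps X" "odd_holes X" "max_core X F"
    and C: "conn C" "C \<subseteq> X" "\<And>r. r \<in> C \<Longrightarrow> loose F r"
    and at: "d \<in> C" "d' \<in> C" "E d x0" "E d' z0" "x0 \<in> F" "z0 \<in> F" "x0 \<noteq> z0"
  shows "E x0 z0"
proof (rule ccontr)
  assume nE: "\<not> E x0 z0"
  have F: "core F" "F \<subseteq> X" "\<And>F'. F' \<subseteq> X \<Longrightarrow> core F' \<Longrightarrow> card F' \<le> card F" using X(3) unfolding max_core_def by auto
  note tri = core_triangle_free[OF F(1)]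
  have uniqC: "\<forall>c\<in>C. \<forall>s\<in>F. \<forall>t\<in>F. E c s \<longrightarrow> E c t \<longrightarrow> s = t"
    using C(3) unfolding loose_def by blast
  obtain P x z where P: "P \<noteq> []" "ipath P" "set P \<subseteq> C"
    and xz: "x \<in> F" "z \<in> F" "E (hd P) x" "E (last P) z" "x \<noteq> z" "\<not> E x z"
    and lab: "\<And>s. s \<in> F \<Longrightarrow> E (hd P) s \<Longrightarrow> s = x" and lab': "\<And>s. s \<in> F \<Longrightarrow> E (last P) s \<Longrightarrow> s = z"
    and inner: "\<And>p s. p \<in> set P \<Longrightarrow> p \<noteq> hd P \<Longrightarrow> p \<noteq> last P \<Longrightarrow> s \<in> F \<Longrightarrow> E p s \<Longrightarrow> E x s \<and> E s z"
    and min: "\<And>p' x z. p' \<noteq> [] \<Longrightarrow> successively E p' \<Longrightarrow> set p' \<subseteq> C \<Longrightarrow> x \<in> F \<Longrightarrow> z \<in> F \<Longrightarrow>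
      E (hd p') x \<Longrightarrow> E (last p') z \<Longrightarrow> x \<noteq> z \<Longrightarrow> \<not> E x z \<Longrightarrow> length P \<le> length p'"
    by (rule shortest_attaching_path[OF C(1) uniqC at nE]) (rule that)
  have hl: "hd P \<in> set P" "last P \<in> set P" using P(1) by auto
  have uniq: "s = t" if "q \<in> set P" "s \<in> F" "t \<in> F" "E q s" "E q t" for q s t
    using uniqC that P(3) by blast
  have PF: "set P \<inter> F = {}" using P(3) C(3) unfolding loose_def by blast
  have oF: "triangle_free F" "odd_holes F" using F(1,2) X(2) odd_holes_mono unfolding core_def by blast+
  have same: "s = s'" if "s \<in> F" "s' \<in> F" "E x s" "E s z" "E x s'" "E s' z" for s s'
    using no_square[OF oF, of x s z s'] that xz(1,2,5) E_sym[OF that(5)] E_sym[OF that(6)] by auto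
  have sX: "set P \<subseteq> X" using P(3) C(2) by blast
  \<comment> \<open>Consecutive vertices \<open>p\<close>, \<open>r\<close> of \<open>P\<close> have no common neighbour \<open>s\<close> in \<open>F\<close>. For the first such pair, let \<open>g\<close> be the last neighbour
    of \<open>s\<close> before \<open>p\<close>; the stretch from \<open>g\<close> to \<open>p\<close> closes with \<open>s\<close> to a hole, and \<open>r\<close> forms a cap with it.\<close>
  have cons: "\<not> (E p s \<and> E r s)" if "P = a @ p # r # b" "s \<in> F" for a p r b s
    using that
  proof (induction a arbitrary: p r b rule: length_induct)
    case (1 a)
    note eq = 1(2) and s = 1(3)
    show ?case
    proof
      assume ps: "E p s \<and> E r s"
      have d: "distinct P" using P(2) by (rule ipath_distinct)
      have pr: "p \<in> set P" "r \<in> set P" "r \<noteq> hd P" "p \<noteq> last P"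
        using d[unfolded eq] unfolding eq by (cases a; auto)+
      have sx: "s \<noteq> x"
      proof
        assume "s = x"
        show False
        proof (cases "r = last P")
          case True then show False using lab'[OF s] ps \<open>s = x\<close> xz(5) by simp
        next
          case False
          then have "E x s" using inner[OF pr(2,3) _ s] ps by blast
          then show False using \<open>s = x\<close> by simp
        qed
      qed
      have ph: "p \<noteq> hd P" using lab[OF s] ps sx by blast
      then have "a \<noteq> []" using eq by auto
      have Exs: "E x s" "E s x" using inner[OF pr(1) ph pr(4) s] ps E_sym by blast+
      obtain a1 g a2 where g: "x # a = a1 @ g # a2" "E s g" "\<forall>q\<in>set a2. \<not> E s q"
        using split_list_last_prop[of "x # a" "E s"] Exs by auto
      have "a2 \<noteq> []"
      proof
        assume "a2 = []"
        then obtain a1' where "a = a1' @ [g]" using g(1) \<open>a \<noteq> []\<close> by (cases a1) auto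
        then show False using 1(1)[rule_format, of a1' g p "r # b"] eq s g(2) ps E_sym by auto
      qed
      have ipx: "ipath (x # P)"
      proof -
        have "x \<notin> set P" using PF xz(1) by blast
        moreover have "E x u \<longleftrightarrow> u = hd P" if u: "u \<in> set P" for u
        proof
          assume "E x u"
          then have ux: "E u x" by (rule E_sym)
          show "u = hd P"
          proof (rule ccontr)
            assume "u \<noteq> hd P"
            then show False using inner[OF u _ _ xz(1) ux] lab'[OF xz(1)] ux xz(5) by (cases "u = last P") auto
          qed
        qed (use xz(3) E_sym in blast)
        ultimately show ?thesis using P(2) by simp
      qed
      have split: "x # P = a1 @ ((g # a2 @ [p]) @ r # b)" using g(1) eq by (metis append.assoc append_Cons append_Nil)
      have ip2: "ipath ((g # a2 @ [p]) @ r # b)" using ipx unfolding split ipath_append[of a1] by blast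
      then have ipp: "ipath (g # a2 @ [p])" "ipath (r # b)"
        and pr': "\<And>u. u \<in> set (g # a2 @ [p]) \<Longrightarrow> E u r \<longleftrightarrow> u = p" "r \<notin> set (g # a2 @ [p])"
        unfolding ipath_append[of "g # a2 @ [p]"] by auto
      have "ipath (rev (g # a2 @ [p]))" using ipp(1) by (rule ipath_rev)
      then have rv: "ipath (p # rev a2 @ [g])" by simp
      have sin: "set (g # a2 @ [p]) \<subseteq> insert x (set P)" 
      proof -
        have "set (g # a2 @ [p]) \<subseteq> set (x # P)" unfolding split by auto
        then show ?thesis by simp
      qed
      have snot: "s \<notin> set (g # a2 @ [p])" "s \<noteq> r" using sin sx PF s pr(2) by auto
      have "hole_list (s # p # rev a2 @ [g])"
        using rv snot g(2,3) ps E_sym[of p s] \<open>a2 \<noteq> []\<close> by (cases a2) (auto simp: hole_list.simps(2))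
      moreover have "set (s # p # rev a2 @ [g]) \<subseteq> X" using sin sX s F(2) xz(1) by auto
      moreover have "r \<in> X - set (s # p # rev a2 @ [g])" using pr(2) sX pr'(2) snot(2) by auto
      moreover have "E r s" "E r p" using ps pr'(1)[of p] E_sym by auto
      ultimately obtain q where q: "q \<in> set (rev a2 @ [g])" "E r q" using no_capsD[OF X(1)] by blast
      then have "q = p" using pr'(1)[of q] E_sym by auto
      then show False using q(1) ipath_distinct[OF ipp(1)] by auto
    qed
  qed
  have adj: False if pr: "p \<in> set P" "r \<in> set P" "E p r" and s: "s \<in> F" "E p s" "E r s" for p r s
  proof -
    obtain a b where ab: "P = a @ p # b" using pr(1) by (meson split_list)
    have "p \<noteq> r" using pr(3) by auto
    then consider "r \<in> set a" | "r \<in> set b" using pr(2) ab by auto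
    then show False
    proof cases
      case 1
      then have "a \<noteq> []" by auto
      have "E r p \<longleftrightarrow> r = last a" using P(2) 1 unfolding ab ipath_append by simp
      then have "r = last a" using E_sym[OF pr(3)] by simp
      then have "P = butlast a @ r # p # b" using ab \<open>a \<noteq> []\<close> by simp
      then show False using cons s by blast
    next
      case 2
      have "ipath (p # b)" using P(2) unfolding ab ipath_append by blast
      then have "r = hd b" using 2 pr(3) by simp
      then have "P = a @ p # r # tl b" using ab 2 by (cases b) auto
      then show False using cons s by blast
    qed
  qed
  have triP: "triangle_free (set P)"
    unfolding triangle_free_def
  proof (intro ballI impI notI)
    fix u v w assume "u \<in> set P" "v \<in> set P" "w \<in> set P" "E u v" "E v w" "E u w"
    have "ipath p \<Longrightarrow> u \<in> set p \<Longrightarrow> v \<in> set p \<Longrightarrow> w \<in> set p \<Longrightarrow> E u v \<Longrightarrow> E v w \<Longrightarrow> E u w \<Longrightarrow> False" for p u v w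
    proof (induction p)
      case (Cons q p)
      have n: "\<And>v. v \<in> set p \<Longrightarrow> E q v \<longleftrightarrow> v = hd p" "\<And>v. v \<in> set p \<Longrightarrow> E v q \<longleftrightarrow> v = hd p" "ipath p"
        using Cons.prems(1) E_commute[of q] by auto
      consider "u = q" | "v = q" | "w = q" | "u \<in> set p" "v \<in> set p" "w \<in> set p" using Cons.prems by auto
      then show ?case
      proof cases
        case 1
        then have "v \<in> set p" "w \<in> set p" using Cons.prems by auto
        then have "v = w" using n(1) Cons.prems 1 by metis
        then show False using Cons.prems(6) by simp
      next
        case 2
        then have "u \<in> set p" "w \<in> set p" using Cons.prems by auto
        then have "u = w" using n(1,2) Cons.prems 2 by metis
        then show False using Cons.prems(7) by simp
      next
        case 3
        then have "u \<in> set p" "v \<in> set p" using Cons.prems by auto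
        then have "u = v" using n(2) Cons.prems 3 by metis
        then show False using Cons.prems(5) by simp
      next
        case 4
        then show False using Cons.IH[OF n(3)] Cons.prems by blast
      qed
    qed simp
    then show False using P(2) \<open>u \<in> set P\<close> \<open>v \<in> set P\<close> \<open>w \<in> set P\<close> \<open>E u v\<close> \<open>E v w\<close> \<open>E u w\<close> by blast
  qed
  have tf: "triangle_free (F \<union> set P)"
    unfolding triangle_free_def
  proof (intro ballI impI notI)
    fix u v w assume uvw: "u \<in> F \<union> set P" "v \<in> F \<union> set P" "w \<in> F \<union> set P" "E u v" "E v w" "E u w"
    have two: False if "q \<in> set P" "s \<in> F" "t \<in> F" "E q s" "E q t" "E s t" for q s t
      using uniq[OF that(1-5)] that(6) by simp
    note sy = E_sym[OF uvw(4)] E_sym[OF uvw(5)] E_sym[OF uvw(6)]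
    consider "u \<in> F" "v \<in> F" "w \<in> F" | "u \<in> set P" "v \<in> F" "w \<in> F" | "u \<in> F" "v \<in> set P" "w \<in> F"
      | "u \<in> F" "v \<in> F" "w \<in> set P" | "u \<in> F" "v \<in> set P" "w \<in> set P" | "u \<in> set P" "v \<in> F" "w \<in> set P"
      | "u \<in> set P" "v \<in> set P" "w \<in> F" | "u \<in> set P" "v \<in> set P" "w \<in> set P" using uvw(1-3) by blast
    then show False
    proof cases
      case 1 then show False using tri uvw by blast
    next
      case 2 then show False using two[of u v w] uvw by blast
    next
      case 3 then show False using two[of v u w] uvw sy by blast
    next
      case 4 then show False using two[of w u v] uvw sy by blast
    next
      case 5 then show False using adj[of v w u] uvw sy by blast
    next
      case 6 then show False using adj[of u w v] uvw sy by blast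
    next
      case 7 then show False using adj[of u v w] uvw sy by blast
    next
      case 8 then show False using triangle_freeD[OF triP] uvw by blast
    qed
  qed
  have "core (F \<union> set P)"
  proof (rule core_extend_path[OF F(1) _ _ PF tf hl xz(3,4,1,2,5,6)])
    show "conn (set P)" using P(2) by (simp add: conn_walk_set ipath_imp_successively)
    fix S p r x z assume S: "S \<subset> set P" "conn S" "p \<in> S" "r \<in> S" "E p x" "E r z" "x \<in> F" "z \<in> F" "x \<noteq> z"
    show "E x z"
    proof (rule ccontr)
      assume "\<not> E x z"
      obtain q where q: "q \<noteq> []" "hd q = p" "last q = r" "successively E q" "set q \<subseteq> S"
        using conn_walk[OF S(2-4)] .
      obtain q' where q': "q' \<noteq> []" "ipath q'" "set q' \<subseteq> S" "hd q' = p \<and> last q' = r"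
        by (rule shortest_walk[of "\<lambda>a b. a = p \<and> b = r" q S]) (use q that in auto)
      have "length P \<le> length q'"
        by (rule min[of q' x z]) (use q' S P(3) ipath_imp_successively \<open>\<not> E x z\<close> in auto)
      also have "\<dots> = card (set q')" using ipath_distinct[OF q'(2)] by (simp add: distinct_card)
      also have "\<dots> < card (set P)" using q'(3) S(1) by (intro psubset_card_mono) auto
      also have "\<dots> \<le> length P" by (rule card_length)
      finally show False by simp
    qed
  qed simp
  then have "card (F \<union> set P) \<le> card F" using F(3)[of "F \<union> set P"] F(2) sX by simp
  moreover have "card (F \<union> set P) = card F + card (set P)"
    using F(1) PF by (intro card_Un_disjoint) (auto simp: core_def)
  moreover have "card (set P) \<noteq> 0" using P(1) by simp
  ultimately show False by simp
qed

text \<open>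
  The neighbours of \<open>a\<close> that are attached to the component of \<open>b\<close> in the set of non-neighbours of \<open>a\<close> separate \<open>a\<close> from \<open>b\<close>; so they do not form a
  clique, and two nonadjacent ones lie on a hole through \<open>a\<close> and the component.
\<close>

lemma hole_exists:
  assumes "no_clique_cutset X" "a \<in> X" "b \<in> X" "a \<noteq> b" "\<not> E a b"
  obtains cs where "hole_list cs" "set cs \<subseteq> X"
proof -
  let ?Z = "{x\<in>X. x = a \<or> E a x}"
  have b: "b \<in> X - ?Z" using assms by auto
  let ?B = "component (X - ?Z) b"
  let ?N = "{z\<in>?Z. \<exists>b'\<in>?B. E z b'}"
  note B = component_subset[OF b] component_root[OF b] component_conn[OF b]
  have aN: "a \<notin> ?N" using B(1) by auto
  have "\<not> is_clique ?N"
  proof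
    assume "is_clique ?N"
    then have "conn (X - ?N)" by (intro no_clique_cutsetD[OF assms(1)]) auto
    then have "?B = X - ?N"
    proof (rule connD[OF _ _ B(2)])
      show "?B \<subseteq> X - ?N" using B(1) by auto
      fix x y assume xy: "x \<in> ?B" "y \<in> X - ?N" "E x y"
      then have "y \<notin> ?Z" using E_sym[OF xy(3)] by blast
      then show "y \<in> ?B" using component_closed[OF b xy(1) _ xy(3)] xy(2) by blast
    qed
    then show False using aN assms(2) B(1) by blast
  qed
  then obtain k k' where k: "k \<in> ?N" "k' \<in> ?N" "k \<noteq> k'" "\<not> E k k'" unfolding is_clique_def by blast
  then obtain d d' where d: "d \<in> ?B" "d' \<in> ?B" "E k d" "E k' d'" by blast
  obtain Q where Q: "Q \<noteq> []" "ipath Q" "set Q \<subseteq> ?B" "\<And>q. q \<in> set Q \<Longrightarrow> E k q \<longleftrightarrow> q = hd Q"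
      "\<And>q. q \<in> set Q \<Longrightarrow> E k' q \<longleftrightarrow> q = last Q"
    by (rule path_through[OF B(3) d]) (rule that)
  have kk: "k \<noteq> a" "k' \<noteq> a" "E a k" "E a k'" "k \<in> X" "k' \<in> X" using k aN by auto
  have QZ: "set Q \<inter> ?Z = {}" using Q(3) B(1) by blast
  then have QQ: "k \<notin> set Q" "k' \<notin> set Q" "a \<notin> set Q" "\<And>q. q \<in> set Q \<Longrightarrow> \<not> E a q"
    using k assms(2) Q(3) B(1) by blast+
  have "ipath (Q @ [k'])" using Q QQ E_commute[of _ k'] by (auto simp: ipath_append)
  then have "ipath (k # Q @ [k'])" using Q(1,4) QQ(1) k(3,4) by (auto simp: hd_append)
  moreover have "3 \<le> length (k # Q @ [k'])" using Q(1) by (cases Q) auto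
  ultimately have "hole_list (a # k # Q @ [k'])"
    using QQ kk by (auto simp: hole_list.simps(2))
  moreover have "set (a # k # Q @ [k']) \<subseteq> X" using kk assms(2) Q(3) B(1) by auto
  ultimately show thesis by (rule that)
qed

lemma swap_in:
  assumes X: "no_caps X" "odd_holes X" "max_core X F" and x: "d \<in> F" "x \<in> X" "x = d \<or> twin_of F d x"
  shows "max_core X (insert x (F - {d}))"
    and "r \<in> X \<Longrightarrow> loose F r \<Longrightarrow> r \<noteq> x \<Longrightarrow> loose (insert x (F - {d})) r"
proof -
  have "insert x (F - {d}) = F" if "x = d" using that x(1) by auto
  then show "max_core X (insert x (F - {d}))" 
    "r \<in> X \<Longrightarrow> loose F r \<Longrightarrow> r \<noteq> x \<Longrightarrow> loose (insert x (F - {d})) r"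
    using max_core_swap[OF X(3) _ x(2)] loose_swap[OF X _ x(2)] x X(3) by auto
qed

text \<open>
  Both \<open>v\<close> and \<open>w\<close> see two nonadjacent neighbours of a vertex of \<open>F\<close>, so \<open>common_nonadjacent_nbrs\<close> applies.
\<close>

lemma full_adjacent:
  assumes X: "odd_holes X" "max_core X F" and v: "v \<in> X - F" "\<forall>z\<in>F. E v z"
    and w: "w \<in> X" "w \<noteq> v" "w \<in> F \<or> (\<forall>z\<in>F. E w z) \<or> twin_of F e w"
  shows "E v w"
proof -
  have F: "core F" "F \<subseteq> X" using X(2) unfolding max_core_def by auto
  obtain d where dF: "d \<in> F" "w \<in> F \<or> (\<forall>z\<in>F. E d z \<longrightarrow> E w z)"
  proof (cases "twin_of F e w")
    case True
    then show ?thesis using that[of e] unfolding twin_of_def by blast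
  next
    case False
    have "F \<noteq> {}" using F(1) unfolding core_def by auto
    then show ?thesis using that w(3) False by blast
  qed
  obtain a c where ac: "a \<in> F" "c \<in> F" "E d a" "E d c" "a \<noteq> c" "\<not> E a c" using core_two_nbrs[OF F(1) dF(1)] .
  show ?thesis
  proof (cases "w \<in> F")
    case False
    then show ?thesis
      using dF(2) ac F(2) v w(1,2) by (intro common_nonadjacent_nbrs[OF X(1), of v w a c]) auto
  qed (use v in auto)
qed

text \<open>
  Let \<open>F\<close> be a largest core. The vertices outside a component \<open>C\<close> of loose vertices to which \<open>C\<close> is attached form a clique:
  vertices adjacent to all of \<open>F\<close> see all non-loose vertices, and two nonadjacent twins or members of \<open>F\<close> can be exchanged into \<open>F\<close>, where
  \<open>loose_component_clique\<close> applies. As \<open>F\<close> is not a clique, this clique would be a cutset, so there are no loose vertices. Then a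
  vertex adjacent to all of \<open>F\<close> is adjacent to every vertex, and a twin has the same neighbours as the vertex of \<open>F\<close> that it doubles.
  Both are excluded, which leaves only \<open>F\<close>.
\<close>

theorem indecomposable_triangle_free:
  assumes X: "finite X" "no_caps X" "odd_holes X" "no_clique_cutset X"
    and nu: "\<And>u. u \<in> X \<Longrightarrow> \<exists>x\<in>X. x \<noteq> u \<and> \<not> E u x"
    and nt: "\<And>u v. u \<in> X \<Longrightarrow> v \<in> X \<Longrightarrow> u \<noteq> v \<Longrightarrow> E u v \<Longrightarrow> \<exists>x\<in>X. x \<noteq> u \<and> x \<noteq> v \<and> E u x \<noteq> E v x"
  shows "triangle_free X"
proof (cases "X = {}")
  case True
  then show ?thesis by (simp add: triangle_free_def)
next
  case False
  then obtain a b where "a \<in> X" "b \<in> X" "a \<noteq> b" "\<not> E a b" using nu by (metis all_not_in_conv)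
  from hole_exists[OF X(4) this] obtain cs where cs: "hole_list cs" "set cs \<subseteq> X" by blast
  have "4 \<le> length cs" using cs(1) by (cases cs) (auto simp: hole_list.simps(2))
  moreover have "odd (length cs)" by (rule odd_holesD[OF X(3) cs])
  ultimately have "5 \<le> length cs" by (cases "length cs = 4") auto
  then have c0: "core (set cs)" by (rule hole_core[OF cs(1)])
  have bd: "\<forall>F. F \<subseteq> X \<and> core F \<longrightarrow> card F < Suc (card X)" using card_mono[OF X(1)] by (simp add: less_Suc_eq_le)
  have "\<exists>F. (F \<subseteq> X \<and> core F) \<and> (\<forall>F'. F' \<subseteq> X \<and> core F' \<longrightarrow> card F' \<le> card F)"
    by (rule ex_has_greatest_nat[OF _ bd, of "set cs"]) (use c0 cs(2) in simp)
  then have "\<exists>F. max_core X F" unfolding max_core_def by (simp add: imp_conjL)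
  then obtain F where m: "max_core X F" ..
  then have F: "F \<subseteq> X" "core F" unfolding max_core_def by simp_all
  obtain d0 where d0: "d0 \<in> F" using F(2) unfolding core_def by fastforce
  have loose_none: False if r: "r \<in> X" "loose F r" for r
  proof -
    let ?L = "{r\<in>X. loose F r}"
    have rL: "r \<in> ?L" using r by blast
    let ?C = "component ?L r"
    note C = component_subset[OF rL] component_root[OF rL] component_conn[OF rL]
    let ?N = "{x\<in>X - ?L. \<exists>b\<in>?C. E x b}"
    have "is_clique ?N"
      unfolding is_clique_def
    proof (intro ballI impI, rule ccontr)
      fix x x' assume xx: "x \<in> ?N" "x' \<in> ?N" "x \<noteq> x'" and nE: "\<not> E x x'"
      then have nE': "\<not> E x' x" using E_sym by blast
      have types: "(y \<in> F \<or> (\<forall>z\<in>F. E y z)) \<or> (\<exists>e. twin_of F e y)" if "y \<in> ?N" for y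
      proof (cases "y \<in> F")
        case False
        then have y: "y \<in> X - F" "\<not> loose F y" using that by auto
        show ?thesis by (rule max_core_types[OF X(2,3) m y(1)]) (use y(2) in blast)+
      qed simp
      have xX: "x \<in> X" "x' \<in> X" using xx by auto
      have "x \<in> F \<or> \<not> (\<forall>z\<in>F. E x z)"
        using full_adjacent[OF X(3) m, of x x'] types[OF xx(2)] xX xx(3) nE by blast
      then have "x \<in> F \<or> (\<exists>e. twin_of F e x)" using types[OF xx(1)] by blast
      then obtain d where d: "d \<in> F" "x = d \<or> twin_of F d x" unfolding twin_of_def by blast
      have "x' \<in> F \<or> \<not> (\<forall>z\<in>F. E x' z)"
        using full_adjacent[OF X(3) m, of x' x] types[OF xx(1)] xX xx(3) nE' by blast
      then have "x' \<in> F \<or> (\<exists>e. twin_of F e x')" using types[OF xx(2)] by blast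
      then obtain e where e: "e \<in> F" "x' = e \<or> twin_of F e x'" unfolding twin_of_def by blast
      have tw: "E t z" if "twin_of F s t" "z = s \<or> E s z" "z \<in> F" for s t z
        using that unfolding twin_of_def by blast
      have tF: "t \<notin> F" if "twin_of F s t" for s t using that unfolding twin_of_def by blast
      have de: "d \<noteq> e"
      proof
        assume "d = e"
        obtain a c where ac: "a \<in> F" "c \<in> F" "E d a" "E d c" "a \<noteq> c" "\<not> E a c" using core_two_nbrs[OF F(2) d(1)] .
        have n: "E x a" "E x c" "E x' a" "E x' c" using d e ac tw \<open>d = e\<close> by blast+
        have "E x x'" by (rule common_nonadjacent_nbrs[OF X(3) _ n ac(5,6) xx(3)]) (use ac F(1) xX in auto)
        then show False using nE by simp
      qed
      have nde: "\<not> E d e"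
      proof
        assume de': "E d e"
        have "E x e \<or> x = d" using d(2) tw[of d x e] de' e(1) by blast
        moreover have "E x' d \<or> x' = e" using e(2) tw[of e x' d] E_sym[OF de'] d(1) by blast
        ultimately show False
          using d(2) e(2) nE nE' de' E_sym twins_adjacent[OF X(2,3) m _ xX(1) _ xX(2) de'] tF d(1) e(1) by blast
      qed
      let ?F1 = "insert x (F - {d})"
      have m1: "max_core X ?F1" by (rule swap_in(1)[OF X(2,3) m d(1) xX(1) d(2)])
      have e1: "e \<in> ?F1" using e(1) de by auto
      have x'1: "x' = e \<or> twin_of ?F1 e x'"
      proof (cases "x' = e")
        case False
        then have t: "twin_of F e x'" using e(2) by blast
        have nex: "\<not> E e x"
        proof
          assume "E e x"
          then have "E x e" by (rule E_sym)
          then show False using d(2) de nde e(1) unfolding twin_of_def by metis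
        qed
        have xe: "x \<noteq> e" using d(2) de tF e(1) by blast
        show ?thesis using t e1 nE' nex xe xx(3) unfolding twin_of_def by auto
      qed simp
      let ?F2 = "insert x' (?F1 - {e})"
      have m2: "max_core X ?F2" by (rule swap_in(1)[OF X(2,3) m1 e1 xX(2) x'1])
      have l2: "loose ?F2 s" if "s \<in> ?C" for s
      proof -
        have s: "s \<in> X" "loose F s" "s \<noteq> x" "s \<noteq> x'" using that C(1) xx by auto
        have "loose ?F1 s" by (rule swap_in(2)[OF X(2,3) m d(1) xX(1) d(2) s(1-3)])
        then show ?thesis by (rule swap_in(2)[OF X(2,3) m1 e1 xX(2) x'1 s(1) _ s(4)])
      qed
      have in2: "x \<in> ?F2" "x' \<in> ?F2" using d(2) de tF e(1) by auto
      obtain q q' where q: "q \<in> ?C" "q' \<in> ?C" "E q x" "E q' x'" using xx E_sym by blast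
      have "?C \<subseteq> X" using C(1) by blast
      from loose_component_clique[OF X(2,3) m2 C(3) this l2 q in2 xx(3)] nE show False by blast
    qed
    then have "conn (X - ?N)" by (rule no_clique_cutsetD[OF X(4), rotated]) auto
    then have "?C = X - ?N"
    proof (rule connD[OF _ _ C(2)])
      show "?C \<subseteq> X - ?N" using C(1) by auto
      fix x y assume xy: "x \<in> ?C" "y \<in> X - ?N" "E x y"
      have "y \<in> ?L" using xy E_sym[OF xy(3)] by blast
      then show "y \<in> ?C" by (rule component_closed[OF rL xy(1) _ xy(3)])
    qed
    moreover have "F \<inter> ?C = {}" using C(1) unfolding loose_def by blast
    ultimately have FN: "F \<subseteq> ?N" using F(1) by blast
    obtain a c where "a \<in> F" "c \<in> F" "a \<noteq> c" "\<not> E a c" using core_two_nbrs[OF F(2) d0] by metis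
    then show False using is_cliqueD[OF \<open>is_clique ?N\<close>] FN by blast
  qed
  have types: "y \<in> F \<or> (\<forall>z\<in>F. E y z) \<or> (\<exists>e. twin_of F e y)" if "y \<in> X" for y
  proof (cases "y \<in> F")
    case False
    then have y: "y \<in> X - F" using that by auto
    show ?thesis by (rule max_core_types[OF X(2,3) m y]) (use loose_none[OF that] in blast)+
  qed simp
  have full_none: False if v: "v \<in> X - F" "\<forall>z\<in>F. E v z" for v
  proof -
    have vX: "v \<in> X" using v by auto
    obtain w where w: "w \<in> X" "w \<noteq> v" "\<not> E v w" using nu[OF vX] by blast
    show False using full_adjacent[OF X(3) m v w(1,2)] types[OF w(1)] w(3) by blast
  qed
  have "t \<in> F" if tX: "t \<in> X" for t
  proof (rule ccontr)
    assume "t \<notin> F"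
    then obtain d where t: "twin_of F d t" using types[OF tX] full_none[of t] tX by blast
    then have T: "d \<in> F" "\<And>z. z \<in> F \<Longrightarrow> E t z \<longleftrightarrow> z = d \<or> E d z" unfolding twin_of_def by blast+
    have dX: "d \<in> X" "t \<noteq> d" using T(1) F(1) \<open>t \<notin> F\<close> by auto
    have "E t d" using T by blast
    then obtain x where x: "x \<in> X" "x \<noteq> t" "x \<noteq> d" "E t x \<noteq> E d x" using nt[OF tX dX] by blast
    then have "x \<notin> F" using T(2) by blast
    then obtain e where e: "twin_of F e x" using types[OF x(1)] full_none[of x] x(1) by blast
    then have S: "e \<in> F" "\<And>z. z \<in> F \<Longrightarrow> E x z \<longleftrightarrow> z = e \<or> E e z" unfolding twin_of_def by blast+
    consider "d = e" | "E d e" | "d \<noteq> e" "\<not> E d e" by blast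
    then show False
    proof cases
      case 1
      obtain a c where ac: "a \<in> F" "c \<in> F" "E d a" "E d c" "a \<noteq> c" "\<not> E a c" using core_two_nbrs[OF F(2) T(1)] .
      have n: "E t a" "E t c" "E x a" "E x c" using T(2) S(2) ac 1 by blast+
      have "E t x" by (rule common_nonadjacent_nbrs[OF X(3) _ n ac(5,6) x(2)[symmetric]]) (use ac F(1) tX x in auto)
      moreover have "E d x" using S(2)[OF T(1)] 1 E_sym by blast
      ultimately show False using x(4) by simp
    next
      case 2
      have "E x d" using S(2)[OF T(1)] E_sym[OF 2] by blast
      then show False using x(4) twins_adjacent[OF X(2,3) m t tX e x(1) 2] E_sym by blast
    next
      case 3
      have "\<not> E d x" using S(2)[OF T(1)] 3 E_sym by blast
      then show False using x(4) twins_nonadjacent[OF X(2,3) m t tX e x(1) 3(2,1)] by blast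
    qed
  qed
  then have "X = F" using F(1) by blast
  then show ?thesis using F(2) unfolding core_def by simp
qed

section \<open>Weighted colourings\<close>

lemma no_caps_mono:
  assumes "no_caps X" "Y \<subseteq> X"
  shows "no_caps Y"
  unfolding no_caps_def
proof (intro allI impI)
  fix d a p v
  assume *: "hole_list (d # a # p)" "set (d # a # p) \<subseteq> Y" "v \<in> Y - set (d # a # p)" "E v d" "E v a"
  then have "set (d # a # p) \<subseteq> X" "v \<in> X - set (d # a # p)" using assms(2) by auto
  then show "\<exists>s\<in>set p. E v s" using no_capsD[OF assms(1)] * by blast
qed

text \<open>
  In constructions, the colours may have any type and the colour sets may be too large: an injection and the choice of subsets
  correct both.
\<close>

lemma set_colouringI:
  fixes \<psi> :: "'a \<Rightarrow> 'c set"
  assumes "finite N" "card N \<le> n" "\<And>v. v \<in> X \<Longrightarrow> \<psi> v \<subseteq> N \<and> s v \<le> card (\<psi> v)"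
    "\<And>u v. u \<in> X \<Longrightarrow> v \<in> X \<Longrightarrow> E u v \<Longrightarrow> \<psi> u \<inter> \<psi> v = {}"
  shows "\<exists>\<phi>. set_colouring n s \<phi> X"
proof -
  obtain f where f: "inj_on f N" "f ` N \<subseteq> {..<n}"
    using card_le_inj[OF assms(1), of "{..<n}"] assms(2) by auto
  have "\<forall>v\<in>X. \<exists>A. A \<subseteq> \<psi> v \<and> card A = s v"
    using assms(3) by (metis obtain_subset_with_card_n)
  then obtain A where A: "\<And>v. v \<in> X \<Longrightarrow> A v \<subseteq> \<psi> v \<and> card (A v) = s v" by metis
  have sub: "A v \<subseteq> N" if "v \<in> X" for v using A[OF that] assms(3)[OF that] by blast
  have "set_colouring n s (\<lambda>v. f ` A v) X"
    unfolding set_colouring_def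
  proof (intro conjI ballI impI)
    fix v assume v: "v \<in> X"
    show "f ` A v \<subseteq> {..<n}" using f(2) sub[OF v] by blast
    show "card (f ` A v) = s v" using A[OF v] inj_on_subset[OF f(1) sub[OF v]] by (simp add: card_image)
  next
    fix u v assume uv: "u \<in> X" "v \<in> X" "E u v"
    then have "A u \<inter> A v = {}" using A[OF uv(1)] A[OF uv(2)] assms(4)[OF uv] by blast
    then show "f ` A u \<inter> f ` A v = {}"
      using inj_on_image_Int[OF f(1) sub[OF uv(1)] sub[OF uv(2)]] by simp
  qed
  then show ?thesis by blast
qed

text \<open>
  There are \<open>\<Omega>\<close> layers, each with its own \<open>2 * q + 1\<close> colours. A vertex occupies layer \<open>j\<close> once for \<open>j < w v\<close> and once for
  \<open>\<Omega> - Suc j < w v\<close>. It gets all colours of a layer that it occupies twice and the colours \<open>c v\<close> of a layer that it occupies once.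
  As \<open>w u + w v \<le> \<Omega>\<close> for an edge, a neighbour of a vertex that occupies a layer twice does not occupy it at all.
  Over all layers, \<open>v\<close> occupies \<open>2 * w v\<close> places, and each contributes at least \<open>q\<close> colours. The layers
  decompose \<open>w\<close> into half-integral points of the polytope given by the edges.
\<close>

lemma set_colouring_layers:
  assumes c: "kneser_col q c X" and w: "\<And>v. v \<in> X \<Longrightarrow> w v \<le> \<Omega>" "\<And>u v. u \<in> X \<Longrightarrow> v \<in> X \<Longrightarrow> E u v \<Longrightarrow> w u + w v \<le> \<Omega>"
  shows "\<exists>\<phi>. set_colouring ((2 * q + 1) * \<Omega>) (\<lambda>v. 2 * q * w v) \<phi> X"
proof -
  define L where "L v j = (if j < w v \<and> \<Omega> - Suc j < w v then {..<2 * q + 1}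
    else if j < w v \<or> \<Omega> - Suc j < w v then c v else {})" for v j
  have cX: "c v \<subseteq> {..<2 * q + 1}" "card (c v) = q" if "v \<in> X" for v using c that unfolding set_colouring_def by auto
  have Lsub: "L v j \<subseteq> {..<2 * q + 1}" if "v \<in> X" for v j using cX[OF that] unfolding L_def by auto
  show ?thesis
  proof (rule set_colouringI[where N = "{..<\<Omega>} \<times> {..<2 * q + 1}" and \<psi> = "\<lambda>v. Sigma {..<\<Omega>} (L v)"])
    show "card ({..<\<Omega>} \<times> {..<2 * q + 1}) \<le> (2 * q + 1) * \<Omega>" by (simp add: card_cartesian_product)
  next
    fix v assume v: "v \<in> X"
    have one: "(\<Sum>j<\<Omega>. if j < w v then q else 0) = q * w v"
    proof -
      have "(\<Sum>j<\<Omega>. if j < w v then q else 0) = (\<Sum>j\<in>{j\<in>{..<\<Omega>}. j < w v}. q)"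
        by (simp add: sum.If_cases Int_def)
      also have "{j\<in>{..<\<Omega>}. j < w v} = {..<w v}" using w(1)[OF v] by auto
      finally show ?thesis by simp
    qed
    have two: "(\<Sum>j<\<Omega>. if \<Omega> - Suc j < w v then q else 0) = q * w v"
      using sum.nat_diff_reindex[of "\<lambda>j. if j < w v then q else 0" \<Omega>] one by simp
    have "2 * q * w v = (\<Sum>j<\<Omega>. (if j < w v then q else 0) + (if \<Omega> - Suc j < w v then q else 0))"
      unfolding sum.distrib one two by simp
    also have "\<dots> \<le> (\<Sum>j<\<Omega>. card (L v j))"
      by (rule sum_mono) (auto simp: L_def cX[OF v])
    also have "\<dots> = card (Sigma {..<\<Omega>} (L v))"
      using finite_subset[OF Lsub[OF v] finite_lessThan] by (subst card_SigmaI) auto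
    finally show "Sigma {..<\<Omega>} (L v) \<subseteq> {..<\<Omega>} \<times> {..<2 * q + 1} \<and> 2 * q * w v \<le> card (Sigma {..<\<Omega>} (L v))"
      using Lsub[OF v] by blast
  next
    fix u v assume uv: "u \<in> X" "v \<in> X" "E u v"
    have "c u \<inter> c v = {}" using c uv unfolding set_colouring_def by blast
    then have "L u j \<inter> L v j = {}" if "j < \<Omega>" for j
      using w(2)[OF uv] that unfolding L_def by auto
    then show "Sigma {..<\<Omega>} (L u) \<inter> Sigma {..<\<Omega>} (L v) = {}" by blast
  qed auto
qed

text \<open>
  The induction removes a clique cutset, a vertex adjacent to all others, or one of two adjacent twins; none of the
  three increases the required number of colours beyond \<open>(2 * q + 1) * \<Omega>\<close>. If none is possible, the graph is triangle-free and
  the Kneser colouring is expanded in layers.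
\<close>

theorem weighted_colouring:
  assumes "finite X" "no_caps X" "odd_holes X" "holes_ge (2 * q + 1) X" "2 \<le> q"
    and "\<And>K. K \<subseteq> X \<Longrightarrow> is_clique K \<Longrightarrow> sum w K \<le> \<Omega>"
  shows "\<exists>\<phi>. set_colouring ((2 * q + 1) * \<Omega>) (\<lambda>v. 2 * q * w v) \<phi> X"
  using assms
proof (induction X arbitrary: w \<Omega> rule: finite_psubset_induct)
  case (psubset X)
  note X = psubset.prems(1-4) and w = psubset.prems(5)
  have IH: "\<exists>\<phi>. set_colouring ((2 * q + 1) * \<Omega>) (\<lambda>v. 2 * q * w v) \<phi> Y"
    if "Y \<subset> X" "\<And>K. K \<subseteq> Y \<Longrightarrow> is_clique K \<Longrightarrow> sum w K \<le> \<Omega>" for Y w \<Omega>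
  proof (rule psubset.IH[OF that(1) _ _ _ X(4) that(2)])
    have "Y \<subseteq> X" using that(1) by blast
    then show "no_caps Y" "odd_holes Y" "holes_ge (2 * q + 1) Y"
      by (rule no_caps_mono[OF X(1)], rule odd_holes_mono[OF X(2)], rule holes_ge_mono[OF X(3)])
  qed
  have wv: "w v \<le> \<Omega>" if "v \<in> X" for v using w[of "{v}"] that unfolding is_clique_def by simp
  have fin: "finite K" if "K \<subseteq> X" for K using that psubset.hyps by (rule finite_subset)
  consider (cutset) "\<not> no_clique_cutset X"
    | (universal) u where "u \<in> X" "\<forall>x\<in>X. x \<noteq> u \<longrightarrow> E u x"
    | (twins) u v where "u \<in> X" "v \<in> X" "u \<noteq> v" "E u v" "\<forall>x\<in>X. x \<noteq> u \<longrightarrow> x \<noteq> v \<longrightarrow> E u x = E v x"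
    | (triangle_free) "triangle_free X"
    using indecomposable_triangle_free[OF psubset.hyps X(1,2)] by metis
  then show ?case
  proof cases
    case cutset
    then obtain K where K: "K \<subseteq> X" "is_clique K" "\<not> conn (X - K)" unfolding no_clique_cutset_def by blast
    then obtain A where A: "A \<subseteq> X - K" "A \<noteq> {}" "\<forall>x\<in>A. \<forall>y\<in>X - K. E x y \<longrightarrow> y \<in> A" "A \<noteq> X - K"
      unfolding conn_def by blast
    have "A \<union> K \<subset> X" "X - A \<subset> X" using A K(1) by blast+
    moreover have "sum w K' \<le> \<Omega>" if "K' \<subseteq> A \<union> K \<or> K' \<subseteq> X - A" "is_clique K'" for K'
      using w[of K'] that A K(1) by blast
    ultimately obtain \<phi> \<psi> where c: "set_colouring ((2 * q + 1) * \<Omega>) (\<lambda>v. 2 * q * w v) \<phi> (A \<union> K)"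
        "set_colouring ((2 * q + 1) * \<Omega>) (\<lambda>v. 2 * q * w v) \<psi> (X - A)"
      using IH[of "A \<union> K" w \<Omega>] IH[of "X - A" w \<Omega>] by metis
    have I: "(A \<union> K) \<inter> (X - A) = K" using A K(1) by blast
    obtain \<chi> where "set_colouring ((2 * q + 1) * \<Omega>) (\<lambda>v. 2 * q * w v) \<chi> ((A \<union> K) \<union> (X - A))"
    proof (rule set_colouring_glue[OF c])
      show "finite ((A \<union> K) \<inter> (X - A))" "is_clique ((A \<union> K) \<inter> (X - A))" unfolding I using K fin by auto
      show "\<not> E u v" if "u \<in> A \<union> K - (X - A)" "v \<in> X - A - (A \<union> K)" for u v using that A K(1) by blast
    qed
    moreover have "(A \<union> K) \<union> (X - A) = X" using A K(1) by blast
    ultimately show ?thesis by auto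
  next
    case (universal u)
    let ?Y = "X - {u}" and ?N = "(2 * q + 1) * (\<Omega> - w u)"
    have "sum w K \<le> \<Omega> - w u" if K: "K \<subseteq> ?Y" "is_clique K" for K
    proof -
      have "is_clique (insert u K)"
        unfolding is_clique_def
      proof (intro ballI impI)
        fix x y assume "x \<in> insert u K" "y \<in> insert u K" "x \<noteq> y"
        then show "E x y" using K universal is_cliqueD[OF K(2)] E_sym by blast
      qed
      then have "sum w (insert u K) \<le> \<Omega>" using w[of "insert u K"] K(1) universal(1) by blast
      moreover have "finite K" "u \<notin> K" using K(1) fin[of K] by auto
      ultimately show ?thesis by simp
    qed
    then obtain \<phi> where \<phi>: "set_colouring ?N (\<lambda>v. 2 * q * w v) \<phi> ?Y" using IH[of ?Y w "\<Omega> - w u"] universal(1) by blast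
    have N: "?N + 2 * q * w u \<le> (2 * q + 1) * \<Omega>"
    proof -
      have "(2 * q + 1) * \<Omega> = ?N + (2 * q + 1) * w u" using wv[OF universal(1)] by (simp flip: distrib_left)
      then show ?thesis by simp
    qed
    show ?thesis
    proof (rule set_colouringI[where N = "{..<(2 * q + 1) * \<Omega>}" and \<psi> = "\<phi>(u := {?N..<?N + 2 * q * w u})"])
      fix v assume v: "v \<in> X"
      show "(\<phi>(u := {?N..<?N + 2 * q * w u})) v \<subseteq> {..<(2 * q + 1) * \<Omega>} \<and>
          2 * q * w v \<le> card ((\<phi>(u := {?N..<?N + 2 * q * w u})) v)"
      proof (cases "v = u")
        case True
        then show ?thesis using N by auto
      next
        case False
        then have "\<phi> v \<subseteq> {..<?N}" "card (\<phi> v) = 2 * q * w v" using \<phi> v unfolding set_colouring_def by auto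
        moreover have "{..<?N} \<subseteq> {..<(2 * q + 1) * \<Omega>}" using N by auto
        ultimately show ?thesis using False by auto
      qed
    next
      fix x y assume xy: "x \<in> X" "y \<in> X" "E x y"
      have sub: "\<phi> v \<subseteq> {..<?N}" if "v \<in> X" "v \<noteq> u" for v using \<phi> that unfolding set_colouring_def by auto
      have dis: "\<phi> v \<inter> {?N..<?N + 2 * q * w u} = {}" if "v \<in> X" "v \<noteq> u" for v
        using sub[OF that] by fastforce
      have "x \<noteq> y" using xy(3) by auto
      then consider "x = u" "y \<noteq> u" | "y = u" "x \<noteq> u" | "x \<noteq> u" "y \<noteq> u" by blast
      then show "(\<phi>(u := {?N..<?N + 2 * q * w u})) x \<inter> (\<phi>(u := {?N..<?N + 2 * q * w u})) y = {}"
      proof cases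
        case 1 then show ?thesis using dis[OF xy(2)] by (simp add: Int_commute)
      next
        case 2 then show ?thesis using dis[OF xy(1)] by simp
      next
        case 3
        then have "\<phi> x \<inter> \<phi> y = {}" using \<phi> xy unfolding set_colouring_def by blast
        then show ?thesis using 3 by simp
      qed
    qed auto
  next
    case (twins u v)
    let ?Y = "X - {v}" and ?w = "w(u := w u + w v)" and ?N = "(2 * q + 1) * \<Omega>"
    have "sum ?w K \<le> \<Omega>" if K: "K \<subseteq> ?Y" "is_clique K" for K
    proof (cases "u \<in> K")
      case True
      have fK: "finite K" "v \<notin> K" using K(1) fin[of K] by auto
      have "is_clique (insert v K)"
        unfolding is_clique_def
      proof (intro ballI impI)
        have vK: "E v x" if "x \<in> K" for x
        proof (cases "x = u")
          case True then show ?thesis using twins(4) E_sym by simp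
        next
          case False
          have "E u x" using is_cliqueD[OF K(2) True that] False by simp
          moreover have "x \<in> X" "x \<noteq> v" using that K(1) by auto
          ultimately show ?thesis using twins(5) False by blast
        qed
        fix x y assume "x \<in> insert v K" "y \<in> insert v K" "x \<noteq> y"
        then show "E x y" using vK is_cliqueD[OF K(2)] E_sym by blast
      qed
      then have "sum w (insert v K) \<le> \<Omega>" using w[of "insert v K"] K(1) twins(2) by blast
      moreover have "sum ?w K = ?w u + sum ?w (K - {u})" using fK True by (simp add: sum.remove)
      moreover have "sum ?w (K - {u}) = sum w (K - {u})" by (rule sum.cong) auto
      moreover have "sum w K = w u + sum w (K - {u})" using fK True by (simp add: sum.remove)
      ultimately show ?thesis using fK by simp
    next
      case False
      then have "sum ?w K = sum w K" by (intro sum.cong) auto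
      then show ?thesis using w[of K] K by auto
    qed
    then obtain \<phi> where \<phi>: "set_colouring ?N (\<lambda>v. 2 * q * ?w v) \<phi> ?Y" using IH[of ?Y ?w \<Omega>] twins(2) by blast
    have uY: "u \<in> ?Y" using twins by auto
    have pu: "\<phi> u \<subseteq> {..<?N}" "card (\<phi> u) = 2 * q * (w u + w v)" using \<phi> uY unfolding set_colouring_def by auto
    then obtain P where P: "P \<subseteq> \<phi> u" "card P = 2 * q * w u"
      by (metis obtain_subset_with_card_n le_add1 distrib_left)
    have cP: "card (\<phi> u - P) = 2 * q * w v"
      using P pu finite_subset[OF P(1)] finite_subset[OF pu(1)] by (subst card_Diff_subset) (auto simp: algebra_simps)
    let ?\<psi> = "\<phi>(u := P, v := \<phi> u - P)"
    show ?thesis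
    proof (rule set_colouringI[where N = "{..<?N}" and \<psi> = ?\<psi>])
      fix x assume x: "x \<in> X"
      show "?\<psi> x \<subseteq> {..<?N} \<and> 2 * q * w x \<le> card (?\<psi> x)"
      proof (cases "x = u \<or> x = v")
        case True
        then show ?thesis using P pu cP twins(3) by auto
      next
        case False
        then have "\<phi> x \<subseteq> {..<?N}" "card (\<phi> x) = 2 * q * w x" using \<phi> x unfolding set_colouring_def by auto
        then show ?thesis using False by auto
      qed
    next
      fix x y assume xy: "x \<in> X" "y \<in> X" "E x y"
      have dis: "\<phi> z \<inter> \<phi> u = {}" if "z \<in> X" "z \<noteq> u" "z \<noteq> v" "E z u \<or> E z v" for z
      proof -
        have "E z u" using that twins(5) E_commute[of z] by metis
        then show ?thesis using \<phi> uY that unfolding set_colouring_def by blast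
      qed
      have sub: "?\<psi> u \<subseteq> \<phi> u" "?\<psi> v \<subseteq> \<phi> u" "?\<psi> u \<inter> ?\<psi> v = {}" using P(1) twins(3) by auto
      consider "x \<in> {u, v}" "y \<in> {u, v}" | "x \<in> {u, v}" "y \<notin> {u, v}" | "x \<notin> {u, v}" "y \<in> {u, v}" | "x \<notin> {u, v}" "y \<notin> {u, v}"
        by blast
      then show "?\<psi> x \<inter> ?\<psi> y = {}"
      proof cases
        case 1
        then have "x = u \<and> y = v \<or> x = v \<and> y = u" using xy(3) by auto
        then show ?thesis using sub(3) by blast
      next
        case 2
        then have "E y u \<or> E y v" using E_sym[OF xy(3)] by auto
        then have "\<phi> y \<inter> \<phi> u = {}" using dis[OF xy(2)] 2 by simp
        moreover have "?\<psi> y = \<phi> y" "?\<psi> x \<subseteq> \<phi> u" using 2 sub(1,2) by auto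
        ultimately show ?thesis by blast
      next
        case 3
        then have "E x u \<or> E x v" using xy(3) by auto
        then have "\<phi> x \<inter> \<phi> u = {}" using dis[OF xy(1)] 3 by simp
        moreover have "?\<psi> x = \<phi> x" "?\<psi> y \<subseteq> \<phi> u" using 3 sub(1,2) by auto
        ultimately show ?thesis by blast
      next
        case 4
        then have "\<phi> x \<inter> \<phi> y = {}" using \<phi> xy unfolding set_colouring_def by blast
        then show ?thesis using 4 by simp
      qed
    qed auto
  next
    case triangle_free
    obtain c where "kneser_col q c X" using kneser_colouring_extends[OF psubset.hyps triangle_free X(2-4)] by blast
    then show ?thesis
    proof (rule set_colouring_layers)
      fix u v assume uv: "u \<in> X" "v \<in> X" "E u v"
      then have "is_clique {u, v}" "u \<noteq> v" using E_sym unfolding is_clique_def by auto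
      then show "w u + w v \<le> \<Omega>" using w[of "{u, v}"] uv by simp
    qed (rule wv)
  qed
qed

end

section \<open>The fractional chromatic number\<close>

definition restrict_to :: "'a pair_pre_digraph \<Rightarrow> 'a set \<Rightarrow> 'a pair_pre_digraph" where
  "restrict_to G S = \<lparr>pverts = S, parcs = parcs G \<inter> S \<times> S\<rparr>"

lemma restrict_to_simps [simp]:
  "pverts (restrict_to G S) = S"
  "parcs (restrict_to G S) = parcs G \<inter> S \<times> S"
  by (simp_all add: restrict_to_def)

lemma pair_graph_simple_graph:
  assumes "pair_graph G"
  shows "simple_graph (\<lambda>u v. (u, v) \<in> parcs G)"
proof -
  interpret pair_graph G by (rule assms)
  show ?thesis
  proof
    show "(u, v) \<in> parcs G \<Longrightarrow> (v, u) \<in> parcs G" for u v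
      using pair_sym_arcs by (auto simp: symmetric_def sym_def)
    show "(u, u) \<notin> parcs G" for u using pair_no_loops[of "(u, u)"] by auto
  qed
qed

lemma pair_graph_restrict_to:
  assumes "pair_graph G" "S \<subseteq> pverts G"
  shows "pair_graph (restrict_to G S)"
proof -
  interpret pair_graph G by (rule assms)
  show ?thesis
    using pair_sym_arcs pair_no_loops pair_finite_verts finite_subset[OF assms(2)]
    by unfold_locales (auto simp: symmetric_def sym_def)
qed

lemma induced_restrict_to:
  assumes "pair_graph G" "S \<subseteq> pverts G"
  shows "induced_subgraph (with_proj (restrict_to G S)) (with_proj G)"
proof -
  interpret pair_graph G by (rule assms)
  interpret S: pair_graph "restrict_to G S" by (rule pair_graph_restrict_to[OF assms])
  have "wf_digraph (with_proj G)" "wf_digraph (with_proj (restrict_to G S))" by unfold_locales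
  then show ?thesis
    using assms(2) unfolding induced_subgraph_def subgraph_def compatible_def by auto
qed

context simple_graph
begin

lemma ipath_nth: "ipath p \<Longrightarrow> i < j \<Longrightarrow> j < length p \<Longrightarrow> E (p ! i) (p ! j) \<longleftrightarrow> j = Suc i"
proof (induction p arbitrary: i j)
  case (Cons x p)
  obtain j' where j: "j = Suc j'" using Cons.prems(2) by (cases j) auto
  show ?case
  proof (cases i)
    case 0
    have "p ! j' \<in> set p" "p \<noteq> []" "distinct p" using Cons.prems j ipath_distinct by auto
    then have "E x (p ! j') \<longleftrightarrow> j' = 0"
      using Cons.prems j by (auto simp: hd_conv_nth nth_eq_iff_index_eq)
    then show ?thesis using 0 j by simp
  next
    case (Suc i')
    then show ?thesis using Cons.IH[of i' j'] Cons.prems j by simp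
  qed
qed simp

lemma hole_list_nth:
  assumes h: "hole_list cs" and ij: "i < length cs" "j < length cs"
  shows "E (cs ! i) (cs ! j) \<longleftrightarrow> j = Suc i mod length cs \<or> i = Suc j mod length cs"
proof -
  have lt: "E (cs ! a) (cs ! b) \<longleftrightarrow> b = Suc a mod length cs \<or> a = Suc b mod length cs"
    if ab: "a < b" "b < length cs" for a b
  proof -
    obtain v p where cs: "cs = v # p" using h by (cases cs) auto
    have p: "ipath p" "3 \<le> length p" "\<And>u. u \<in> set p \<Longrightarrow> E v u \<longleftrightarrow> u = hd p \<or> u = last p"
      using h cs by (simp_all add: hole_list.simps(2))
    obtain b' where b: "b = Suc b'" using ab by (cases b) auto
    have pe: "p \<noteq> []" "distinct p" using p ipath_distinct by auto
    have b': "b' < length p" using ab b cs by simp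
    have m: "Suc a mod length cs = Suc a" using ab by simp
    have m': "Suc b mod length cs = (if Suc b = length cs then 0 else Suc b)" using ab by (simp add: mod_Suc)
    show ?thesis
    proof (cases a)
      case 0
      have "E v (p ! b') \<longleftrightarrow> b' = 0 \<or> b' = length p - 1"
        using p(3)[OF nth_mem[OF b']] pe b' by (simp add: hd_conv_nth last_conv_nth nth_eq_iff_index_eq)
      moreover have "b' = length p - 1 \<longleftrightarrow> Suc b = length cs" using b b' cs by auto
      ultimately show ?thesis using 0 b m m' cs by (auto split: if_splits)
    next
      case (Suc a')
      then have "E (p ! a') (p ! b') \<longleftrightarrow> b' = Suc a'" using ipath_nth[OF p(1)] ab b b' by simp
      then show ?thesis using Suc b m m' ab cs by (auto split: if_splits)
    qed
  qed
  have "4 \<le> length cs" using h by (cases cs) (auto simp: hole_list.simps(2))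
  then have "i = j \<Longrightarrow> ?thesis" using ij by (auto simp: mod_Suc split: if_splits)
  moreover have "i < j \<Longrightarrow> ?thesis" using lt[of i j] ij by simp
  moreover have "j < i \<Longrightarrow> ?thesis" using lt[of j i] ij E_commute[of "cs ! i"] by auto
  ultimately show ?thesis by linarith
qed

end

lemma hole_list_hole:
  fixes G :: "'a pair_pre_digraph"
  assumes G: "pair_graph G" and cs: "simple_graph.hole_list (\<lambda>u v. (u, v) \<in> parcs G) cs" "set cs \<subseteq> pverts G"
  shows "hole G (restrict_to G (set cs))"
  unfolding hole_def
proof (intro conjI exI[of _ "length cs"])
  interpret simple_graph "\<lambda>u v. (u, v) \<in> parcs G" by (rule pair_graph_simple_graph[OF G])
  show "induced_subgraph (with_proj (restrict_to G (set cs))) (with_proj G)"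
    by (rule induced_restrict_to[OF G cs(2)])
  show l: "4 \<le> length cs" using cs(1) by (cases cs) (auto simp: hole_list.simps(2))
  have d: "distinct cs" using cs(1) by (rule hole_list_distinct)
  have n: "Suc i mod length cs < length cs" for i using l by (intro mod_less_divisor) auto
  have e: "(cs ! i, cs ! j) \<in> parcs G \<longleftrightarrow> j = Suc i mod length cs \<or> i = Suc j mod length cs"
    if "i < length cs" "j < length cs" for i j
    using hole_list_nth[OF cs(1) that] .
  show "is_cycle (length cs) (restrict_to G (set cs))"
    unfolding is_cycle_def
  proof (intro conjI exI[of _ "(!) cs"])
    show "3 \<le> length cs" using l by simp
    show "bij_betw ((!) cs) {..<length cs} (pverts (restrict_to G (set cs)))"
      using bij_betw_nth[OF d refl refl] by simp
    show "parcs (restrict_to G (set cs)) =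
        (\<Union>i<length cs. {(cs ! i, cs ! (Suc i mod length cs)), (cs ! (Suc i mod length cs), cs ! i)})"
      (is "_ = ?R")
    proof (intro equalityI subsetI)
      fix a assume "a \<in> parcs (restrict_to G (set cs))"
      then obtain u v where a: "a = (u, v)" "(u, v) \<in> parcs G" "u \<in> set cs" "v \<in> set cs" by auto
      then obtain i j where ij: "i < length cs" "j < length cs" "u = cs ! i" "v = cs ! j"
        by (metis in_set_conv_nth)
      then have "j = Suc i mod length cs \<or> i = Suc j mod length cs" using e a(2) by simp
      then show "a \<in> ?R" using a(1) ij by auto
    next
      fix a assume "a \<in> ?R"
      then obtain i where i: "i < length cs"
        "a = (cs ! i, cs ! (Suc i mod length cs)) \<or> a = (cs ! (Suc i mod length cs), cs ! i)" by auto
      then show "a \<in> parcs (restrict_to G (set cs))"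
        using e[of i "Suc i mod length cs"] e[of "Suc i mod length cs" i] n[of i] by auto
    qed
  qed
qed

lemma hole_list_length:
  assumes G: "pair_graph G" and cs: "simple_graph.hole_list (\<lambda>u v. (u, v) \<in> parcs G) cs"
  shows "hole_length (restrict_to G (set cs)) = length cs"
  using simple_graph.hole_list_distinct[OF pair_graph_simple_graph[OF G] cs] by (simp add: distinct_card)

lemma cap_free_no_caps:
  fixes G :: "'a pair_pre_digraph"
  assumes G: "pair_graph G" and cf: "cap_free G"
  shows "simple_graph.no_caps (\<lambda>u v. (u, v) \<in> parcs G) (pverts G)"
proof -
  interpret simple_graph "\<lambda>u v. (u, v) \<in> parcs G" by (rule pair_graph_simple_graph[OF G])
  show ?thesis
    unfolding no_caps_def
  proof (intro allI impI, rule ccontr)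
    fix d a p v
    assume h: "hole_list (d # a # p)" "set (d # a # p) \<subseteq> pverts G" and v: "v \<in> pverts G - set (d # a # p)"
      and e: "(v, d) \<in> parcs G" "(v, a) \<in> parcs G" and no: "\<not> (\<exists>s\<in>set p. (v, s) \<in> parcs G)"
    let ?S = "set (d # a # p)" and ?K = "restrict_to G (insert v (set (d # a # p)))"
    have sub: "insert v ?S \<subseteq> pverts G" using h v by auto
    have K: "pair_graph ?K" by (rule pair_graph_restrict_to[OF G sub])
    have eq: "restrict_to ?K ?S = restrict_to G ?S" by (auto simp: restrict_to_def)
    have "hole G (restrict_to G ?S)" by (rule hole_list_hole[OF G h])
    moreover have "induced_subgraph (with_proj (restrict_to G ?S)) (with_proj ?K)"
      using induced_restrict_to[OF K, of ?S] unfolding eq by auto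
    ultimately have "hole ?K (restrict_to G ?S)" unfolding hole_def by blast
    moreover have "(d, a) \<in> parcs (restrict_to G ?S)" using h(1) by (auto simp: hole_list.simps(2))
    moreover have "{w \<in> ?S. (v, w) \<in> parcs ?K} = {d, a}" using e no by auto
    ultimately have "is_cap ?K"
      unfolding is_cap_def using K v by (intro conjI exI[of _ "restrict_to G ?S"] exI[of _ v]) auto
    then show False using cf induced_restrict_to[OF G sub] unfolding cap_free_def by blast
  qed
qed

theorem corollary1p2:
  fixes G :: "'a pair_pre_digraph" and q :: nat
  assumes "q \<ge> 2"
    and "pair_graph G"
    and "cap_free G"
    and "even_hole_free G"
    and "\<not> (\<exists>C. hole G C \<and> odd (hole_length C) \<and> hole_length C \<le> 2 * q - 1)"
  shows "fractional_chromatic_number G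
           \<le> (2 * real q + 1) / (2 * real q) * real (clique_number G)"
proof -
  let ?E = "\<lambda>u v. (u, v) \<in> parcs G" and ?V = "pverts G" and ?\<omega> = "clique_number G"
  interpret simple_graph ?E by (rule pair_graph_simple_graph[OF assms(2)])
  have fin: "finite ?V" using assms(2) by (simp add: pair_graph.axioms pair_digraph.axioms pair_fin_digraph.pair_finite_verts)
  have odd: "odd (length cs)" "2 * q + 1 \<le> length cs" if cs: "hole_list cs" "set cs \<subseteq> ?V" for cs
  proof -
    note h = hole_list_hole[OF assms(2) cs] and l = hole_list_length[OF assms(2) cs(1)]
    show o: "odd (length cs)" using h l assms(4) unfolding even_hole_free_def by metis
    then have "\<not> length cs \<le> 2 * q - 1" using h l assms(5) by metis
    then show "2 * q + 1 \<le> length cs" using o by (cases "length cs = 2 * q") auto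
  qed
  have X: "odd_holes ?V" "holes_ge (2 * q + 1) ?V" "no_caps ?V"
    using odd cap_free_no_caps[OF assms(2,3)] unfolding odd_holes_def holes_ge_def by auto
  have "sum (\<lambda>_. 1) K \<le> ?\<omega>" if K: "K \<subseteq> ?V" "is_clique K" for K
  proof -
    have "clique G K" using K unfolding clique_def is_clique_def pairwise_def by blast
    moreover have "finite {card K |K. clique G K}"
      by (rule finite_subset[of _ "card ` Pow ?V"]) (use fin in \<open>auto simp: clique_def\<close>)
    ultimately show ?thesis unfolding clique_number_def by (auto intro: Max_ge)
  qed
  then obtain \<phi> where col: "set_colouring ((2 * q + 1) * ?\<omega>) (\<lambda>v. 2 * q * 1) \<phi> ?V"
    using weighted_colouring[OF fin X(3,1,2) assms(1), of "\<lambda>_. 1" ?\<omega>] by auto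
  note col = col[unfolded set_colouring_def]
  have \<phi>: "\<phi> v \<subseteq> {..<(2 * q + 1) * ?\<omega>}" "card (\<phi> v) = 2 * q" if "v \<in> ?V" for v
    using col that by auto
  have dis: "\<phi> u \<inter> \<phi> v = {}" if "u \<in> ?V" "v \<in> ?V" "(u, v) \<in> parcs G" for u v
    using col that by auto
  define N where "N = {..<(2 * q + 1) * ?\<omega>}"
  \<comment> \<open>The colour classes are stable sets; \<open>w\<close> counts how often a stable set occurs among them.\<close>
  define g where "g i = {v\<in>?V. i \<in> \<phi> v}" for i
  define w where "w S = real (card {i\<in>N. g i = S}) / (2 * real q)" for S
  have st: "stable_set G (g i)" for i
    using dis unfolding stable_set_def pairwise_def g_def by blast
  have fS: "finite {S. stable_set G S}"
    by (rule finite_subset[of _ "Pow ?V"]) (use fin in \<open>auto simp: stable_set_def\<close>)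
  have count: "(\<Sum>S\<in>T. w S) = real (card I) / (2 * real q)"
    if "finite T" "I \<subseteq> N" "g ` I \<subseteq> T" "\<And>S i. S \<in> T \<Longrightarrow> i \<in> N \<Longrightarrow> g i = S \<Longrightarrow> i \<in> I" for T I
  proof -
    have fI: "finite I" using that(2) finite_subset unfolding N_def by blast
    have "(\<Sum>S\<in>T. card {i\<in>N. g i = S}) = (\<Sum>S\<in>T. \<Sum>i\<in>{i\<in>I. g i = S}. 1)"
    proof (rule sum.cong)
      fix S assume "S \<in> T"
      then have "{i\<in>N. g i = S} = {i\<in>I. g i = S}" using that by blast
      then show "card {i\<in>N. g i = S} = (\<Sum>i\<in>{i\<in>I. g i = S}. 1)" by simp
    qed simp
    also have "\<dots> = card I" using sum.group[OF fI that(1,3), of "\<lambda>_. 1::nat"] by simp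
    finally have "(\<Sum>S\<in>T. real (card {i\<in>N. g i = S})) = real (card I)" by (metis of_nat_sum)
    then show ?thesis unfolding w_def by (simp flip: sum_divide_distrib)
  qed
  have tot: "(\<Sum>S | stable_set G S. w S) = (2 * real q + 1) / (2 * real q) * real ?\<omega>"
  proof -
    have "(\<Sum>S | stable_set G S. w S) = real (card N) / (2 * real q)"
      by (rule count) (use fS st in auto)
    then show ?thesis unfolding N_def by (simp add: algebra_simps)
  qed
  have "fractional_colouring G w"
    unfolding fractional_colouring_def
  proof (intro conjI allI impI ballI)
    show "0 \<le> w S" for S unfolding w_def by simp
    fix v assume v: "v \<in> ?V"
    have "(\<Sum>S | stable_set G S \<and> v \<in> S. w S) = real (card (\<phi> v)) / (2 * real q)"
      by (rule count) (use fS st v \<phi>(1)[OF v] in \<open>auto simp: N_def g_def\<close>)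
    then show "1 \<le> (\<Sum>S | stable_set G S \<and> v \<in> S. w S)" using \<phi>(2)[OF v] assms(1) by simp
  qed
  moreover have "bdd_below {(\<Sum>S | stable_set G S. w S) |w. fractional_colouring G w}"
    by (rule bdd_belowI[of _ 0]) (auto simp: fractional_colouring_def intro!: sum_nonneg)
  ultimately have "fractional_chromatic_number G \<le> (\<Sum>S | stable_set G S. w S)"
    unfolding fractional_chromatic_number_def by (intro cInf_lower) auto
  then show ?thesis using tot by simp
qed

end
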